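(* The map $$A_{\mathfrak r}\times M_\Omega(n,\mathfrak e,\mathfrak b)\to M_\Omega(n,\mathfrak e),\qquad (b,y)\mapsto b\cdot y$$ is an algebraic isomorphism.
   Context: Fix a positive integer $n$. For $k\ge 0$ put $d(k)=k(k+1)/2$ and $I_k=\{1,\dots,k\}$. $M(n)$ is the space of complex $n\times n$ matrices; for $x\in M(n)$ and $m\in I_n$, $x_m$ is the upper left $m\times m$ block of $x$. $M_\Omega(n)$ is the Zariski open set of all $x\in M(n)$ such that $x_m$ has $m$ distinct eigenvalues for every $m\in I_n$, and $x_m,x_{m+1}$ have no common eigenvalue for every $m\in I_{n-1}$. $\mathfrak e_{\Omega(n)}$ is the set of all $\nu=(\nu(1),\dots,\nu(n))$, $\nu(m)=\mathrm{diag}(\nu_{1\,m},\dots,\nu_{m\,m})$, such that for each $m\in I_n$ the numbers $\nu_{1\,m},\dots,\nu_{m\,m}$ are distinct and $\nu_{i\,m}\ne\nu_{j\,m+1}$ for all $m\in I_{n-1}$, $i\in I_m$, $j\in I_{m+1}$; it is a Zariski open subset of $\mathbb C^{d(n)}$. Let $$M_\Omega(n,\mathfrak e)=\{(\nu,x)\in\mathfrak e_{\Omega(n)}\times M_\Omega(n)\mid \nu(m)\text{ is } Gl(m)\text{-conjugate to }x_m\ \forall m\in I_n\},$$ with projection $\pi_n(\nu,x)=x$; it is a nonsingular affine variety of dimension $n^2$. For $m\in I_n$, $k\in I_m$ let $r_{d(m-1)+k}(\nu,x)=\nu_{k\,m}$. Poisson structure: on $M(n)$, $[f,g](x)=\mathrm{tr}(x[\nabla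 f(x),\nabla g(x)])$, where $\mathrm{tr}(\nabla f(x)v)=df_x(v)$. Since $\pi_n$ is a local analytic isomorphism onto $M_\Omega(n)$, the structure lifts to $M_\Omega(n,\mathfrak e)$. For a function $\varphi$, $\xi_\varphi$ is the vector field with $\xi_\varphi\psi=[\varphi,\psi]$. Torus: the vector fields $\xi_{r_j}$, $j\in I_{d(n-1)}$, commute and have globally defined complex flows $\exp q\,\xi_{r_j}$ ($q\in\mathbb C$), trivial for $q\in 2\pi i\,\mathbb Z$. The torus $A_{\mathfrak r}\cong(\mathbb C^\times)^{d(n-1)}$, with coordinates $\zeta_1,\dots,\zeta_{d(n-1)}$, acts on $M_\Omega(n,\mathfrak e)$ so that the element with $\zeta_j=e^{q_j}$ for all $j$ acts as $\prod_j\exp q_j\,\xi_{r_j}$. $\mathfrak b_e$ is the set of $x\in M(n)$ with $x_{i+1,i}=1$ for all $i\in I_{n-1}$ and $x_{i,j}=0$ for $i>j+1$ (Hessenberg matrices), and $M_\Omega(n,\mathfrak e,\mathfrak b)=\pi_n^{-1}(\mathfrak b_e\cap M_\Omega(n))$, a closed nonsingular subvariety of $M_\Omega(n,\mathfrak e)$. *)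

theory Defs
  imports
    Complex_Main
    "HOL-Library.FuncSet"
    "Jordan_Normal_Form.Matrix"
    "Jordan_Normal_Form.Char_Poly"
begin

section \<open>Quasi-affine varieties\<close>

text \<open>A quasi-affine variety is given by its set \<open>X\<close> of points together with a set \<open>C\<close> of coordinate
  functions, which is finite and separates the points of \<open>X\<close> wherever this is used below: \<open>C\<close>
  embeds \<open>X\<close> in an affine space, and \<open>poly_functions C\<close> consists of the polynomials in the
  coordinates. The notions of regular function and of morphism are the usual ones for quasi-affine
  varieties: a regular function is locally a quotient of polynomials, a morphism is a Zariski
  continuous map that pulls back regular functions on open sets to regular functions.\<close>

inductive_set poly_functions :: "('a \<Rightarrow> complex) set \<Rightarrow> ('a \<Rightarrow> complex) set"
  for C :: "('a \<Rightarrow> complex) set" where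
  const: "(\<lambda>_. a) \<in> poly_functions C"
| coord: "g \<in> C \<Longrightarrow> g \<in> poly_functions C"
| add: "p \<in> poly_functions C \<Longrightarrow> q \<in> poly_functions C \<Longrightarrow> (\<lambda>x. p x + q x) \<in> poly_functions C"
| mult: "p \<in> poly_functions C \<Longrightarrow> q \<in> poly_functions C \<Longrightarrow> (\<lambda>x. p x * q x) \<in> poly_functions C"

definition zariski_open_in :: "('a \<Rightarrow> complex) set \<Rightarrow> 'a set \<Rightarrow> 'a set \<Rightarrow> bool" where
  "zariski_open_in C X V \<longleftrightarrow>
     (\<exists>S \<subseteq> poly_functions C. V = {x \<in> X. \<exists>p\<in>S. p x \<noteq> 0})"

definition regular_on :: "('a \<Rightarrow> complex) set \<Rightarrow> 'a set \<Rightarrow> ('a \<Rightarrow> complex) \<Rightarrow> bool" where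
  "regular_on C V \<psi> \<longleftrightarrow>
     (\<forall>x\<in>V. \<exists>p\<in>poly_functions C. \<exists>q\<in>poly_functions C.
        q x \<noteq> 0 \<and> (\<forall>z\<in>V. q z \<noteq> 0 \<longrightarrow> \<psi> z = p z / q z))"

definition morphism ::
  "('a \<Rightarrow> complex) set \<Rightarrow> 'a set \<Rightarrow> ('b \<Rightarrow> complex) set \<Rightarrow> 'b set \<Rightarrow> ('a \<Rightarrow> 'b) \<Rightarrow> bool" where
  "morphism C X D Y f \<longleftrightarrow>
     f \<in> X \<rightarrow> Y \<and>
     (\<forall>V. zariski_open_in D Y V \<longrightarrow>
        zariski_open_in C X {x \<in> X. f x \<in> V} \<and>
        (\<forall>\<psi>. regular_on D V \<psi> \<longrightarrow> regular_on C {x \<in> X. f x \<in> V} (\<lambda>x. \<psi> (f x))))"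

definition algebraic_isomorphism ::
  "('a \<Rightarrow> complex) set \<Rightarrow> 'a set \<Rightarrow> ('b \<Rightarrow> complex) set \<Rightarrow> 'b set \<Rightarrow> ('a \<Rightarrow> 'b) \<Rightarrow> bool" where
  "algebraic_isomorphism C X D Y f \<longleftrightarrow>
     morphism C X D Y f \<and>
     (\<exists>g. morphism D Y C X g \<and> (\<forall>x\<in>X. g (f x) = x) \<and> (\<forall>y\<in>Y. f (g y) = y))"

definition prod_coords ::
  "('a \<Rightarrow> complex) set \<Rightarrow> ('b \<Rightarrow> complex) set \<Rightarrow> ('a \<times> 'b \<Rightarrow> complex) set" where
  "prod_coords C D = (\<lambda>g. g \<circ> fst) ` C \<union> (\<lambda>h. h \<circ> snd) ` D"


section \<open>Matrices\<close>

text \<open>The entry usually written \<open>x\<^bsub>i,j\<^esub>\<close>, with \<open>i, j \<ge> 1\<close>, is \<open>x $$ (i - 1, j - 1)\<close>.\<close>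

definition dim_d :: "nat \<Rightarrow> nat" where
  "dim_d k = k * (k + 1) div 2"

definition cutoff :: "nat \<Rightarrow> complex mat \<Rightarrow> complex mat" where
  "cutoff m x = mat m m (\<lambda>(i, j). x $$ (i, j))"

definition mat_trace :: "complex mat \<Rightarrow> complex" where
  "mat_trace A = (\<Sum>i<dim_row A. A $$ (i, i))"

definition mat_bracket :: "complex mat \<Rightarrow> complex mat \<Rightarrow> complex mat" where
  "mat_bracket A B = A * B - B * A"

definition M_Omega :: "nat \<Rightarrow> complex mat set" where
  "M_Omega n = {x \<in> carrier_mat n n.
     (\<forall>m\<in>{1..n}. card {z. eigenvalue (cutoff m x) z} = m) \<and>
     (\<forall>m\<in>{1..<n}. \<nexists>z. eigenvalue (cutoff m x) z \<and> eigenvalue (cutoff (m + 1) x) z)}"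

definition hessenberg :: "nat \<Rightarrow> complex mat set" where
  "hessenberg n = {x \<in> carrier_mat n n.
     (\<forall>i\<in>{1..<n}. x $$ (i, i - 1) = 1) \<and>
     (\<forall>i<n. \<forall>j<n. i > j + 1 \<longrightarrow> x $$ (i, j) = 0)}"


section \<open>The covering\<close>

text \<open>An element \<open>\<nu>\<close> is the tuple of diagonal matrices \<open>\<nu>(1), \<dots>, \<nu>(n)\<close>, represented by a function
  that is \<open>undefined\<close> outside \<open>{1..n}\<close>; \<open>nu_entry \<nu> k m\<close> is \<open>\<nu>\<^bsub>k m\<^esub>\<close>, \<open>1 \<le> k \<le> m\<close>.\<close>

definition nu_entry :: "(nat \<Rightarrow> complex mat) \<Rightarrow> nat \<Rightarrow> nat \<Rightarrow> complex" where
  "nu_entry \<nu> k m = \<nu> m $$ (k - 1, k - 1)"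

definition e_Omega :: "nat \<Rightarrow> (nat \<Rightarrow> complex mat) set" where
  "e_Omega n = {\<nu> \<in> (\<Pi>\<^sub>E m\<in>{1..n}. {D \<in> carrier_mat m m. diagonal_mat D}).
     (\<forall>m\<in>{1..n}. inj_on (\<lambda>k. nu_entry \<nu> k m) {1..m}) \<and>
     (\<forall>m\<in>{1..<n}. \<forall>i\<in>{1..m}. \<forall>j\<in>{1..m + 1}. nu_entry \<nu> i m \<noteq> nu_entry \<nu> j (m + 1))}"

type_synonym point = "(nat \<Rightarrow> complex mat) \<times> complex mat"

definition M_Omega_e :: "nat \<Rightarrow> point set" where
  "M_Omega_e n = {(\<nu>, x). \<nu> \<in> e_Omega n \<and> x \<in> M_Omega n \<and>
     (\<forall>m\<in>{1..n}. similar_mat (\<nu> m) (cutoff m x))}"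

abbreviation proj :: "point \<Rightarrow> complex mat" where
  "proj \<equiv> snd"

definition M_Omega_e_b :: "nat \<Rightarrow> point set" where
  "M_Omega_e_b n = {y \<in> M_Omega_e n. proj y \<in> hessenberg n \<inter> M_Omega n}"

definition point_coords :: "nat \<Rightarrow> (point \<Rightarrow> complex) set" where
  "point_coords n = {\<lambda>y. nu_entry (fst y) k m | k m. m \<in> {1..n} \<and> k \<in> {1..m}} \<union>
                    {\<lambda>y. proj y $$ (i, j) | i j. i < n \<and> j < n}"

definition r_fun :: "nat \<Rightarrow> point \<Rightarrow> complex" where
  "r_fun j y = (THE z. \<exists>m k. 1 \<le> k \<and> k \<le> m \<and> j = dim_d (m - 1) + k \<and> z = nu_entry (fst y) k m)"


section \<open>The lifted Poisson structure\<close>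

definition mat_norm1 :: "complex mat \<Rightarrow> real" where
  "mat_norm1 A = (\<Sum>i<dim_row A. \<Sum>j<dim_col A. cmod (A $$ (i, j)))"

text \<open>Matrices carry no topology in the library; this is the neighbourhood filter of \<open>x\<close> in \<open>M(n)\<close>.\<close>

definition nhds_mat :: "nat \<Rightarrow> complex mat \<Rightarrow> complex mat filter" where
  "nhds_mat n x = inf (filtercomap (\<lambda>u. mat_norm1 (u - x)) (nhds 0)) (principal (carrier_mat n n))"

text \<open>\<open>f\<close> is complex (Frechet) differentiable at \<open>x\<close> with differential \<open>v \<mapsto> tr(G v)\<close>.\<close>

definition has_gradient :: "nat \<Rightarrow> (complex mat \<Rightarrow> complex) \<Rightarrow> complex mat \<Rightarrow> complex mat \<Rightarrow> bool" where
  "has_gradient n f G x \<longleftrightarrow> G \<in> carrier_mat n n \<and>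
     ((\<lambda>u. (f u - f x - mat_trace (G * (u - x))) / of_real (mat_norm1 (u - x))) \<longlongrightarrow> 0)
       (nhds_mat n x)"

text \<open>\<open>s\<close> is the continuous inverse, near \<open>proj y\<close>, of the covering projection, with value \<open>y\<close> at
  \<open>proj y\<close>; as \<open>proj\<close> is a local analytic isomorphism, \<open>s\<close> is a local analytic chart around \<open>y\<close>.\<close>

definition local_section :: "nat \<Rightarrow> point \<Rightarrow> (complex mat \<Rightarrow> point) \<Rightarrow> bool" where
  "local_section n y s \<longleftrightarrow> s (proj y) = y \<and>
     (\<forall>\<^sub>F u in nhds_mat n (proj y). s u \<in> M_Omega_e n \<and> proj (s u) = u \<and>
        (\<forall>g\<in>point_coords n. ((\<lambda>w. g (s w)) \<longlongrightarrow> g (s u)) (nhds_mat n u)))"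

definition has_lifted_gradient :: "nat \<Rightarrow> (point \<Rightarrow> complex) \<Rightarrow> complex mat \<Rightarrow> point \<Rightarrow> bool" where
  "has_lifted_gradient n \<phi> G y \<longleftrightarrow>
     (\<exists>s. local_section n y s \<and> has_gradient n (\<phi> \<circ> s) G (proj y))"

definition lifted_gradient :: "nat \<Rightarrow> (point \<Rightarrow> complex) \<Rightarrow> point \<Rightarrow> complex mat" where
  "lifted_gradient n \<phi> y = (THE G. has_lifted_gradient n \<phi> G y)"

definition holomorphic_fun :: "nat \<Rightarrow> (point \<Rightarrow> complex) \<Rightarrow> bool" where
  "holomorphic_fun n \<psi> \<longleftrightarrow> (\<forall>y\<in>M_Omega_e n. \<exists>G. has_lifted_gradient n \<psi> G y)"

definition poisson :: "nat \<Rightarrow> (point \<Rightarrow> complex) \<Rightarrow> (point \<Rightarrow> complex) \<Rightarrow> point \<Rightarrow> complex" where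
  "poisson n \<phi> \<psi> y =
     mat_trace (proj y * mat_bracket (lifted_gradient n \<phi> y) (lifted_gradient n \<psi> y))"


section \<open>Flows and the torus action\<close>

text \<open>\<open>c\<close> is an integral curve of \<open>\<xi>\<^bsub>\<phi>\<^esub>\<close>, the vector field acting on functions by
  \<open>\<xi>\<^bsub>\<phi>\<^esub> \<psi> = [\<phi>, \<psi>]\<close>. The coordinates are among the functions \<open>\<psi>\<close>, so \<open>c\<close> is holomorphic.\<close>

definition integral_curve :: "nat \<Rightarrow> (point \<Rightarrow> complex) \<Rightarrow> (complex \<Rightarrow> point) \<Rightarrow> bool" where
  "integral_curve n \<phi> c \<longleftrightarrow> (\<forall>q. c q \<in> M_Omega_e n) \<and>
     (\<forall>\<psi>. holomorphic_fun n \<psi> \<longrightarrow>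
        (\<forall>q. ((\<lambda>p. \<psi> (c p)) has_field_derivative poisson n \<phi> \<psi> (c q)) (at q)))"

definition exp_flow :: "nat \<Rightarrow> (point \<Rightarrow> complex) \<Rightarrow> complex \<Rightarrow> point \<Rightarrow> point" where
  "exp_flow n \<phi> q y = (THE z. \<exists>c. integral_curve n \<phi> c \<and> c 0 = y \<and> z = c q)"

definition torus :: "nat \<Rightarrow> (nat \<Rightarrow> complex) set" where
  "torus n = (\<Pi>\<^sub>E j\<in>{1..dim_d (n - 1)}. - {0})"

definition torus_coords :: "nat \<Rightarrow> ((nat \<Rightarrow> complex) \<Rightarrow> complex) set" where
  "torus_coords n = {\<lambda>\<zeta>. \<zeta> j | j. j \<in> {1..dim_d (n - 1)}}"

text \<open>The value does not depend on the choice of the logarithms \<open>q\<^bsub>j\<^esub>\<close> since the flows are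
  trivial for \<open>q \<in> 2\<pi>i\<int>\<close>, nor on the order of composition since they commute.\<close>

definition torus_act :: "nat \<Rightarrow> (nat \<Rightarrow> complex) \<Rightarrow> point \<Rightarrow> point" where
  "torus_act n \<zeta> y = (THE z. \<forall>q. (\<forall>j\<in>{1..dim_d (n - 1)}. \<zeta> j = exp (q j)) \<longrightarrow>
     z = foldr (\<lambda>j. exp_flow n (r_fun j) (q j)) [1..<Suc (dim_d (n - 1))] y)"

end

theory Submission
  imports Defs
begin

text \<open>The Hamiltonian vector field of the eigenvalue \<open>\<nu>\<^bsub>k m\<^esub>\<close> at \<open>x\<close> is \<open>[x, P]\<close>, where \<open>P\<close> is the spectral projection of
  \<open>x\<^bsub>m\<^esub>\<close> for \<open>\<nu>\<^bsub>k m\<^esub>\<close>, extended by zero to an \<open>n \<times> n\<close> matrix. As \<open>P\<close> only depends on \<open>x\<^bsub>m\<^esub>\<close>, which is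
  constant along the flow, the flow is \<open>x \<mapsto> g\<^sup>-\<^sup>1 x g\<close> with \<open>g = 1 + (e\<^sup>q - 1) P\<close>, hence algebraic in \<open>e\<^sup>q\<close>.
  Let \<open>a\<^bsub>k m\<^esub>\<close> be the product of row \<open>m + 1\<close> of \<open>x\<close> with the eigenvector of \<open>x\<^bsub>m\<^esub>\<close> for \<open>\<nu>\<^bsub>k m\<^esub>\<close> whose last
  entry is 1. Since \<open>x\<^bsub>m\<^esub>\<close> has no eigenvalue in common with \<open>x\<^bsub>m - 1\<^esub>\<close> and \<open>x\<^bsub>m + 1\<^esub>\<close>, this is a well-defined
  nowhere vanishing regular function. The torus element \<open>\<zeta>\<close> multiplies \<open>a\<^sub>j\<close> by \<open>\<zeta>\<^sub>j\<close>, and \<open>x\<close> is a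
  Hessenberg matrix if and only if all \<open>a\<^sub>j\<close> are 1. So \<open>z \<mapsto> (a(z), a(z)\<^sup>-\<^sup>1 \<cdot> z)\<close> is the inverse
  morphism.\<close>

section \<open>Regular functions and morphisms\<close>

text \<open>On the covering the eigenvalues are coordinates, which is the source of algebraicity:
  \<open>P\<close> is a polynomial in the leading block whose denominators are differences of
  eigenvalues of one level, and these do not vanish on \<open>e_Omega\<close>. The obstacle is that
  gradients, flows and the torus action are given by definite descriptions, so every closed form
  needs a uniqueness argument. Gradients: two local sections through a point agree nearby, and
  derivatives along lines determine the gradient. Flows: an integral curve conserves all eigenvalues
  and then the leading block, hence \<open>P\<close>; so X' = [X, P] is linear with constant
  coefficients, and conjugating back gives a constant. Torus: all choices of logarithms give the
  same composition along one fixed list of positions, and the inverse map undoes that list in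
  reverse order. The condition that all a are 1 controls a whole row of x because the spectral
  projections of one level have rank one, have nonzero corner entries and sum to the
  identity.\<close>

locale function_ring =
  fixes Q :: "('a \<Rightarrow> complex) \<Rightarrow> bool"
  assumes Q_const: "Q (\<lambda>_. a)"
    and Q_add: "Q f \<Longrightarrow> Q g \<Longrightarrow> Q (\<lambda>x. f x + g x)"
    and Q_mult: "Q f \<Longrightarrow> Q g \<Longrightarrow> Q (\<lambda>x. f x * g x)"
begin

lemma Q_diff: "Q f \<Longrightarrow> Q g \<Longrightarrow> Q (\<lambda>x. f x - g x)"
  using Q_add[of f "\<lambda>x. (-1) * g x"] Q_mult[OF Q_const[of "-1"], of g] by simp

lemma Q_sum: "(\<And>i. i \<in> I \<Longrightarrow> Q (f i)) \<Longrightarrow> Q (\<lambda>x. \<Sum>i\<in>I. f i x)"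
proof (induction I rule: infinite_finite_induct)
  case (insert i I)
  then show ?case using Q_add[of "f i" "\<lambda>x. \<Sum>i\<in>I. f i x"] by simp
qed (auto intro: Q_const)

end

lemma regular_on_const: "regular_on C V (\<lambda>_. a)"
  unfolding regular_on_def
  by (intro ballI bexI[of _ "\<lambda>_. a"] bexI[of _ "\<lambda>_. 1"]) (auto intro: poly_functions.const)

lemma regular_on_poly: "p \<in> poly_functions C \<Longrightarrow> regular_on C V p"
  unfolding regular_on_def
  by (intro ballI bexI[of _ p] bexI[of _ "\<lambda>_. 1"]) (auto intro: poly_functions.const)

lemma regular_on_coord: "g \<in> C \<Longrightarrow> regular_on C V g"
  by (intro regular_on_poly poly_functions.coord)

lemma regular_on_add:
  assumes "regular_on C V f" "regular_on C V g"
  shows "regular_on C V (\<lambda>x. f x + g x)"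
  unfolding regular_on_def
proof
  fix x assume x: "x \<in> V"
  obtain p q where pq: "p \<in> poly_functions C" "q \<in> poly_functions C" "q x \<noteq> 0"
    "\<And>z. z \<in> V \<Longrightarrow> q z \<noteq> 0 \<Longrightarrow> f z = p z / q z"
    using assms(1) x unfolding regular_on_def by blast
  obtain r s where rs: "r \<in> poly_functions C" "s \<in> poly_functions C" "s x \<noteq> 0"
    "\<And>z. z \<in> V \<Longrightarrow> s z \<noteq> 0 \<Longrightarrow> g z = r z / s z"
    using assms(2) x unfolding regular_on_def by blast
  show "\<exists>p\<in>poly_functions C. \<exists>q\<in>poly_functions C. q x \<noteq> 0 \<and>
      (\<forall>z\<in>V. q z \<noteq> 0 \<longrightarrow> f z + g z = p z / q z)"
    by (rule bexI[of _ "\<lambda>z. p z * s z + r z * q z"], rule bexI[of _ "\<lambda>z. q z * s z"])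
      (use pq rs in \<open>auto intro!: poly_functions.add poly_functions.mult simp: field_simps\<close>)
qed

lemma regular_on_mult:
  assumes "regular_on C V f" "regular_on C V g"
  shows "regular_on C V (\<lambda>x. f x * g x)"
  unfolding regular_on_def
proof
  fix x assume x: "x \<in> V"
  obtain p q where pq: "p \<in> poly_functions C" "q \<in> poly_functions C" "q x \<noteq> 0"
    "\<And>z. z \<in> V \<Longrightarrow> q z \<noteq> 0 \<Longrightarrow> f z = p z / q z"
    using assms(1) x unfolding regular_on_def by blast
  obtain r s where rs: "r \<in> poly_functions C" "s \<in> poly_functions C" "s x \<noteq> 0"
    "\<And>z. z \<in> V \<Longrightarrow> s z \<noteq> 0 \<Longrightarrow> g z = r z / s z"
    using assms(2) x unfolding regular_on_def by blast
  show "\<exists>p\<in>poly_functions C. \<exists>q\<in>poly_functions C. q x \<noteq> 0 \<and>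
      (\<forall>z\<in>V. q z \<noteq> 0 \<longrightarrow> f z * g z = p z / q z)"
    by (rule bexI[of _ "\<lambda>z. p z * r z"], rule bexI[of _ "\<lambda>z. q z * s z"])
      (use pq rs in \<open>auto intro!: poly_functions.mult\<close>)
qed

lemma regular_on_divide:
  assumes "regular_on C V f" "regular_on C V g" "\<And>x. x \<in> V \<Longrightarrow> g x \<noteq> 0"
  shows "regular_on C V (\<lambda>x. f x / g x)"
  unfolding regular_on_def
proof
  fix x assume x: "x \<in> V"
  obtain p q where pq: "p \<in> poly_functions C" "q \<in> poly_functions C" "q x \<noteq> 0"
    "\<And>z. z \<in> V \<Longrightarrow> q z \<noteq> 0 \<Longrightarrow> f z = p z / q z"
    using assms(1) x unfolding regular_on_def by blast
  obtain r s where rs: "r \<in> poly_functions C" "s \<in> poly_functions C" "s x \<noteq> 0"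
    "\<And>z. z \<in> V \<Longrightarrow> s z \<noteq> 0 \<Longrightarrow> g z = r z / s z"
    using assms(2) x unfolding regular_on_def by blast
  have "r x \<noteq> 0" using rs(3) rs(4)[OF x] assms(3)[OF x] by auto
  then show "\<exists>p\<in>poly_functions C. \<exists>q\<in>poly_functions C. q x \<noteq> 0 \<and>
      (\<forall>z\<in>V. q z \<noteq> 0 \<longrightarrow> f z / g z = p z / q z)"
    \<comment> \<open>the common factor \<open>s\<close> makes \<open>g = r / s\<close> available wherever the denominator does not vanish\<close>
    by (intro bexI[of _ "\<lambda>z. (p z * s z) * s z"] bexI[of _ "\<lambda>z. (q z * r z) * s z"])
      (use pq rs in \<open>auto intro!: poly_functions.mult\<close>)
qed

lemma function_ring_regular_on: "function_ring (regular_on C V)"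
  by unfold_locales (auto intro: regular_on_const regular_on_add regular_on_mult)

lemma regular_on_subset: "regular_on C V f \<Longrightarrow> W \<subseteq> V \<Longrightarrow> regular_on C W f"
  unfolding regular_on_def by blast

lemma regular_on_cong:
  assumes "regular_on C V f" "\<And>x. x \<in> V \<Longrightarrow> f x = g x"
  shows "regular_on C V g"
  using assms unfolding regular_on_def by (metis (no_types, lifting))

lemma regular_on_poly_compose:
  assumes "\<And>g. g \<in> D \<Longrightarrow> regular_on C X (\<lambda>x. g (f x))" "p \<in> poly_functions D"
  shows "regular_on C X (\<lambda>x. p (f x))"
  using assms(2)
  by induction (auto intro: assms(1) regular_on_const regular_on_add regular_on_mult)

text \<open>Regularity is local, so the coordinates decide everything: a polynomial on the target
  pulls back to a function that is locally a quotient of polynomials, and clearing denominators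
  turns open conditions and quotients on \<open>Y\<close> into data of the same kind on
  \<open>X\<close>.\<close>

lemma morphismI:
  assumes f: "f \<in> X \<rightarrow> Y" and reg: "\<And>g. g \<in> D \<Longrightarrow> regular_on C X (\<lambda>x. g (f x))"
  shows "morphism C X D Y f"
  unfolding morphism_def
proof (intro conjI allI impI f)
  fix V assume "zariski_open_in D Y V"
  then obtain S where S: "S \<subseteq> poly_functions D" "V = {y \<in> Y. \<exists>p\<in>S. p y \<noteq> 0}"
    unfolding zariski_open_in_def by auto
  \<comment> \<open>The largest candidate family: all polynomials whose nonvanishing set lies in the
    preimage. What remains is that each point of the preimage is seen by a member.\<close>
  define S' where "S' = {r \<in> poly_functions C. \<forall>z\<in>X. r z \<noteq> 0 \<longrightarrow> f z \<in> V}"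
  have "\<exists>r\<in>S'. r x \<noteq> 0" if x: "x \<in> X" "f x \<in> V" for x
  proof -
    obtain p where p: "p \<in> S" "p (f x) \<noteq> 0" using x S by auto
    then have "regular_on C X (\<lambda>x. p (f x))"
      using regular_on_poly_compose[of D C X f p] reg S by auto
    then obtain u v where uv: "u \<in> poly_functions C" "v \<in> poly_functions C" "v x \<noteq> 0"
      "\<And>z. z \<in> X \<Longrightarrow> v z \<noteq> 0 \<Longrightarrow> p (f z) = u z / v z"
      using x unfolding regular_on_def by blast
    \<comment> \<open>Where \<open>v\<close> does not vanish, \<open>p (f z) = u z / v z\<close>;
      where \<open>u\<close> does not vanish either, this value is nonzero, so \<open>f z\<close>
      lies in \<open>V\<close>.\<close>
    have "(\<lambda>z. u z * v z) \<in> S'"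
      unfolding S'_def using uv p S f by (fastforce intro: poly_functions.mult)
    moreover have "u x \<noteq> 0" using uv(3) uv(4)[of x] x p by auto
    ultimately show ?thesis using uv(3) by (intro bexI[of _ "\<lambda>z. u z * v z"]) auto
  qed
  then have "{x \<in> X. f x \<in> V} = {x \<in> X. \<exists>p\<in>S'. p x \<noteq> 0}"
    unfolding S'_def by blast
  moreover have "S' \<subseteq> poly_functions C" by (auto simp: S'_def)
  ultimately show "zariski_open_in C X {x \<in> X. f x \<in> V}"
    unfolding zariski_open_in_def by blast
next
  fix V \<psi> assume psi: "regular_on D V \<psi>"
  let ?W = "{x \<in> X. f x \<in> V}"
  have pull: "regular_on C ?W (\<lambda>x. p (f x))" if "p \<in> poly_functions D" for p
    by (rule regular_on_subset[OF regular_on_poly_compose[OF reg that]]) auto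
  show "regular_on C ?W (\<lambda>x. \<psi> (f x))"
    unfolding regular_on_def
  proof
    fix x assume x: "x \<in> ?W"
    then obtain p q where pq: "p \<in> poly_functions D" "q \<in> poly_functions D" "q (f x) \<noteq> 0"
      "\<And>z. z \<in> V \<Longrightarrow> q z \<noteq> 0 \<Longrightarrow> \<psi> z = p z / q z"
      using psi unfolding regular_on_def by blast
    let ?U = "{z \<in> ?W. q (f z) \<noteq> 0}"
    have "regular_on C ?U (\<lambda>z. p (f z) / q (f z))"
      by (intro regular_on_divide regular_on_subset[OF pull[OF pq(1)]]
          regular_on_subset[OF pull[OF pq(2)]]) auto
    then obtain u v where uv: "u \<in> poly_functions C" "v \<in> poly_functions C" "v x \<noteq> 0"
      "\<And>z. z \<in> ?U \<Longrightarrow> v z \<noteq> 0 \<Longrightarrow> p (f z) / q (f z) = u z / v z"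
      using x pq(3) unfolding regular_on_def by blast
    \<comment> \<open>Where \<open>b\<close> is nonzero, \<open>q (f z) = a z / b z\<close>, and
      then a nonzero \<open>a\<close> keeps \<open>q (f z)\<close> away from 0. Expanding
      \<open>u / v\<close> by \<open>a * b\<close> thus confines it to the set where it represents
      \<open>\<psi> (f z)\<close>.\<close>
    obtain a b where ab: "a \<in> poly_functions C" "b \<in> poly_functions C" "b x \<noteq> 0"
      "\<And>z. z \<in> ?W \<Longrightarrow> b z \<noteq> 0 \<Longrightarrow> q (f z) = a z / b z"
      using x pull[OF pq(2)] unfolding regular_on_def by blast
    have "a x \<noteq> 0" using ab(3) ab(4)[of x] x pq by auto
    then have nz: "v x * (a x * b x) \<noteq> 0" using uv ab by auto
    have "\<psi> (f z) = (u z * (a z * b z)) / (v z * (a z * b z))"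
      if z: "z \<in> ?W" "v z * (a z * b z) \<noteq> 0" for z
    proof -
      have "q (f z) \<noteq> 0" using ab(4)[of z] z by auto
      then have "\<psi> (f z) = u z / v z" using uv(4)[of z] pq(4)[of "f z"] z by auto
      then show ?thesis using z by auto
    qed
    then show "\<exists>p\<in>poly_functions C. \<exists>q\<in>poly_functions C. q x \<noteq> 0 \<and>
      (\<forall>z\<in>?W. q z \<noteq> 0 \<longrightarrow> \<psi> (f z) = p z / q z)"
      using nz uv ab
      by (intro bexI[of _ "\<lambda>z. u z * (a z * b z)"] bexI[of _ "\<lambda>z. v z * (a z * b z)"])
        (auto intro!: poly_functions.mult)
  qed
qed

section \<open>Spectral projections\<close>

lemma index_mult_sum:
  fixes A B :: "complex mat"
  assumes "A \<in> carrier_mat nr n" "B \<in> carrier_mat n nc" "i < nr" "j < nc"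
  shows "(A * B) $$ (i, j) = (\<Sum>l<n. A $$ (i, l) * B $$ (l, j))"
  using assms by (auto simp: scalar_prod_def lessThan_atLeast0 intro!: sum.cong)

lemma eigenvalueI:
  fixes A :: "complex mat"
  assumes "A \<in> carrier_mat m m" "i0 < m" "v i0 \<noteq> 0"
    and "\<And>i. i < m \<Longrightarrow> (\<Sum>j<m. A $$ (i, j) * v j) = z * v i"
  shows "eigenvalue A z"
proof -
  have "vec m v $ i0 \<noteq> 0\<^sub>v m $ i0" using assms by simp
  then have "vec m v \<noteq> 0\<^sub>v m" by metis
  moreover have "A *\<^sub>v vec m v = z \<cdot>\<^sub>v vec m v"
    using assms by (intro eq_vecI) (auto simp: scalar_prod_def lessThan_atLeast0)
  ultimately show ?thesis
    using assms(1) unfolding eigenvalue_def eigenvector_def by (intro exI[of _ "vec m v"]) auto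
qed

lemma eigenvalueI_left:
  fixes A :: "complex mat"
  assumes A: "A \<in> carrier_mat m m" and "i0 < m" "v i0 \<noteq> 0"
    and "\<And>j. j < m \<Longrightarrow> (\<Sum>i<m. v i * A $$ (i, j)) = z * v j"
  shows "eigenvalue A z"
proof -
  have "eigenvalue (transpose_mat A) z"
    using assms by (intro eigenvalueI[of _ m i0 v]) (auto simp: mult.commute)
  then show ?thesis
    using eigenvalue_root_char_poly[OF A] A
      eigenvalue_root_char_poly[of "transpose_mat A" m] char_poly_transpose_mat[OF A] by auto
qed

lemma eigenvalueE:
  fixes A :: "complex mat"
  assumes "A \<in> carrier_mat m m" "eigenvalue A z"
  obtains v i0 where "i0 < m" "v i0 \<noteq> 0"
    "\<And>i. i < m \<Longrightarrow> (\<Sum>j<m. A $$ (i, j) * v j) = z * v i"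
proof -
  obtain w where w: "w \<in> carrier_vec m" "w \<noteq> 0\<^sub>v m" "A *\<^sub>v w = z \<cdot>\<^sub>v w"
    using assms unfolding eigenvalue_def eigenvector_def by auto
  have "\<exists>i<m. w $ i \<noteq> 0"
  proof (rule ccontr)
    assume "\<not> ?thesis"
    then have "w = 0\<^sub>v m" using w(1) by (intro eq_vecI) auto
    then show False using w by simp
  qed
  then obtain i0 where i0: "i0 < m" "w $ i0 \<noteq> 0" by auto
  have "(\<Sum>j<m. A $$ (i, j) * w $ j) = z * w $ i" if "i < m" for i
    using arg_cong[OF w(3), of "\<lambda>u. u $ i"] that w(1) assms(1)
    by (auto simp: scalar_prod_def lessThan_atLeast0)
  then show ?thesis using that i0 by blast
qed

definition diag_of :: "nat \<Rightarrow> (nat \<Rightarrow> complex) \<Rightarrow> complex mat" where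
  "diag_of m e = mat m m (\<lambda>(i, j). if i = j then e i else 0)"

lemma diag_of_carrier [simp]: "diag_of m e \<in> carrier_mat m m"
  by (simp add: diag_of_def)

lemma mult_diag_of:
  assumes "S \<in> carrier_mat m m" "i < m" "j < m"
  shows "(S * diag_of m e) $$ (i, j) = S $$ (i, j) * e j"
proof -
  have "(S * diag_of m e) $$ (i, j) = (\<Sum>l<m. S $$ (i, l) * diag_of m e $$ (l, j))"
    using assms by (intro index_mult_sum[of _ m m _ m]) auto
  also have "\<dots> = (\<Sum>l<m. if l = j then S $$ (i, j) * e j else 0)"
    using assms by (intro sum.cong) (auto simp: diag_of_def)
  finally show ?thesis using assms by simp
qed

lemma diag_of_dim [simp]: "dim_row (diag_of m e) = m" "dim_col (diag_of m e) = m"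
  by (auto simp: diag_of_def)

lemma eigenvalue_diag_of: "eigenvalue (diag_of m e) z \<longleftrightarrow> z \<in> e ` {..<m}"
proof -
  have "upper_triangular (diag_of m e)" by (auto simp: diag_of_def)
  then have "char_poly (diag_of m e) = (\<Prod>a\<leftarrow>diag_mat (diag_of m e). [:- a, 1:])"
    by (intro char_poly_upper_triangular[of _ m]) auto
  moreover have "diag_mat (diag_of m e) = map e [0..<m]"
    by (auto simp: diag_mat_def diag_of_def)
  ultimately have "poly (char_poly (diag_of m e)) z = (\<Prod>i\<leftarrow>[0..<m]. z - e i)"
    by (simp add: poly_prod_list o_def)
  then show ?thesis
    by (auto simp: eigenvalue_root_char_poly[of _ m] prod_list_zero_iff)
qed

lemma eigenvalue_similar:
  fixes A B :: "complex mat"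
  assumes "similar_mat A B"
  shows "eigenvalue A z \<longleftrightarrow> eigenvalue B z"
proof -
  obtain m where "A \<in> carrier_mat m m" "B \<in> carrier_mat m m"
    using similar_matD[OF assms] by auto
  then show ?thesis using char_poly_similar[OF assms] by (simp add: eigenvalue_root_char_poly)
qed

text \<open>The Lagrange interpolation polynomial that is 1 at \<open>d k\<close> and 0 at the other \<open>d l\<close>, evaluated
  at \<open>A\<close>; it is the spectral projection of \<open>A\<close> when the \<open>d l\<close> are its distinct eigenvalues.\<close>

fun lagrange :: "complex mat \<Rightarrow> (nat \<Rightarrow> complex) \<Rightarrow> nat \<Rightarrow> nat list \<Rightarrow> complex mat" where
  "lagrange A d k [] = 1\<^sub>m (dim_row A)"
| "lagrange A d k (l # ls) = (if l = k then lagrange A d k ls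
     else (1 / (d k - d l)) \<cdot>\<^sub>m ((A - d l \<cdot>\<^sub>m 1\<^sub>m (dim_row A)) * lagrange A d k ls))"

lemma lagrange_carrier [simp]:
  "A \<in> carrier_mat m m \<Longrightarrow> lagrange A d k ls \<in> carrier_mat m m"
proof (induction ls)
  case (Cons l ls)
  then have "(A - d l \<cdot>\<^sub>m 1\<^sub>m m) * lagrange A d k ls \<in> carrier_mat m m"
    by (intro mult_carrier_mat[of _ m m] minus_carrier_mat) auto
  then show ?case using Cons by simp
qed simp

text \<open>The relation \<open>A * S = S * B\<close> passes to polynomials one factor at a time and
  involves no inverse of \<open>S\<close>, so it applies to a matrix of eigenvectors whose
  invertibility is still open.\<close>

lemma lagrange_intertwine:
  assumes A: "A \<in> carrier_mat m m" and B: "B \<in> carrier_mat m m" and S: "S \<in> carrier_mat m m"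
    and AS: "A * S = S * B"
  shows "lagrange A d k ls * S = S * lagrange B d k ls"
proof (induction ls)
  case Nil
  then show ?case using assms by simp
next
  case (Cons l ls)
  let ?L = "lagrange A d k ls" and ?M = "lagrange B d k ls"
  let ?c = "1 / (d k - d l)" and ?A = "A - d l \<cdot>\<^sub>m 1\<^sub>m m" and ?B = "B - d l \<cdot>\<^sub>m 1\<^sub>m m"
  have car: "?L \<in> carrier_mat m m" "?M \<in> carrier_mat m m" "?A \<in> carrier_mat m m"
    "?B \<in> carrier_mat m m" using A B by auto
  have "?A * S = S * ?B"
    using A B S AS
    by (simp add: minus_mult_distrib_mat[of _ m m _ _ m] mult_minus_distrib_mat[of _ m m _ m]
        mult_smult_distrib[of _ m m _ m] mult_smult_assoc_mat[of _ m m _ m])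
  moreover have "(?A * ?L) * S = ?A * (S * ?M)"
    using car S Cons.IH by (simp add: assoc_mult_mat[of _ m m _ m _ m])
  ultimately have "(?A * ?L) * S = S * (?B * ?M)"
    using car S
    by (simp add: assoc_mult_mat[of _ m m _ m _ m, symmetric] del: assoc_mult_mat)
  then have "(?c \<cdot>\<^sub>m (?A * ?L)) * S = S * (?c \<cdot>\<^sub>m (?B * ?M))"
    using car S by (simp add: mult_smult_distrib[of _ m m _ m] mult_smult_assoc_mat[of _ m m _ m])
  then show ?case using Cons.IH A B by (simp add: carrier_matD)
qed

lemma lagrange_diag_of:
  "lagrange (diag_of m e) d k ls =
     diag_of m (\<lambda>i. \<Prod>l\<leftarrow>ls. if l = k then 1 else (e i - d l) / (d k - d l))"
proof (induction ls)
  case Nil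
  then show ?case by (auto simp: diag_of_def)
next
  case (Cons l ls)
  have mult: "diag_of m f * diag_of m g = diag_of m (\<lambda>i. f i * g i)" for f g
    by (intro eq_matI) (simp_all add: mult_diag_of[of _ m] del: index_mult_mat(1),
        auto simp: diag_of_def)
  have "diag_of m e - d l \<cdot>\<^sub>m 1\<^sub>m m = diag_of m (\<lambda>i. e i - d l)"
    by (intro eq_matI) (auto simp: diag_of_def)
  moreover have "c \<cdot>\<^sub>m diag_of m f = diag_of m (\<lambda>i. c * f i)" for c f
    by (intro eq_matI) (auto simp: diag_of_def)
  moreover have "dim_row (diag_of m e) = m" by (simp add: diag_of_def)
  ultimately show ?case using Cons.IH mult by (auto intro!: arg_cong[of _ _ "diag_of m"])
qed

definition spectral_proj :: "nat \<Rightarrow> complex mat \<Rightarrow> (nat \<Rightarrow> complex) \<Rightarrow> nat \<Rightarrow> complex mat" where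
  "spectral_proj m A d k = lagrange A d k [1..<Suc m]"

lemma spectral_proj_carrier [simp]:
  "A \<in> carrier_mat m m \<Longrightarrow> spectral_proj m A d k \<in> carrier_mat m m"
  by (simp add: spectral_proj_def del: upt_Suc)

lemma spectral_proj_intertwine:
  assumes "A \<in> carrier_mat m m" "B \<in> carrier_mat m m" "S \<in> carrier_mat m m" "A * S = S * B"
  shows "spectral_proj m A d k * S = S * spectral_proj m B d k"
  unfolding spectral_proj_def by (rule lagrange_intertwine[OF assms])

lemma spectral_proj_diag:
  assumes "inj_on d {1..m}" "k \<in> {1..m}"
  shows "spectral_proj m (diag_of m (\<lambda>i. d (Suc i))) d k =
    diag_of m (\<lambda>i. if Suc i = k then 1 else 0)"
proof -
  have "(\<Prod>l\<leftarrow>[1..<Suc m]. if l = k then 1 else (d (Suc i) - d l) / (d k - d l)) =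
      (if Suc i = k then 1 else 0 :: complex)" if "i < m" for i
  proof (cases "Suc i = k")
    case True
    then have "map (\<lambda>l. if l = k then 1 else (d (Suc i) - d l) / (d k - d l)) [1..<Suc m] =
        map (\<lambda>_. 1) [1..<Suc m]"
      using inj_onD[OF assms(1), of k] assms(2) by (auto simp del: upt_Suc)
    then show ?thesis using True by (simp add: map_replicate_const del: upt_Suc)
  next
    case False
    \<comment> \<open>The factor with \<open>l = Suc i\<close> vanishes; matrix positions start at
      0, eigenvalue labels at 1.\<close>
    then have "0 \<in> set (map (\<lambda>l. if l = k then 1 else (d (Suc i) - d l) / (d k - d l)) [1..<Suc m])"
      using that by (auto simp del: upt_Suc intro!: image_eqI[of _ _ "Suc i"])
    then show ?thesis using False by (simp add: prod_list_zero_iff del: upt_Suc)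
  qed
  then show ?thesis
    unfolding spectral_proj_def lagrange_diag_of by (intro eq_matI) (auto simp: diag_of_def simp del: upt_Suc)
qed

text \<open>Diagonalization carries the projection to a matrix unit, so it is the product of column
  \<open>k - 1\<close> of \<open>S\<close>, a right eigenvector, and row \<open>k - 1\<close> of
  \<open>T\<close>, a left eigenvector.\<close>

lemma spectral_proj_entry:
  assumes A: "A \<in> carrier_mat m m" and S: "S \<in> carrier_mat m m" and T: "T \<in> carrier_mat m m"
    and ST: "S * T = 1\<^sub>m m" and AS: "A * S = S * diag_of m (\<lambda>i. d (Suc i))"
    and d: "inj_on d {1..m}" "k \<in> {1..m}" and ij: "i < m" "j < m"
  shows "spectral_proj m A d k $$ (i, j) = S $$ (i, k - 1) * T $$ (k - 1, j)"
proof -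
  let ?P = "spectral_proj m A d k" and ?E = "diag_of m (\<lambda>i. if Suc i = k then 1 else 0)"
  have P: "?P \<in> carrier_mat m m" using A by simp
  have "?P * S = S * ?E"
    using spectral_proj_intertwine[OF A _ S AS] spectral_proj_diag[OF d] by simp
  moreover have "?P = ?P * S * T"
    using P S T ST by (simp add: assoc_mult_mat[of _ m m _ m _ m])
  ultimately have "?P = S * ?E * T" by simp
  moreover have SE: "(S * ?E) $$ (i, l) = (if l = k - 1 then S $$ (i, l) else 0)" if "l < m" for l
    using mult_diag_of[OF S ij(1) that] d(2) by auto
  moreover have "(S * ?E * T) $$ (i, j) = (\<Sum>l<m. (S * ?E) $$ (i, l) * T $$ (l, j))"
    using S T ij by (intro index_mult_sum[of _ m m _ m]) (auto intro!: mult_carrier_mat[of _ m m])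
  ultimately have "?P $$ (i, j) = (\<Sum>l<m. (S * ?E) $$ (i, l) * T $$ (l, j))"
    by metis
  also have "\<dots> = (\<Sum>l<m. if l = k - 1 then S $$ (i, k - 1) * T $$ (k - 1, j) else 0)"
    by (intro sum.cong refl) (simp add: SE del: index_mult_mat)
  also have "\<dots> = S $$ (i, k - 1) * T $$ (k - 1, j)"
    using d(2) by (subst sum.delta) auto
  finally show ?thesis .
qed

text \<open>Eigenvectors for distinct eigenvalues are independent: a vanishing combination of them
  is killed by every spectral projection, while the projection for an index with nonzero coefficient
  returns a nonzero multiple of that eigenvector.\<close>

lemma similar_diag_of:
  assumes A: "A \<in> carrier_mat m m" and d: "inj_on d {1..m}"
    and ev: "\<And>k. k \<in> {1..m} \<Longrightarrow> eigenvalue A (d k)"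
  shows "similar_mat (diag_of m (\<lambda>i. d (Suc i))) A"
proof -
  have "\<forall>k\<in>{1..m}. \<exists>v. (\<exists>i<m. v i \<noteq> 0) \<and> (\<forall>i<m. (\<Sum>j<m. A $$ (i, j) * v j) = d k * v i)"
    using ev eigenvalueE[OF A] by metis
  then obtain v where v: "\<And>k. k \<in> {1..m} \<Longrightarrow> (\<exists>i<m. v k i \<noteq> 0)"
    "\<And>k i. k \<in> {1..m} \<Longrightarrow> i < m \<Longrightarrow> (\<Sum>j<m. A $$ (i, j) * v k j) = d k * v k i"
    by metis
  define D where "D = diag_of m (\<lambda>i. d (Suc i))"
  define S where "S = mat m m (\<lambda>(i, j). v (Suc j) i)"
  have S: "S \<in> carrier_mat m m" and D: "D \<in> carrier_mat m m" by (auto simp: S_def D_def)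
  have AS: "A * S = S * D"
  proof (rule eq_matI)
    fix i j assume "i < dim_row (S * D)" "j < dim_col (S * D)"
    then have ij: "i < m" "j < m" using S D by auto
    show "(A * S) $$ (i, j) = (S * D) $$ (i, j)"
      unfolding D_def mult_diag_of[OF S ij] index_mult_sum[OF A S ij]
      using ij v(2)[of "Suc j" i] by (simp add: S_def mult.commute)
  qed (use A S D in auto)
  have "det S \<noteq> 0"
  proof
    assume "det S = 0"
    then obtain c where c: "c \<in> carrier_vec m" "c \<noteq> 0\<^sub>v m" "S *\<^sub>v c = 0\<^sub>v m"
      using det_0_iff_vec_prod_zero[OF S] by auto
    have "\<exists>i<m. c $ i \<noteq> 0"
    proof (rule ccontr)
      assume "\<not> ?thesis"
      then have "c = 0\<^sub>v m" using c(1) by (intro eq_vecI) auto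
      then show False using c by simp
    qed
    then obtain i0 where i0: "i0 < m" "c $ i0 \<noteq> 0" by auto
    let ?k = "Suc i0" let ?P = "spectral_proj m A d ?k"
    let ?E = "diag_of m (\<lambda>i. if Suc i = ?k then 1 else 0)"
    have k: "?k \<in> {1..m}" using i0 by auto
    have P: "?P \<in> carrier_mat m m" using A by simp
    have PS: "?P * S = S * ?E"
      using spectral_proj_intertwine[OF A D S AS] spectral_proj_diag[OF d k] by (simp add: D_def)
    have "(S * ?E) *\<^sub>v c = ?P *\<^sub>v (S *\<^sub>v c)"
      using assoc_mult_mat_vec[OF P S c(1)] PS by simp
    then have z: "(S * ?E) *\<^sub>v c = 0\<^sub>v m" using c P by auto
    have "v ?k i = 0" if i: "i < m" for i
    proof -
      have "((S * ?E) *\<^sub>v c) $ i = (\<Sum>l<m. (S * ?E) $$ (i, l) * c $ l)"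
        using i S c(1) by (auto simp: scalar_prod_def lessThan_atLeast0 simp del: index_mult_mat(1)
            row_mult intro!: sum.cong)
      also have "\<dots> = (\<Sum>l<m. if l = i0 then S $$ (i, l) * c $ l else 0)"
        using mult_diag_of[OF S i] by (intro sum.cong) auto
      also have "\<dots> = S $$ (i, i0) * c $ i0" using i0 by auto
      finally have "S $$ (i, i0) * c $ i0 = 0" unfolding z using i by simp
      then show ?thesis using i i0 by (simp add: S_def)
    qed
    then show False using v(1)[OF k] by auto
  qed
  then obtain T where T: "T \<in> carrier_mat m m" "T * S = 1\<^sub>m m" "S * T = 1\<^sub>m m"
    using det_non_zero_imp_unit[OF S, of "()"] by (auto simp: Units_def ring_mat_def)
  have "D = T * A * S"
  proof -
    have "T * A * S = T * (S * D)" using T A S AS by (simp add: assoc_mult_mat[of _ m m _ m _ m])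
    also have "\<dots> = D" using T S D
      by (simp add: assoc_mult_mat[of _ m m _ m _ m, symmetric] del: assoc_mult_mat)
    finally show ?thesis by simp
  qed
  then have "similar_mat D A" using T S D A by (intro similar_matI[of _ _ T S m]) auto
  then show ?thesis by (simp add: D_def)
qed

section \<open>Leading blocks and zero padding\<close>

lemma sum_lessThan_trunc:
  fixes f :: "nat \<Rightarrow> complex"
  assumes "m \<le> n" "\<And>l. m \<le> l \<Longrightarrow> l < n \<Longrightarrow> f l = 0"
  shows "(\<Sum>l<n. f l) = (\<Sum>l<m. f l)"
  using assms by (intro sum.mono_neutral_right) auto

lemma mult_carrier_square [simp]:
  "A \<in> carrier_mat n n \<Longrightarrow> B \<in> carrier_mat n n \<Longrightarrow> A * B \<in> carrier_mat n n"
  for A B :: "complex mat"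
  by (rule mult_carrier_mat)

lemma cutoff_carrier [simp]: "cutoff m x \<in> carrier_mat m m"
  by (simp add: cutoff_def)

lemma cutoff_index: "i < m \<Longrightarrow> j < m \<Longrightarrow> cutoff m x $$ (i, j) = x $$ (i, j)"
  by (simp add: cutoff_def)

lemma cutoff_one: "m \<le> n \<Longrightarrow> cutoff m (1\<^sub>m n) = 1\<^sub>m m"
  by (intro eq_matI) (auto simp: cutoff_def)

text \<open>The leading block of a product has an extra summand, the upper right block of
  \<open>A\<close> times the lower left block of \<open>B\<close>; the hypothesis \<open>z\<close>
  makes one of the two vanish.\<close>

lemma cutoff_mult:
  assumes A: "A \<in> carrier_mat n n" and B: "B \<in> carrier_mat n n" and m: "m \<le> n"
    and z: "(\<forall>i<m. \<forall>l. m \<le> l \<longrightarrow> l < n \<longrightarrow> A $$ (i, l) = 0) \<or>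
      (\<forall>j<m. \<forall>l. m \<le> l \<longrightarrow> l < n \<longrightarrow> B $$ (l, j) = 0)"
  shows "cutoff m (A * B) = cutoff m A * cutoff m B"
proof (rule eq_matI)
  fix i j assume "i < dim_row (cutoff m A * cutoff m B)" "j < dim_col (cutoff m A * cutoff m B)"
  then have ij: "i < m" "j < m" by (auto simp: cutoff_def)
  have "cutoff m (A * B) $$ (i, j) = (\<Sum>l<n. A $$ (i, l) * B $$ (l, j))"
    using ij m index_mult_sum[OF A B] by (simp add: cutoff_index)
  also have "\<dots> = (\<Sum>l<m. A $$ (i, l) * B $$ (l, j))"
    using z ij by (intro sum_lessThan_trunc m) auto
  also have "\<dots> = (cutoff m A * cutoff m B) $$ (i, j)"
    using ij by (subst index_mult_sum[of _ m m _ m]) (auto simp: cutoff_index)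
  finally show "cutoff m (A * B) $$ (i, j) = (cutoff m A * cutoff m B) $$ (i, j)" .
qed (auto simp: cutoff_def)

definition pad :: "nat \<Rightarrow> complex mat \<Rightarrow> complex mat" where
  "pad n A = mat n n (\<lambda>(i, j). if i < dim_row A \<and> j < dim_col A then A $$ (i, j) else 0)"

lemma pad_carrier [simp]: "pad n A \<in> carrier_mat n n"
  by (simp add: pad_def)

lemma pad_cutoff:
  assumes "B \<in> carrier_mat n n" "m \<le> n"
    "\<And>i j. i < n \<Longrightarrow> j < n \<Longrightarrow> m \<le> i \<or> m \<le> j \<Longrightarrow> B $$ (i, j) = 0"
  shows "pad n (cutoff m B) = B"
  using assms by (intro eq_matI) (auto simp: pad_def cutoff_def)

lemma cutoff_pad: "A \<in> carrier_mat m m \<Longrightarrow> m \<le> n \<Longrightarrow> cutoff m (pad n A) = A"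
  by (intro eq_matI) (auto simp: pad_def cutoff_def)

definition eproj :: "nat \<Rightarrow> nat \<Rightarrow> nat \<Rightarrow> point \<Rightarrow> complex mat" where
  "eproj n m k y = pad n (spectral_proj m (cutoff m (proj y)) (\<lambda>l. nu_entry (fst y) l m) k)"

lemma eproj_carrier [simp]: "eproj n m k y \<in> carrier_mat n n"
  by (simp add: eproj_def)

lemma eproj_outside:
  "i < n \<Longrightarrow> j < n \<Longrightarrow> m \<le> i \<or> m \<le> j \<Longrightarrow> eproj n m k y $$ (i, j) = 0"
  using carrier_matD[OF spectral_proj_carrier[OF cutoff_carrier]] by (auto simp: eproj_def pad_def)

section \<open>Points of the covering and their spectral data\<close>

lemma M_Omega_eD:
  assumes "y \<in> M_Omega_e n"
  shows "fst y \<in> e_Omega n" "proj y \<in> M_Omega n" "proj y \<in> carrier_mat n n"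
    "m \<in> {1..n} \<Longrightarrow> similar_mat (fst y m) (cutoff m (proj y))"
  using assms by (auto simp: M_Omega_e_def M_Omega_def)

lemma e_Omega_diag_of:
  assumes "\<nu> \<in> e_Omega n" "m \<in> {1..n}"
  shows "\<nu> m = diag_of m (\<lambda>i. nu_entry \<nu> (Suc i) m)"
proof -
  have "\<nu> m \<in> carrier_mat m m" "diagonal_mat (\<nu> m)"
    using assms unfolding e_Omega_def by (blast dest: PiE_mem)+
  then show ?thesis
    by (intro eq_matI) (auto simp: diag_of_def nu_entry_def diagonal_mat_def)
qed

lemma e_Omega_inj: "\<nu> \<in> e_Omega n \<Longrightarrow> m \<in> {1..n} \<Longrightarrow> inj_on (\<lambda>k. nu_entry \<nu> k m) {1..m}"
  unfolding e_Omega_def by blast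

lemma image_Suc_lessThan: "(\<lambda>i. f (Suc i)) ` {..<m} = f ` {1..m}"
  by (simp only: image_image[of f Suc, symmetric] lessThan_atLeast0 image_Suc_atLeastLessThan
      atLeastLessThanSuc_atLeastAtMost One_nat_def)

lemma eigenvalue_cutoff:
  assumes "\<nu> \<in> e_Omega n" "m \<in> {1..n}" "similar_mat (\<nu> m) (cutoff m x)"
  shows "eigenvalue (cutoff m x) z \<longleftrightarrow> z \<in> (\<lambda>k. nu_entry \<nu> k m) ` {1..m}"
proof -
  have "eigenvalue (cutoff m x) z \<longleftrightarrow> eigenvalue (diag_of m (\<lambda>i. nu_entry \<nu> (Suc i) m)) z"
    using eigenvalue_similar[OF assms(3)] e_Omega_diag_of[OF assms(1,2)] by simp
  then show ?thesis
    unfolding eigenvalue_diag_of using image_Suc_lessThan[of "\<lambda>k. nu_entry \<nu> k m" m] by simp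
qed

text \<open>The spectrum of each leading block can be read off from \<open>\<nu>\<close>, so the
  conditions that define \<open>M_Omega\<close> are inherited from those of
  \<open>e_Omega\<close>.\<close>

lemma M_Omega_eI:
  assumes nu: "\<nu> \<in> e_Omega n" and x: "x \<in> carrier_mat n n"
    and sim: "\<And>m. m \<in> {1..n} \<Longrightarrow> similar_mat (\<nu> m) (cutoff m x)"
  shows "(\<nu>, x) \<in> M_Omega_e n"
proof -
  have ev: "{z. eigenvalue (cutoff m x) z} = (\<lambda>k. nu_entry \<nu> k m) ` {1..m}" if "m \<in> {1..n}" for m
    using eigenvalue_cutoff[OF nu that sim[OF that]] by auto
  have "card {z. eigenvalue (cutoff m x) z} = m" if "m \<in> {1..n}" for m
    unfolding ev[OF that] using card_image[OF e_Omega_inj[OF nu that]] by simp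
  moreover have "\<nexists>z. eigenvalue (cutoff m x) z \<and> eigenvalue (cutoff (m + 1) x) z"
    if m: "m \<in> {1..<n}" for m
  proof
    assume "\<exists>z. eigenvalue (cutoff m x) z \<and> eigenvalue (cutoff (m + 1) x) z"
    then obtain z where z: "z \<in> {z. eigenvalue (cutoff m x) z}"
      "z \<in> {z. eigenvalue (cutoff (m + 1) x) z}" by auto
    have mn: "m \<in> {1..n}" "m + 1 \<in> {1..n}" using m by auto
    obtain i where i: "i \<in> {1..m}" "z = nu_entry \<nu> i m" using z(1) ev[OF mn(1)] by auto
    obtain j where j: "j \<in> {1..m + 1}" "z = nu_entry \<nu> j (m + 1)" using z(2) ev[OF mn(2)] by blast
    show False using nu m i j unfolding e_Omega_def by blast
  qed
  ultimately show ?thesis using assms by (auto simp: M_Omega_e_def M_Omega_def)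
qed

lemma M_Omega_e_eigenvalue:
  assumes "y \<in> M_Omega_e n" "m \<in> {1..n}"
  shows "eigenvalue (cutoff m (proj y)) z \<longleftrightarrow> z \<in> (\<lambda>k. nu_entry (fst y) k m) ` {1..m}"
  using eigenvalue_cutoff M_Omega_eD[OF assms(1)] assms(2) by blast

text \<open>One diagonalization serves all labels \<open>k\<close> at once: orthogonality of the
  projections then comes from \<open>T * S = 1\<^sub>m m\<close> and their completeness from
  \<open>S * T = 1\<^sub>m m\<close>.\<close>

lemma spectral_data:
  assumes y: "y \<in> M_Omega_e n" and m: "m \<in> {1..n}"
  obtains S T where "S \<in> carrier_mat m m" "T \<in> carrier_mat m m"
    "S * T = 1\<^sub>m m" "T * S = 1\<^sub>m m"
    "cutoff m (proj y) * S = S * diag_of m (\<lambda>i. nu_entry (fst y) (Suc i) m)"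
    "\<And>k i j. k \<in> {1..m} \<Longrightarrow> i < m \<Longrightarrow> j < m \<Longrightarrow>
       eproj n m k y $$ (i, j) = S $$ (i, k - 1) * T $$ (k - 1, j)"
proof -
  let ?A = "cutoff m (proj y)" and ?D = "diag_of m (\<lambda>i. nu_entry (fst y) (Suc i) m)"
  have A: "?A \<in> carrier_mat m m" by simp
  have "similar_mat ?D ?A"
    using M_Omega_eD(4)[OF y m] e_Omega_diag_of[OF M_Omega_eD(1)[OF y] m] by simp
  then obtain n' T S where TS: "{?D, ?A, T, S} \<subseteq> carrier_mat n' n'" "T * S = 1\<^sub>m n'"
    "S * T = 1\<^sub>m n'" "?D = T * ?A * S" using similar_matD by blast
  have "n' = m" using TS(1) A by (auto dest!: carrier_matD)
  then have S: "S \<in> carrier_mat m m" and T: "T \<in> carrier_mat m m"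
    and ST: "S * T = 1\<^sub>m m" "T * S = 1\<^sub>m m" using TS by auto
  have "S * ?D = S * (T * (?A * S))"
    unfolding TS(4) using S T A by (simp add: assoc_mult_mat[of _ m m _ m _ m])
  also have "\<dots> = (S * T) * (?A * S)"
    using S T A by (intro assoc_mult_mat[symmetric, of _ m m _ m _ m]) auto
  finally have AS: "?A * S = S * ?D" using ST A S by simp
  have "eproj n m k y $$ (i, j) = S $$ (i, k - 1) * T $$ (k - 1, j)"
    if "k \<in> {1..m}" "i < m" "j < m" for k i j
    using spectral_proj_entry[OF A S T ST(1) AS e_Omega_inj[OF M_Omega_eD(1)[OF y] m] that] that m
      carrier_matD[OF spectral_proj_carrier[OF A]]
    by (auto simp: eproj_def pad_def)
  then show ?thesis using that S T ST AS by blast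
qed

context
  fixes n m k y P x \<mu>
  assumes y: "y \<in> M_Omega_e n" and m: "m \<in> {1..n}" and k: "k \<in> {1..m}"
  defines "P \<equiv> eproj n m k y" and "x \<equiv> proj y" and "\<mu> \<equiv> nu_entry (fst y) k m"
begin

private lemma x: "x \<in> carrier_mat n n"
  using M_Omega_eD(3)[OF y] by (simp add: x_def)

text \<open>By zero padding the full \<open>x\<close> acts on \<open>P\<close> as its leading block
  does, but only in rows \<open>i < m\<close>. The restriction matters: row \<open>m\<close> of
  \<open>x * P\<close> contains the numerator of \<open>acoord\<close>.\<close>

lemma eproj_left:
  assumes i: "i < m" and j: "j < n"
  shows "(x * P) $$ (i, j) = \<mu> * P $$ (i, j)"
proof -
  obtain S T where ST: "S \<in> carrier_mat m m" "T \<in> carrier_mat m m"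
    "cutoff m x * S = S * diag_of m (\<lambda>i. nu_entry (fst y) (Suc i) m)"
    "\<And>i j. i < m \<Longrightarrow> j < m \<Longrightarrow> P $$ (i, j) = S $$ (i, k - 1) * T $$ (k - 1, j)"
    using spectral_data[OF y m] k unfolding x_def P_def by metis
  have "(x * P) $$ (i, j) = (\<Sum>l<n. x $$ (i, l) * P $$ (l, j))"
    using x i j m by (intro index_mult_sum[of _ n n _ n]) (auto simp: P_def)
  also have "\<dots> = (\<Sum>l<m. x $$ (i, l) * P $$ (l, j))"
    using m j by (intro sum_lessThan_trunc) (auto simp: P_def eproj_outside)
  also have "\<dots> = \<mu> * P $$ (i, j)"
  proof (cases "j < m")
    case True
    have "(\<Sum>l<m. x $$ (i, l) * P $$ (l, j)) =
        (\<Sum>l<m. cutoff m x $$ (i, l) * S $$ (l, k - 1)) * T $$ (k - 1, j)"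
      using True i ST(4) by (simp add: cutoff_index sum_distrib_right mult.assoc)
    also have "\<dots> = (cutoff m x * S) $$ (i, k - 1) * T $$ (k - 1, j)"
      using i k ST(1) by (subst index_mult_sum[of _ m m _ m]) auto
    also have "\<dots> = \<mu> * P $$ (i, j)"
      unfolding ST(3) using i k True ST(4) by (subst mult_diag_of[OF ST(1)]) (auto simp: \<mu>_def)
    finally show ?thesis .
  next
    case False
    then show ?thesis using j m i by (simp add: P_def eproj_outside)
  qed
  finally show ?thesis .
qed

text \<open>Inverting the diagonalization makes the rows of \<open>T\<close> left eigenvectors of
  the leading block, which gives the mirror image of \<open>eproj_left\<close>.\<close>

lemma eproj_right:
  assumes i: "i < n" and j: "j < m"
  shows "(P * x) $$ (i, j) = \<mu> * P $$ (i, j)"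
proof -
  let ?D = "diag_of m (\<lambda>i. nu_entry (fst y) (Suc i) m)"
  obtain S T where ST: "S \<in> carrier_mat m m" "T \<in> carrier_mat m m" "S * T = 1\<^sub>m m" "T * S = 1\<^sub>m m"
    "cutoff m x * S = S * ?D"
    "\<And>i j. i < m \<Longrightarrow> j < m \<Longrightarrow> P $$ (i, j) = S $$ (i, k - 1) * T $$ (k - 1, j)"
    using spectral_data[OF y m] k unfolding x_def P_def by metis
  have "T * cutoff m x = T * ((cutoff m x * S) * T)"
    using ST(1-3) by (simp add: assoc_mult_mat[of _ m m _ m _ m] right_mult_one_mat[of _ m m])
  also have "\<dots> = (T * S) * (?D * T)"
    unfolding ST(5) using ST(1,2) by (simp add: assoc_mult_mat[of _ m m _ m _ m])
  also have "\<dots> = ?D * T" using ST by simp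
  finally have TA: "T * cutoff m x = ?D * T" .
  have DT: "(?D * T) $$ (k - 1, j) = \<mu> * T $$ (k - 1, j)"
  proof -
    have "(?D * T) $$ (k - 1, j) = (\<Sum>l<m. ?D $$ (k - 1, l) * T $$ (l, j))"
      using ST j k by (intro index_mult_sum[of _ m m _ m]) auto
    also have "\<dots> = (\<Sum>l<m. if l = k - 1 then \<mu> * T $$ (k - 1, j) else 0)"
      using k by (intro sum.cong) (auto simp: diag_of_def \<mu>_def)
    also have "\<dots> = \<mu> * T $$ (k - 1, j)" using k by (subst sum.delta) auto
    finally show ?thesis .
  qed
  have "(P * x) $$ (i, j) = (\<Sum>l<n. P $$ (i, l) * x $$ (l, j))"
    using x i j m by (intro index_mult_sum[of _ n n _ n]) (auto simp: P_def)
  also have "\<dots> = (\<Sum>l<m. P $$ (i, l) * x $$ (l, j))"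
    using m i by (intro sum_lessThan_trunc) (auto simp: P_def eproj_outside)
  also have "\<dots> = \<mu> * P $$ (i, j)"
  proof (cases "i < m")
    case True
    have "(\<Sum>l<m. P $$ (i, l) * x $$ (l, j)) =
        S $$ (i, k - 1) * (\<Sum>l<m. T $$ (k - 1, l) * cutoff m x $$ (l, j))"
      using True j ST(6) by (simp add: cutoff_index sum_distrib_left mult.assoc)
    also have "\<dots> = S $$ (i, k - 1) * (T * cutoff m x) $$ (k - 1, j)"
      using j k ST(2) by (subst index_mult_sum[of _ m m _ m]) auto
    also have "\<dots> = \<mu> * P $$ (i, j)"
      unfolding TA DT using True j ST by simp
    finally show ?thesis .
  next
    case False
    then show ?thesis using j m i by (simp add: P_def eproj_outside)
  qed
  finally show ?thesis .
qed

lemma eproj_mult: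
  assumes k': "k' \<in> {1..m}"
  shows "P * eproj n m k' y = (if k = k' then P else 0\<^sub>m n n)"
proof (rule eq_matI)
  let ?R = "eproj n m k' y"
  obtain S T where ST: "S \<in> carrier_mat m m" "T \<in> carrier_mat m m" "T * S = 1\<^sub>m m"
    "\<And>k i j. k \<in> {1..m} \<Longrightarrow> i < m \<Longrightarrow> j < m \<Longrightarrow>
       eproj n m k y $$ (i, j) = S $$ (i, k - 1) * T $$ (k - 1, j)"
    using spectral_data[OF y m] by metis
  fix i j
  assume "i < dim_row (if k = k' then P else 0\<^sub>m n n)" "j < dim_col (if k = k' then P else 0\<^sub>m n n)"
  then have ij: "i < n" "j < n" using carrier_matD[OF eproj_carrier[of n m k y]]
    by (auto simp: P_def split: if_splits)
  have "(P * ?R) $$ (i, j) = (\<Sum>l<n. P $$ (i, l) * ?R $$ (l, j))"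
    using ij by (intro index_mult_sum) (auto simp: P_def)
  also have "\<dots> = (\<Sum>l<m. P $$ (i, l) * ?R $$ (l, j))"
    using m ij by (intro sum_lessThan_trunc) (auto simp: P_def eproj_outside)
  also have "\<dots> = (if k = k' then P else 0\<^sub>m n n) $$ (i, j)"
  proof (cases "i < m \<and> j < m")
    case True
    have "(\<Sum>l<m. P $$ (i, l) * ?R $$ (l, j)) =
        S $$ (i, k - 1) * (\<Sum>l<m. T $$ (k - 1, l) * S $$ (l, k' - 1)) * T $$ (k' - 1, j)"
      using True ST(4) k k' by (simp add: P_def sum_distrib_left sum_distrib_right mult.assoc)
    also have "(\<Sum>l<m. T $$ (k - 1, l) * S $$ (l, k' - 1)) = (T * S) $$ (k - 1, k' - 1)"
      using k k' ST by (subst index_mult_sum[of _ m m _ m]) auto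
    also have "\<dots> = (if k = k' then 1 else 0)"
      unfolding ST(3) using k k' by (auto simp: index_one_mat)
    finally show ?thesis using True ST(4) k ij by (auto simp: P_def)
  next
    case False
    then show ?thesis using ij m by (auto simp: P_def eproj_outside)
  qed
  finally show "(P * ?R) $$ (i, j) = (if k = k' then P else 0\<^sub>m n n) $$ (i, j)" .
qed (use carrier_matD[OF eproj_carrier] in \<open>auto simp: P_def\<close>)

lemma eproj_idem: "P * P = P"
  using eproj_mult[OF k] by (simp add: P_def)

lemma eproj_trace: "mat_trace P = 1"
proof -
  obtain S T where ST: "S \<in> carrier_mat m m" "T \<in> carrier_mat m m" "T * S = 1\<^sub>m m"
    "\<And>i j. i < m \<Longrightarrow> j < m \<Longrightarrow> P $$ (i, j) = S $$ (i, k - 1) * T $$ (k - 1, j)"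
    using spectral_data[OF y m] k unfolding P_def by metis
  have "mat_trace P = (\<Sum>i<n. P $$ (i, i))"
    using carrier_matD[OF eproj_carrier[of n m k y]] by (simp add: mat_trace_def P_def)
  also have "\<dots> = (\<Sum>i<m. P $$ (i, i))"
    using m by (intro sum_lessThan_trunc) (auto simp: P_def eproj_outside)
  also have "\<dots> = (\<Sum>i<m. T $$ (k - 1, i) * S $$ (i, k - 1))"
    using ST(4) by (intro sum.cong) auto
  also have "\<dots> = (T * S) $$ (k - 1, k - 1)"
    using k ST by (subst index_mult_sum[of _ m m _ m]) auto
  also have "\<dots> = 1" unfolding ST(3) using k by (auto simp: index_one_mat)
  finally show ?thesis .
qed

text \<open>The 2 by 2 minors of a column times a row vanish. In this form rows and columns of
  \<open>P\<close> can be compared without choosing eigenvectors.\<close>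

lemma eproj_rank1:
  assumes "i < m" "j < m" "i' < m" "j' < m"
  shows "P $$ (i, j) * P $$ (i', j') = P $$ (i, j') * P $$ (i', j)"
proof -
  obtain S T where
    "\<And>i j. i < m \<Longrightarrow> j < m \<Longrightarrow> P $$ (i, j) = S $$ (i, k - 1) * T $$ (k - 1, j)"
    using spectral_data[OF y m] k unfolding P_def by metis
  then show ?thesis using assms by simp
qed

end

lemma eproj_sum:
  assumes y: "y \<in> M_Omega_e n" and m: "m \<in> {1..n}" and ij: "i < m" "j < m"
  shows "(\<Sum>k\<in>{1..m}. eproj n m k y $$ (i, j)) = (if i = j then 1 else 0)"
proof -
  obtain S T where ST: "S \<in> carrier_mat m m" "T \<in> carrier_mat m m" "S * T = 1\<^sub>m m"
    "\<And>k i j. k \<in> {1..m} \<Longrightarrow> i < m \<Longrightarrow> j < m \<Longrightarrow>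
       eproj n m k y $$ (i, j) = S $$ (i, k - 1) * T $$ (k - 1, j)"
    using spectral_data[OF y m] by metis
  have "(\<Sum>k\<in>{1..m}. eproj n m k y $$ (i, j)) = (\<Sum>k\<in>{1..m}. S $$ (i, k - 1) * T $$ (k - 1, j))"
    using ST(4) ij by (intro sum.cong) auto
  also have "\<dots> = (\<Sum>l<m. S $$ (i, l) * T $$ (l, j))"
    by (rule sum.reindex_bij_witness[of _ Suc "\<lambda>k. k - 1"]) auto
  also have "\<dots> = (S * T) $$ (i, j)"
    using ij ST by (subst index_mult_sum[of _ m m _ m]) auto
  also have "\<dots> = (if i = j then 1 else 0)" unfolding ST(3) using ij by (simp add: index_one_mat)
  finally show ?thesis .
qed

section \<open>The flows in closed form\<close>

definition gmat :: "nat \<Rightarrow> complex mat \<Rightarrow> complex \<Rightarrow> complex mat" where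
  "gmat n P \<zeta> = 1\<^sub>m n + (\<zeta> - 1) \<cdot>\<^sub>m P"

lemma gmat_carrier [simp]: "P \<in> carrier_mat n n \<Longrightarrow> gmat n P \<zeta> \<in> carrier_mat n n"
  by (simp add: gmat_def)

lemma gmat_mult_left:
  assumes "P \<in> carrier_mat n n" "A \<in> carrier_mat n n"
  shows "gmat n P \<zeta> * A = A + (\<zeta> - 1) \<cdot>\<^sub>m (P * A)"
  unfolding gmat_def using assms
  by (simp add: add_mult_distrib_mat[of _ n n _ _ n] mult_smult_assoc_mat[of _ n n _ n]
      left_mult_one_mat[of _ n n])

lemma gmat_mult_right:
  assumes "P \<in> carrier_mat n n" "A \<in> carrier_mat n n"
  shows "A * gmat n P \<zeta> = A + (\<zeta> - 1) \<cdot>\<^sub>m (A * P)"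
  unfolding gmat_def using assms
  by (simp add: mult_add_distrib_mat[of _ n n _ n] mult_smult_distrib[of _ n n _ n]
      right_mult_one_mat[of _ n n])

lemma gmat_one: "P \<in> carrier_mat n n \<Longrightarrow> gmat n P 1 = 1\<^sub>m n"
  unfolding gmat_def by (intro eq_matI) auto

text \<open>For idempotent \<open>P\<close>, \<open>gmat n P \<zeta>\<close> is the scalar
  \<open>\<zeta>\<close> on the image of \<open>P\<close> and the identity on its kernel; for
  \<open>\<zeta> = exp q\<close> it is the matrix exponential of q P.\<close>

lemma gmat_mult:
  assumes P: "P \<in> carrier_mat n n" "P * P = P"
  shows "gmat n P \<zeta> * gmat n P \<eta> = gmat n P (\<zeta> * \<eta>)"
proof -
  have "gmat n P \<zeta> * gmat n P \<eta> = gmat n P \<eta> + (\<zeta> - 1) \<cdot>\<^sub>m (P * gmat n P \<eta>)"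
    using P by (intro gmat_mult_left) auto
  also have "P * gmat n P \<eta> = P + (\<eta> - 1) \<cdot>\<^sub>m P"
    using P gmat_mult_right[OF P(1,1)] by simp
  also have "gmat n P \<eta> + (\<zeta> - 1) \<cdot>\<^sub>m (P + (\<eta> - 1) \<cdot>\<^sub>m P) = gmat n P (\<zeta> * \<eta>)"
    unfolding gmat_def using P by (intro eq_matI) (auto simp: algebra_simps)
  finally show ?thesis .
qed

lemma gmat_proj:
  assumes P: "P \<in> carrier_mat n n" "P * P = P"
  shows "gmat n P \<zeta> * P = \<zeta> \<cdot>\<^sub>m P" "P * gmat n P \<zeta> = \<zeta> \<cdot>\<^sub>m P"
  using P by (auto simp: gmat_mult_left gmat_mult_right algebra_simps intro!: eq_matI)

definition act :: "nat \<Rightarrow> nat \<Rightarrow> nat \<Rightarrow> complex \<Rightarrow> point \<Rightarrow> point" where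
  "act n m k \<zeta> y =
     (fst y, gmat n (eproj n m k y) (1 / \<zeta>) * proj y * gmat n (eproj n m k y) \<zeta>)"

lemma fst_act [simp]: "fst (act n m k \<zeta> y) = fst y"
  by (simp add: act_def)

lemma eproj_dim [simp]: "dim_row (eproj n m k y) = n" "dim_col (eproj n m k y) = n"
  using carrier_matD[OF eproj_carrier[of n m k y]] by simp_all

text \<open>The last column of the rank one projection spans the eigenspace, and dividing by the corner entry
  normalizes the last entry of the eigenvector to 1.\<close>

definition acoord :: "nat \<Rightarrow> nat \<Rightarrow> nat \<Rightarrow> point \<Rightarrow> complex" where
  "acoord n m k y = (proj y * eproj n m k y) $$ (m, m - 1) / eproj n m k y $$ (m - 1, m - 1)"

context
  fixes n m k y \<zeta> P x G H
  assumes y: "y \<in> M_Omega_e n" and m: "m \<in> {1..n}" and k: "k \<in> {1..m}" and zeta: "\<zeta> \<noteq> 0"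
  defines "P \<equiv> eproj n m k y" and "x \<equiv> proj y"
    and "G \<equiv> gmat n P \<zeta>" and "H \<equiv> gmat n P (1 / \<zeta>)"
begin

private lemma car: "x \<in> carrier_mat n n" "P \<in> carrier_mat n n" "G \<in> carrier_mat n n"
  "H \<in> carrier_mat n n"
  using M_Omega_eD(3)[OF y] by (auto simp: x_def P_def G_def H_def)

private lemma dims: "dim_row x = n" "dim_col x = n" "dim_row P = n" "dim_col P = n"
  "dim_row G = n" "dim_col G = n" "dim_row H = n" "dim_col H = n"
  using car by auto

private lemma snd_act: "proj (act n m k \<zeta> y) = H * x * G"
  by (simp add: act_def H_def G_def P_def x_def)

private lemma GH: "G * H = 1\<^sub>m n" "H * G = 1\<^sub>m n"
  using gmat_mult[OF car(2)] eproj_idem[OF y m k] gmat_one[OF car(2)] zeta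
  by (simp_all add: G_def H_def P_def)

private lemma outside: "i < n \<Longrightarrow> j < n \<Longrightarrow> m \<le> i \<or> m \<le> j \<Longrightarrow> P $$ (i, j) = 0"
  unfolding P_def by (rule eproj_outside)

private lemma GH_block:
  assumes "i < n" "j < n" "i \<noteq> j" "m \<le> i \<or> m \<le> j"
  shows "G $$ (i, j) = 0" "H $$ (i, j) = 0"
  using assms outside[of i j] dims by (auto simp: G_def H_def gmat_def)

private lemma H_row:
  assumes A: "A \<in> carrier_mat n n" and "m \<le> i" "i < n" "j < n"
  shows "(H * A) $$ (i, j) = A $$ (i, j)"
proof -
  have "(P * A) $$ (i, j) = (\<Sum>l<n. P $$ (i, l) * A $$ (l, j))"
    using assms car by (intro index_mult_sum) auto
  also have "\<dots> = 0" using assms outside by (intro sum.neutral) auto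
  finally show ?thesis
    unfolding H_def gmat_mult_left[OF car(2) A] using assms dims carrier_matD[OF A]
    by (simp del: index_mult_mat(1))
qed

private lemma G_col:
  assumes A: "A \<in> carrier_mat n n" and "m \<le> j" "i < n" "j < n"
  shows "(A * G) $$ (i, j) = A $$ (i, j)"
proof -
  have "(A * P) $$ (i, j) = (\<Sum>l<n. A $$ (i, l) * P $$ (l, j))"
    using assms car by (intro index_mult_sum[of _ n n _ n]) auto
  also have "\<dots> = 0" using assms outside by (intro sum.neutral) auto
  finally show ?thesis
    unfolding G_def gmat_mult_right[OF car(2) A] using assms dims carrier_matD[OF A]
    by (simp del: index_mult_mat(1))
qed

text \<open>In the leading block \<open>x * P\<close>, \<open>P * x\<close> and
  \<open>P * x * P\<close> are the same multiple of \<open>P\<close>, and the total coefficient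
  \<open>(\<zeta> - 1) + (1 / \<zeta> - 1) + (\<zeta> - 1) * (1 / \<zeta> - 1)\<close> is 0.\<close>

lemma act_index_low:
  assumes ij: "i < m" "j < m"
  shows "proj (act n m k \<zeta> y) $$ (i, j) = x $$ (i, j)"
proof -
  let ?mu = "nu_entry (fst y) k m"
  have n: "i < n" "j < n" using ij m by auto
  have xP: "(x * P) $$ (i, j) = ?mu * P $$ (i, j)"
    unfolding x_def P_def by (rule eproj_left[OF y m k ij(1) n(2)])
  have Px: "(P * x) $$ (i, j) = ?mu * P $$ (i, j)"
    unfolding x_def P_def by (rule eproj_right[OF y m k n(1) ij(2)])
  have "(P * (x * P)) $$ (i, j) = (\<Sum>l<n. P $$ (i, l) * (x * P) $$ (l, j))"
    using n car by (intro index_mult_sum) auto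
  also have "\<dots> = (\<Sum>l<n. ?mu * (P $$ (i, l) * P $$ (l, j)))"
  proof (intro sum.cong refl)
    fix l assume "l \<in> {..<n}"
    then show "P $$ (i, l) * (x * P) $$ (l, j) = ?mu * (P $$ (i, l) * P $$ (l, j))"
      using eproj_left[OF y m k _ n(2), of l] outside[of i l] n(1)
      by (cases "l < m") (auto simp: x_def P_def simp del: index_mult_mat)
  qed
  also have "\<dots> = ?mu * (P * P) $$ (i, j)"
    using n by (subst index_mult_sum[OF car(2,2)]) (auto simp: sum_distrib_left)
  also have "P * P = P" unfolding P_def by (rule eproj_idem[OF y m k])
  finally have PxP: "(P * (x * P)) $$ (i, j) = ?mu * P $$ (i, j)" .
  have "H * x * G = H * (x + (\<zeta> - 1) \<cdot>\<^sub>m (x * P))"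
    using car gmat_mult_right[OF car(2,1), of \<zeta>] by (simp add: G_def[symmetric] assoc_mult_mat[of _ n n _ n _ n])
  also have "\<dots> = (x + (\<zeta> - 1) \<cdot>\<^sub>m (x * P)) +
      (1 / \<zeta> - 1) \<cdot>\<^sub>m (P * (x + (\<zeta> - 1) \<cdot>\<^sub>m (x * P)))"
    unfolding H_def using car by (intro gmat_mult_left) auto
  also have "P * (x + (\<zeta> - 1) \<cdot>\<^sub>m (x * P)) = P * x + (\<zeta> - 1) \<cdot>\<^sub>m (P * (x * P))"
    using car by (simp add: mult_add_distrib_mat[of _ n n _ n] mult_smult_distrib[of _ n n _ n])
  finally have "(H * x * G) $$ (i, j) = x $$ (i, j) + (\<zeta> - 1) * (x * P) $$ (i, j) +
      (1 / \<zeta> - 1) * ((P * x) $$ (i, j) + (\<zeta> - 1) * (P * (x * P)) $$ (i, j))"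
    using n dims by (simp del: index_mult_mat(1))
  also have "\<dots> = x $$ (i, j)"
    unfolding xP Px PxP using zeta by (simp add: field_simps)
  finally show ?thesis unfolding snd_act .
qed

lemma act_cutoff_le: "l \<le> m \<Longrightarrow> cutoff l (proj (act n m k \<zeta> y)) = cutoff l (proj y)"
  using act_index_low by (intro eq_matI) (auto simp: cutoff_def x_def)

lemma act_eproj_le: "l \<le> m \<Longrightarrow> eproj n l k' (act n m k \<zeta> y) = eproj n l k' y"
  by (simp add: eproj_def act_cutoff_le)

text \<open>\<open>G\<close> and \<open>H\<close> differ from the identity only in the leading block
  of size \<open>m\<close>; they are block diagonal for every cut at \<open>l \<ge> m\<close>, so
  the cutoff is multiplicative on the products in question.\<close>

private lemma cutoff_GH:
  assumes "m \<le> l" "l \<le> n"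
  shows "cutoff l G * cutoff l H = 1\<^sub>m l" "cutoff l H * cutoff l G = 1\<^sub>m l"
    "cutoff l (proj (act n m k \<zeta> y)) = cutoff l H * cutoff l x * cutoff l G"
proof -
  have *: "\<forall>i<l. \<forall>j. l \<le> j \<longrightarrow> j < n \<longrightarrow> G $$ (i, j) = 0"
    "\<forall>i<l. \<forall>j. l \<le> j \<longrightarrow> j < n \<longrightarrow> H $$ (i, j) = 0"
    "\<forall>i<l. \<forall>j. l \<le> j \<longrightarrow> j < n \<longrightarrow> G $$ (j, i) = 0"
    using assms by (auto intro!: GH_block)
  show "cutoff l G * cutoff l H = 1\<^sub>m l" "cutoff l H * cutoff l G = 1\<^sub>m l"
    using cutoff_mult[OF car(3,4) assms(2)] cutoff_mult[OF car(4,3) assms(2)] * GH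
      cutoff_one[OF assms(2)] by auto
  have "cutoff l (H * x * G) = cutoff l (H * x) * cutoff l G"
    using car * assms by (intro cutoff_mult[of _ n]) auto
  also have "cutoff l (H * x) = cutoff l H * cutoff l x"
    using car * assms by (intro cutoff_mult[of _ n]) auto
  finally show "cutoff l (proj (act n m k \<zeta> y)) = cutoff l H * cutoff l x * cutoff l G"
    unfolding snd_act .
qed

private lemma snd_act_carrier: "proj (act n m k \<zeta> y) \<in> carrier_mat n n"
  unfolding snd_act using car by auto

text \<open>Leading blocks up to size \<open>m\<close> do not change and larger ones are conjugated,
  so the labels in \<open>fst y\<close> still fit.\<close>

lemma act_in: "act n m k \<zeta> y \<in> M_Omega_e n"
proof -
  have "similar_mat (fst y l) (cutoff l (proj (act n m k \<zeta> y)))" if l: "l \<in> {1..n}" for l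
  proof (cases "l \<le> m")
    case True
    then show ?thesis using act_cutoff_le M_Omega_eD(4)[OF y l] by simp
  next
    case False
    then have l': "m \<le> l" "l \<le> n" using l by auto
    have "similar_mat (cutoff l (proj (act n m k \<zeta> y))) (cutoff l x)"
      using cutoff_GH[OF l'] by (intro similar_matI[of _ _ "cutoff l H" "cutoff l G" l]) auto
    then show ?thesis
      using M_Omega_eD(4)[OF y l] unfolding x_def by (meson similar_mat_sym similar_mat_trans)
  qed
  then have "(fst y, proj (act n m k \<zeta> y)) \<in> M_Omega_e n"
    by (intro M_Omega_eI M_Omega_eD(1)[OF y] snd_act_carrier)
  then show ?thesis by (simp add: act_def)
qed

text \<open>Spectral projections are equivariant under conjugation. As \<open>G\<close> and
  \<open>H\<close> are block diagonal at \<open>l\<close>, conjugating the padded projection creates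
  no entries outside the leading block of size \<open>l\<close>.\<close>

lemma act_eproj_ge:
  assumes l: "m \<le> l" "l \<le> n"
  shows "eproj n l k' (act n m k \<zeta> y) = H * eproj n l k' y * G"
proof -
  let ?A = "cutoff l x" and ?B = "cutoff l (proj (act n m k \<zeta> y))"
  let ?h = "cutoff l H" and ?g = "cutoff l G" and ?d = "\<lambda>i. nu_entry (fst y) i l"
  let ?R = "eproj n l k' y"
  note c = cutoff_GH[OF l]
  have "?B * ?h = ?h * ?A * (?g * ?h)"
    unfolding c(3) by (simp add: assoc_mult_mat[of _ l l _ l _ l])
  also have "\<dots> = ?h * ?A"
    unfolding c(1) by (intro right_mult_one_mat[of _ l l]) simp
  finally have "spectral_proj l ?B ?d k' * ?h = ?h * spectral_proj l ?A ?d k'"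
    by (intro spectral_proj_intertwine) auto
  then have "spectral_proj l ?B ?d k' * (?h * ?g) = ?h * spectral_proj l ?A ?d k' * ?g"
    by (simp add: assoc_mult_mat[of _ l l _ l _ l, symmetric] del: assoc_mult_mat)
  moreover have "spectral_proj l ?B ?d k' * (?h * ?g) = spectral_proj l ?B ?d k'"
    unfolding c(2) by (intro right_mult_one_mat[of _ l l]) simp
  ultimately have B: "spectral_proj l ?B ?d k' = ?h * spectral_proj l ?A ?d k' * ?g" by simp
  have RA: "cutoff l ?R = spectral_proj l ?A ?d k'"
    unfolding eproj_def x_def using l by (intro cutoff_pad) auto
  have *: "\<forall>i<l. \<forall>j. l \<le> j \<longrightarrow> j < n \<longrightarrow> H $$ (i, j) = 0"
    "\<forall>i<l. \<forall>j. l \<le> j \<longrightarrow> j < n \<longrightarrow> G $$ (j, i) = 0"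
    using l by (auto intro!: GH_block)
  have R: "?R \<in> carrier_mat n n" by simp
  have "cutoff l (H * ?R * G) = cutoff l (H * ?R) * ?g"
    using car * l by (intro cutoff_mult[of _ n]) auto
  also have "cutoff l (H * ?R) = ?h * cutoff l ?R"
    using car * l by (intro cutoff_mult[of _ n]) auto
  finally have "spectral_proj l ?B ?d k' = cutoff l (H * ?R * G)"
    unfolding B RA by simp
  then have "eproj n l k' (act n m k \<zeta> y) = pad n (cutoff l (H * ?R * G))"
    by (simp add: eproj_def)
  also have "\<dots> = H * ?R * G"
  proof (rule pad_cutoff)
    fix i j assume ij: "i < n" "j < n" and lij: "l \<le> i \<or> l \<le> j"
    show "(H * ?R * G) $$ (i, j) = 0"
    proof (cases "l \<le> i")
      case True
      have "(H * ?R * G) $$ (i, j) = (H * (?R * G)) $$ (i, j)"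
        using car R by (simp add: assoc_mult_mat[of _ n n _ n _ n] del: index_mult_mat)
      also have "\<dots> = (?R * G) $$ (i, j)"
        using True l ij car R by (intro H_row) auto
      also have "\<dots> = (\<Sum>q<n. ?R $$ (i, q) * G $$ (q, j))"
        using ij car R by (intro index_mult_sum) auto
      also have "\<dots> = 0" using ij True by (intro sum.neutral) (auto simp: eproj_outside)
      finally show ?thesis .
    next
      case False
      then have j: "l \<le> j" using lij by simp
      have "(H * ?R * G) $$ (i, j) = (H * ?R) $$ (i, j)"
        using j l ij car R by (intro G_col) auto
      also have "\<dots> = (\<Sum>q<n. H $$ (i, q) * ?R $$ (q, j))"
        using ij car R by (intro index_mult_sum) auto
      also have "\<dots> = 0" using ij j by (intro sum.neutral) (auto simp: eproj_outside)
      finally show ?thesis .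
    qed
  qed (use car l in auto)
  finally show ?thesis .
qed

lemma act_act_inverse: "act n m k (1 / \<zeta>) (act n m k \<zeta> y) = y"
proof -
  have "proj (act n m k (1 / \<zeta>) (act n m k \<zeta> y)) = G * (H * x * G) * H"
    unfolding act_def[of n m k "1 / \<zeta>"] act_eproj_le[OF order_refl] snd_act
    by (simp add: G_def H_def P_def)
  also have "\<dots> = (G * H) * (x * (G * H))"
    using car by (simp add: assoc_mult_mat[of _ n n _ n _ n])
  also have "\<dots> = x" unfolding GH using car(1) by simp
  finally show ?thesis by (simp add: prod_eq_iff x_def)
qed

text \<open>Below level \<open>m\<close> only unchanged entries of \<open>x\<close> enter. At level
  \<open>m\<close> orthogonality of the projections leaves the factor \<open>\<zeta>\<close> for
  \<open>k' = k\<close> and 1 otherwise. Above level \<open>m\<close> the projection is conjugated,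
  but the entries that enter lie in rows fixed by \<open>H\<close> and columns fixed by
  \<open>G\<close>.\<close>

lemma acoord_act:
  assumes l: "l \<in> {1..<n}" and k': "k' \<in> {1..l}"
  shows "acoord n l k' (act n m k \<zeta> y) = (if m = l \<and> k = k' then \<zeta> else 1) * acoord n l k' y"
proof -
  let ?R = "eproj n l k' y" and ?x = "proj (act n m k \<zeta> y)"
  have R: "?R \<in> carrier_mat n n" by simp
  have l1: "l < n" "l - 1 < n" using l by auto
  consider "l < m" | "l = m" | "m < l" by linarith
  then show ?thesis
  proof cases
    case 1
    have "(?x * ?R) $$ (l, l - 1) = (\<Sum>i<n. ?x $$ (l, i) * ?R $$ (i, l - 1))"
      using l1 R snd_act_carrier by (intro index_mult_sum[of _ n n _ n]) auto
    also have "\<dots> = (\<Sum>i<n. x $$ (l, i) * ?R $$ (i, l - 1))"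
    proof (intro sum.cong refl)
      fix i assume "i \<in> {..<n}"
      then show "?x $$ (l, i) * ?R $$ (i, l - 1) = x $$ (l, i) * ?R $$ (i, l - 1)"
        using 1 l1 act_index_low[of l i] by (cases "i < l") (auto simp: eproj_outside)
    qed
    also have "\<dots> = (x * ?R) $$ (l, l - 1)"
      using l1 R car by (intro index_mult_sum[of _ n n _ n, symmetric]) auto
    finally show ?thesis
      using 1 by (simp add: acoord_def act_eproj_le x_def del: index_mult_mat)
  next
    case 2
    have "(?x * ?R) $$ (l, l - 1) = (H * (x * (G * ?R))) $$ (l, l - 1)"
      unfolding snd_act using car R by (simp add: assoc_mult_mat[of _ n n _ n _ n] del: index_mult_mat)
    also have "\<dots> = (x * (G * ?R)) $$ (l, l - 1)"
      using 2 l1 car R by (intro H_row) auto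
    also have "G * ?R = ?R + (\<zeta> - 1) \<cdot>\<^sub>m (P * ?R)"
      unfolding G_def by (rule gmat_mult_left[OF car(2) R])
    also have "P * ?R = (if k = k' then P else 0\<^sub>m n n)"
      unfolding P_def using eproj_mult[OF y m k] k' 2 by simp
    also have "?R + (\<zeta> - 1) \<cdot>\<^sub>m (if k = k' then P else 0\<^sub>m n n) = (if k = k' then \<zeta> else 1) \<cdot>\<^sub>m ?R"
      using 2 car R by (intro eq_matI) (auto simp: P_def algebra_simps)
    also have "x * \<dots> = (if k = k' then \<zeta> else 1) \<cdot>\<^sub>m (x * ?R)"
      using car R by (intro mult_smult_distrib) auto
    also have "\<dots> $$ (l, l - 1) = (if k = k' then \<zeta> else 1) * (x * ?R) $$ (l, l - 1)"
      using l1 dims R by (simp del: index_mult_mat(1))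
    finally show ?thesis
      using 2 act_eproj_le[of l k'] by (simp add: acoord_def x_def del: index_mult_mat)
  next
    case 3
    have eq: "eproj n l k' (act n m k \<zeta> y) = H * ?R * G"
      using 3 l by (intro act_eproj_ge) auto
    have "?x * (H * ?R * G) = H * (x * ((G * H) * (?R * G)))"
      unfolding snd_act using car R by (simp add: assoc_mult_mat[of _ n n _ n _ n])
    also have "\<dots> = H * (x * ?R * G)"
      unfolding GH using car R by (simp add: assoc_mult_mat[of _ n n _ n _ n])
    finally have "(?x * (H * ?R * G)) $$ (l, l - 1) = (H * (x * ?R * G)) $$ (l, l - 1)" by simp
    also have "\<dots> = (x * ?R * G) $$ (l, l - 1)"
      using 3 l1 car R by (intro H_row) auto
    also have "\<dots> = (x * ?R) $$ (l, l - 1)"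
      using 3 l1 car R by (intro G_col) auto
    finally have num: "(?x * (H * ?R * G)) $$ (l, l - 1) = (x * ?R) $$ (l, l - 1)" .
    have "(H * ?R * G) $$ (l - 1, l - 1) = (H * ?R) $$ (l - 1, l - 1)"
      using 3 l1 car R by (intro G_col) auto
    also have "\<dots> = ?R $$ (l - 1, l - 1)"
      using 3 l1 car R by (intro H_row) auto
    finally show ?thesis
      using 3 num unfolding acoord_def eq x_def by simp
  qed
qed

end

section \<open>Nonvanishing of the functions a and the Hessenberg condition\<close>

lemma M_Omega_disjoint:
  assumes "x \<in> M_Omega n" "m \<in> {1..<n}"
    "eigenvalue (cutoff m x) z" "eigenvalue (cutoff (Suc m) x) z"
  shows False
  using assms by (auto simp: M_Omega_def)

context
  fixes n m k y P x \<mu>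
  assumes y: "y \<in> M_Omega_e n" and m: "m \<in> {1..n}" and k: "k \<in> {1..m}"
  defines "P \<equiv> eproj n m k y" and "x \<equiv> proj y" and "\<mu> \<equiv> nu_entry (fst y) k m"
begin

private lemma x_P_carrier: "x \<in> carrier_mat n n" "P \<in> carrier_mat n n"
  using M_Omega_eD(3)[OF y] by (auto simp: x_def P_def)

private lemma eigenvalue_mu: "eigenvalue (cutoff m x) \<mu>"
  using M_Omega_e_eigenvalue[OF y m] k by (auto simp: x_def \<mu>_def)

private lemma sum_left:
  assumes "i < m" "j < m" "m \<le> l" "l \<le> n"
  shows "(\<Sum>q<l. x $$ (i, q) * P $$ (q, j)) = \<mu> * P $$ (i, j)"
proof -
  have "(\<Sum>q<n. x $$ (i, q) * P $$ (q, j)) = (x * P) $$ (i, j)"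
    using assms x_P_carrier by (subst index_mult_sum[of _ n n _ n]) auto
  also have "\<dots> = \<mu> * P $$ (i, j)"
    unfolding x_def P_def \<mu>_def using assms by (intro eproj_left[OF y m k]) auto
  finally show ?thesis
    using sum_lessThan_trunc[of l n "\<lambda>q. x $$ (i, q) * P $$ (q, j)"] assms
    by (simp add: P_def eproj_outside)
qed

private lemma sum_right:
  assumes "i < m" "j < m"
  shows "(\<Sum>q<m. P $$ (i, q) * x $$ (q, j)) = \<mu> * P $$ (i, j)"
proof -
  have "(\<Sum>q<n. P $$ (i, q) * x $$ (q, j)) = (P * x) $$ (i, j)"
    using assms x_P_carrier m by (subst index_mult_sum[of _ n n _ n]) auto
  also have "\<dots> = \<mu> * P $$ (i, j)"
    unfolding x_def P_def \<mu>_def using assms m by (intro eproj_right[OF y m k]) auto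
  finally show ?thesis
    using sum_lessThan_trunc[of m n "\<lambda>q. P $$ (i, q) * x $$ (q, j)"] assms m
    by (simp add: P_def eproj_outside)
qed

text \<open>A zero corner forces a left or a right eigenvector of the block of size m to end in 0.
  Deleting that entry leaves an eigenvector of the block of size m - 1 with the same eigenvalue,
  which \<open>M_Omega\<close> excludes.\<close>

lemma eproj_corner_nonzero: "eproj n m k y $$ (m - 1, m - 1) \<noteq> 0"
proof
  assume "eproj n m k y $$ (m - 1, m - 1) = 0"
  then have corner: "P $$ (m - 1, m - 1) = 0" by (simp add: P_def)
  \<comment> \<open>Trace 1 provides a nonzero diagonal entry, whose row and column are then nonzero
    left and right eigenvectors.\<close>
  have "\<exists>i<n. P $$ (i, i) \<noteq> 0"
  proof (rule ccontr)
    assume "\<not> ?thesis"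
    then have "mat_trace P = 0" using x_P_carrier by (auto simp: mat_trace_def)
    then show False using eproj_trace[OF y m k] by (simp add: P_def)
  qed
  then obtain i where i: "i < m" "P $$ (i, i) \<noteq> 0"
    using eproj_outside[of _ n _ m k y] unfolding P_def by (metis not_le_imp_less)
  have im: "i < m - 1" using i corner by (cases "i = m - 1") auto
  have mn: "m - 1 \<in> {1..<n}" "Suc (m - 1) = m" "m - 1 < m" using im m by auto
  have split: "(\<Sum>q<m. f q) = (\<Sum>q<m - 1. f q)" if "f (m - 1) = 0" for f :: "nat \<Rightarrow> complex"
    using that sum.lessThan_Suc[of f "m - 1"] mn(2) by simp
  \<comment> \<open>By rank one the product equals \<open>P $$ (i, i) * P $$ (m - 1, m - 1)\<close>,
    so this row or this column ends in 0.\<close>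
  have "P $$ (i, m - 1) * P $$ (m - 1, i) = 0"
    using eproj_rank1[OF y m k, of i i "m - 1" "m - 1"] i mn(3) corner by (simp add: P_def)
  then consider "P $$ (i, m - 1) = 0" | "P $$ (m - 1, i) = 0" by auto
  then have "eigenvalue (cutoff (m - 1) x) \<mu>"
  proof cases
    case 1
    show ?thesis
    proof (rule eigenvalueI_left[of _ "m - 1" i "\<lambda>j. P $$ (i, j)"])
      fix j assume j: "j < m - 1"
      then have "(\<Sum>q<m - 1. P $$ (i, q) * cutoff (m - 1) x $$ (q, j)) =
          (\<Sum>q<m - 1. P $$ (i, q) * x $$ (q, j))" by (simp add: cutoff_index)
      also have "\<dots> = (\<Sum>q<m. P $$ (i, q) * x $$ (q, j))"
        using 1 by (intro split[symmetric]) simp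
      also have "\<dots> = \<mu> * P $$ (i, j)" using i j by (intro sum_right) auto
      finally show "(\<Sum>q<m - 1. P $$ (i, q) * cutoff (m - 1) x $$ (q, j)) = \<mu> * P $$ (i, j)" .
    qed (use im i in auto)
  next
    case 2
    show ?thesis
    proof (rule eigenvalueI[of _ "m - 1" i "\<lambda>j. P $$ (j, i)"])
      fix j assume j: "j < m - 1"
      then have "(\<Sum>q<m - 1. cutoff (m - 1) x $$ (j, q) * P $$ (q, i)) =
          (\<Sum>q<m - 1. x $$ (j, q) * P $$ (q, i))" by (simp add: cutoff_index)
      also have "\<dots> = (\<Sum>q<m. x $$ (j, q) * P $$ (q, i))"
        using 2 by (intro split[symmetric]) simp
      also have "\<dots> = \<mu> * P $$ (j, i)" using i j m by (intro sum_left) auto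
      finally show "(\<Sum>q<m - 1. cutoff (m - 1) x $$ (j, q) * P $$ (q, i)) = \<mu> * P $$ (j, i)" .
    qed (use im i in auto)
  qed
  then show False
    using M_Omega_disjoint[OF M_Omega_eD(2)[OF y] mn(1)] eigenvalue_mu mn(2) by (simp add: x_def)
qed

text \<open>Otherwise the eigenvector of the block of size m, extended by a 0, would be an
  eigenvector of the block of size m + 1 with the same eigenvalue.\<close>

lemma eproj_row_nonzero:
  assumes "m < n"
  shows "(proj y * eproj n m k y) $$ (m, m - 1) \<noteq> 0"
proof
  assume "(proj y * eproj n m k y) $$ (m, m - 1) = 0"
  moreover have "(x * P) $$ (m, m - 1) = (\<Sum>q<n. x $$ (m, q) * P $$ (q, m - 1))"
    using x_P_carrier assms m by (intro index_mult_sum[of _ n n _ n]) auto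
  moreover have "\<dots> = (\<Sum>q<Suc m. x $$ (m, q) * P $$ (q, m - 1))"
    using assms by (intro sum_lessThan_trunc) (auto simp: P_def eproj_outside)
  ultimately have 0: "(\<Sum>q<Suc m. x $$ (m, q) * P $$ (q, m - 1)) = 0"
    by (simp add: x_def P_def del: sum.lessThan_Suc index_mult_mat)
  have out: "P $$ (m, m - 1) = 0" using assms m by (auto simp: P_def eproj_outside)
  have "eigenvalue (cutoff (Suc m) x) \<mu>"
  proof (rule eigenvalueI[of _ "Suc m" "m - 1" "\<lambda>i. P $$ (i, m - 1)"])
    fix i assume i: "i < Suc m"
    have "(\<Sum>j<Suc m. cutoff (Suc m) x $$ (i, j) * P $$ (j, m - 1)) =
        (\<Sum>j<Suc m. x $$ (i, j) * P $$ (j, m - 1))"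
      using i by (intro sum.cong) (auto simp: cutoff_index)
    also have "\<dots> = \<mu> * P $$ (i, m - 1)"
      using i 0 out sum_left[of i "m - 1" "Suc m"] assms m by (cases "i = m") auto
    finally show "(\<Sum>j<Suc m. cutoff (Suc m) x $$ (i, j) * P $$ (j, m - 1)) = \<mu> * P $$ (i, m - 1)" .
  qed (use eproj_corner_nonzero m in \<open>auto simp: P_def\<close>)
  then show False
    using M_Omega_disjoint[OF M_Omega_eD(2)[OF y], of m] eigenvalue_mu assms m by (simp add: x_def)
qed

lemma acoord_nonzero: "m < n \<Longrightarrow> acoord n m k y \<noteq> 0"
  using eproj_corner_nonzero eproj_row_nonzero by (simp add: acoord_def)

end

text \<open>Let \<open>r\<close> be the first \<open>m\<close> entries of row \<open>m\<close> of x
  minus those that Hessenberg form prescribes. The equations \<open>acoord n m k y = 1\<close> say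
  that \<open>r\<close> annihilates the last column of each projection of level \<open>m\<close>,
  hence by rank one every column; as the projections sum to the identity, \<open>r\<close>
  vanishes.\<close>

lemma hessenberg_iff_acoord:
  assumes y: "y \<in> M_Omega_e n"
  shows "proj y \<in> hessenberg n \<longleftrightarrow> (\<forall>m\<in>{1..<n}. \<forall>k\<in>{1..m}. acoord n m k y = 1)"
proof -
  let ?x = "proj y"
  have x: "?x \<in> carrier_mat n n" by (rule M_Omega_eD(3)[OF y])
  let ?row = "\<lambda>m. \<forall>i<m. ?x $$ (m, i) = (if i = m - 1 then 1 else 0)"
  have hess: "?x \<in> hessenberg n \<longleftrightarrow> (\<forall>m\<in>{1..<n}. ?row m)"
  proof
    assume h: "?x \<in> hessenberg n"
    show "\<forall>m\<in>{1..<n}. ?row m"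
    proof (intro ballI allI impI)
      fix m i assume "m \<in> {1..<n}" "i < m"
      then show "?x $$ (m, i) = (if i = m - 1 then 1 else 0)"
        using h by (auto simp: hessenberg_def)
    qed
  next
    assume r: "\<forall>m\<in>{1..<n}. ?row m"
    show "?x \<in> hessenberg n"
      unfolding hessenberg_def using x r by auto
  qed
  have "?row m \<longleftrightarrow> (\<forall>k\<in>{1..m}. acoord n m k y = 1)" if m: "m \<in> {1..<n}" for m
  proof -
    have m': "m \<in> {1..n}" "m < n" "m - 1 < m" using m by auto
    let ?P = "\<lambda>k. eproj n m k y"
    define r where "r i = ?x $$ (m, i) - (if i = m - 1 then 1 else 0)" for i
    have sum: "(\<Sum>i<m. r i * ?P k $$ (i, m - 1)) =
        (?x * ?P k) $$ (m, m - 1) - ?P k $$ (m - 1, m - 1)" for k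
    proof -
      have "(?x * ?P k) $$ (m, m - 1) = (\<Sum>i<n. ?x $$ (m, i) * ?P k $$ (i, m - 1))"
        using x m' by (intro index_mult_sum[of _ n n _ n]) auto
      also have "\<dots> = (\<Sum>i<m. ?x $$ (m, i) * ?P k $$ (i, m - 1))"
        using m' by (intro sum_lessThan_trunc) (auto simp: eproj_outside)
      finally have *: "(?x * ?P k) $$ (m, m - 1) = (\<Sum>i<m. ?x $$ (m, i) * ?P k $$ (i, m - 1))" .
      have "(\<Sum>i<m. (if i = m - 1 then 1 else 0) * ?P k $$ (i, m - 1)) =
          (\<Sum>i<m. if i = m - 1 then ?P k $$ (m - 1, m - 1) else 0)"
        by (intro sum.cong) auto
      also have "\<dots> = ?P k $$ (m - 1, m - 1)" using m' by (subst sum.delta) auto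
      finally show ?thesis
        unfolding * r_def left_diff_distrib sum_subtractf by simp
    qed
    have a1: "acoord n m k y = 1 \<longleftrightarrow> (\<Sum>i<m. r i * ?P k $$ (i, m - 1)) = 0" if "k \<in> {1..m}" for k
      unfolding sum acoord_def using eproj_corner_nonzero[OF y m'(1) that]
      by (simp add: divide_eq_1_iff)
    have "(\<forall>k\<in>{1..m}. (\<Sum>i<m. r i * ?P k $$ (i, m - 1)) = 0) \<longleftrightarrow> (\<forall>i<m. r i = 0)"
    proof (intro iffI allI impI)
      fix j assume all: "\<forall>k\<in>{1..m}. (\<Sum>i<m. r i * ?P k $$ (i, m - 1)) = 0" and j: "j < m"
      \<comment> \<open>Up to the nonzero corner entry, rank one makes column \<open>j\<close> a
        multiple of the last column.\<close>
      have 0: "(\<Sum>i<m. r i * ?P k $$ (i, j)) = 0" if k: "k \<in> {1..m}" for k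
      proof -
        have "(\<Sum>i<m. r i * ?P k $$ (i, j)) * ?P k $$ (m - 1, m - 1) =
            (\<Sum>i<m. r i * (?P k $$ (i, j) * ?P k $$ (m - 1, m - 1)))"
          by (simp add: sum_distrib_right mult.assoc)
        also have "\<dots> = (\<Sum>i<m. r i * (?P k $$ (i, m - 1) * ?P k $$ (m - 1, j)))"
          using eproj_rank1[OF y m'(1) k] j m'(3) by (intro sum.cong) auto
        also have "\<dots> = (\<Sum>i<m. r i * ?P k $$ (i, m - 1)) * ?P k $$ (m - 1, j)"
          by (simp add: sum_distrib_right mult.assoc)
        also have "\<dots> = 0" using all k by simp
        finally show ?thesis using eproj_corner_nonzero[OF y m'(1) k] by simp
      qed
      have "0 = (\<Sum>k\<in>{1..m}. \<Sum>i<m. r i * ?P k $$ (i, j))" using 0 by simp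
      also have "\<dots> = (\<Sum>i<m. r i * (\<Sum>k\<in>{1..m}. ?P k $$ (i, j)))"
        by (subst sum.swap) (simp add: sum_distrib_left)
      also have "\<dots> = (\<Sum>i<m. if i = j then r j else 0)"
        using eproj_sum[OF y m'(1)] j by (intro sum.cong) auto
      also have "\<dots> = r j" using j by (subst sum.delta) auto
      finally show "r j = 0" by simp
    qed simp
    then show ?thesis using a1 by (auto simp: r_def)
  qed
  then show ?thesis unfolding hess by blast
qed

section \<open>Numbering the pairs (m, k) by one index\<close>

lemma dim_d_Suc: "dim_d (Suc m) = dim_d m + Suc m"
  by (simp add: dim_d_def)

lemma dim_d_mono: "m \<le> m' \<Longrightarrow> dim_d m \<le> dim_d m'"
  by (induction rule: dec_induct) (auto simp: dim_d_Suc)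

text \<open>The position \<open>(level j, index j)\<close> of \<open>r\<^bsub>j\<^esub>\<close>: the unique \<open>(m, k)\<close> with \<open>j = d(m - 1) + k\<close>
  and \<open>1 \<le> k \<le> m\<close>.\<close>

definition level :: "nat \<Rightarrow> nat" where
  "level j = (LEAST m. j \<le> dim_d m)"

definition index :: "nat \<Rightarrow> nat" where
  "index j = j - dim_d (level j - 1)"

lemma level_index:
  assumes "1 \<le> j"
  shows "1 \<le> level j" "index j \<in> {1..level j}" "j = dim_d (level j - 1) + index j"
    "j \<le> dim_d N \<Longrightarrow> level j \<le> N"
proof -
  have "j \<le> dim_d j" by (induction j) (auto simp: dim_d_Suc)
  then have le: "j \<le> dim_d (level j)" unfolding level_def by (rule LeastI)
  then show 1: "1 \<le> level j" using assms by (cases "level j") (auto simp: dim_d_def)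
  have "\<not> j \<le> dim_d (level j - 1)"
    using not_less_Least[of "level j - 1" "\<lambda>m. j \<le> dim_d m"] 1 by (simp add: level_def)
  moreover have "dim_d (level j) = dim_d (level j - 1) + level j"
    using dim_d_Suc[of "level j - 1"] 1 by simp
  ultimately show "index j \<in> {1..level j}" "j = dim_d (level j - 1) + index j"
    using le by (auto simp: index_def)
  show "j \<le> dim_d N \<Longrightarrow> level j \<le> N" unfolding level_def by (rule Least_le)
qed

lemma level_index_eq:
  assumes "1 \<le> k" "k \<le> m"
  shows "level (dim_d (m - 1) + k) = m" "index (dim_d (m - 1) + k) = k"
proof -
  have m: "dim_d m = dim_d (m - 1) + m" using assms dim_d_Suc[of "m - 1"] by simp
  show "level (dim_d (m - 1) + k) = m"
    unfolding level_def
  proof (rule Least_equality)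
    fix m' assume "dim_d (m - 1) + k \<le> dim_d m'"
    moreover have "dim_d m' \<le> dim_d (m - 1)" if "\<not> m \<le> m'"
      using that by (intro dim_d_mono) simp
    ultimately show "m \<le> m'" using assms by fastforce
  qed (use m assms in auto)
  then show "index (dim_d (m - 1) + k) = k" by (simp add: index_def)
qed

lemma dim_d_ge_position:
  assumes "1 \<le> k" "k \<le> m" "m < n"
  shows "dim_d (m - 1) + k \<in> {1..dim_d (n - 1)}"
proof -
  have "dim_d m \<le> dim_d (n - 1)" using assms by (intro dim_d_mono) simp
  then show ?thesis using assms dim_d_Suc[of "m - 1"] by simp
qed

lemma r_fun_eq: "1 \<le> j \<Longrightarrow> r_fun j y = nu_entry (fst y) (index j) (level j)"
  unfolding r_fun_def
proof (rule the_equality)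
  assume j: "1 \<le> j"
  show "\<exists>m k. 1 \<le> k \<and> k \<le> m \<and> j = dim_d (m - 1) + k \<and>
      nu_entry (fst y) (index j) (level j) = nu_entry (fst y) k m"
    using level_index[OF j] by (intro exI[of _ "level j"] exI[of _ "index j"]) auto
qed (use level_index_eq in auto)

lemma level_index_range:
  assumes "j \<in> {1..dim_d (n - 1)}"
  shows "level j \<in> {1..<n}" "level j \<in> {1..n}" "index j \<in> {1..level j}"
proof -
  have "1 \<le> j" "j \<le> dim_d (n - 1)" using assms by auto
  then have "1 \<le> level j" "level j \<le> n - 1" "index j \<in> {1..level j}"
    using level_index[of j] by blast+
  then show "level j \<in> {1..<n}" "level j \<in> {1..n}" "index j \<in> {1..level j}" by auto
qed

section \<open>Eigenvalues as local holomorphic functions\<close>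

context function_ring
begin

lemma Q_mult_mat:
  assumes "\<And>t. A t \<in> carrier_mat n n" "\<And>t. B t \<in> carrier_mat n n"
    and "\<And>i j. i < n \<Longrightarrow> j < n \<Longrightarrow> Q (\<lambda>t. A t $$ (i, j))"
    and "\<And>i j. i < n \<Longrightarrow> j < n \<Longrightarrow> Q (\<lambda>t. B t $$ (i, j))"
    and ij: "i < n" "j < n"
  shows "Q (\<lambda>t. (A t * B t) $$ (i, j))"
proof -
  have "(\<lambda>t. (A t * B t) $$ (i, j)) = (\<lambda>t. \<Sum>l<n. A t $$ (i, l) * B t $$ (l, j))"
    using assms(1,2) ij by (intro ext index_mult_sum) auto
  then show ?thesis using assms by (simp del: index_mult_mat(1)) (intro Q_sum Q_mult, auto)
qed

text \<open>\<open>Q\<close> stands for two notions: regularity on a set, for the morphisms, and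
  convergence to the value at a point, for the gradients. The inverse differences are a separate
  hypothesis \<open>Qi\<close>, since division is not among the closure properties of
  \<open>Q\<close>.\<close>

lemma Q_lagrange:
  assumes A: "\<And>t. A t \<in> carrier_mat m m"
    and QA: "\<And>i j. i < m \<Longrightarrow> j < m \<Longrightarrow> Q (\<lambda>t. A t $$ (i, j))"
    and Qd: "\<And>l. l \<in> set ls \<Longrightarrow> Q (\<lambda>t. d t l)"
    and Qi: "\<And>l. l \<in> set ls \<Longrightarrow> l \<noteq> k \<Longrightarrow> Q (\<lambda>t. 1 / (d t k - d t l))"
    and ij: "i < m" "j < m"
  shows "Q (\<lambda>t. lagrange (A t) (d t) k ls $$ (i, j))"
  using Qd Qi ij
proof (induction ls arbitrary: i j)
  case Nil
  have "dim_row (A t) = m" for t using A by auto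
  then show ?case using Nil by (simp add: Q_const)
next
  case (Cons l ls)
  have dim: "dim_row (A t) = m" for t using A by auto
  have IH: "Q (\<lambda>t. lagrange (A t) (d t) k ls $$ (i, j))" if "i < m" "j < m" for i j
    by (rule Cons.IH) (use Cons.prems that in auto)
  show ?case
  proof (cases "l = k")
    case True
    then show ?thesis using IH Cons.prems by simp
  next
    case False
    let ?B = "\<lambda>t. A t - d t l \<cdot>\<^sub>m 1\<^sub>m m"
    have B: "?B t \<in> carrier_mat m m" for t by (intro minus_carrier_mat) auto
    have L: "lagrange (A t) (d t) k ls \<in> carrier_mat m m" for t using A by simp
    have "Q (\<lambda>t. ?B t $$ (i, j))" if "i < m" "j < m" for i j
      using that Q_diff[OF QA Q_mult[OF Cons.prems(1) Q_const], of i j l "if i = j then 1 else 0"]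
      by simp
    then have "Q (\<lambda>t. (?B t * lagrange (A t) (d t) k ls) $$ (i, j))"
      using Cons.prems IH by (intro Q_mult_mat[of _ m] B L) auto
    then have *: "Q (\<lambda>t. 1 / (d t k - d t l) * (?B t * lagrange (A t) (d t) k ls) $$ (i, j))"
      using Cons.prems False by (intro Q_mult) auto
    have "lagrange (A t) (d t) k (l # ls) $$ (i, j) =
        1 / (d t k - d t l) * (?B t * lagrange (A t) (d t) k ls) $$ (i, j)" for t
      using carrier_matD[OF B[of t]] carrier_matD[OF L[of t]] Cons.prems False
      by (simp add: dim del: index_mult_mat(1))
    then show ?thesis using * by presburger
  qed
qed

lemma Q_eproj:
  assumes m: "m \<le> n" and k: "k \<in> {1..m}"
    and x: "\<And>i j. i < n \<Longrightarrow> j < n \<Longrightarrow> Q (\<lambda>t. proj (Y t) $$ (i, j))"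
    and nu: "\<And>l. l \<in> {1..m} \<Longrightarrow> Q (\<lambda>t. nu_entry (fst (Y t)) l m)"
    and inv: "\<And>l. l \<in> {1..m} \<Longrightarrow> l \<noteq> k \<Longrightarrow>
      Q (\<lambda>t. 1 / (nu_entry (fst (Y t)) k m - nu_entry (fst (Y t)) l m))"
    and ij: "i < n" "j < n"
  shows "Q (\<lambda>t. eproj n m k (Y t) $$ (i, j))"
proof (cases "i < m \<and> j < m")
  case True
  have "eproj n m k (Y t) $$ (i, j) = spectral_proj m (cutoff m (proj (Y t)))
      (\<lambda>l. nu_entry (fst (Y t)) l m) k $$ (i, j)" for t
    using True ij carrier_matD[OF spectral_proj_carrier[OF cutoff_carrier[of m "proj (Y t)"]]]
    by (simp add: eproj_def pad_def)
  moreover have "Q (\<lambda>t. spectral_proj m (cutoff m (proj (Y t)))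
      (\<lambda>l. nu_entry (fst (Y t)) l m) k $$ (i, j))"
    unfolding spectral_proj_def using True m x nu inv
    by (intro Q_lagrange[of _ m]) (auto simp: cutoff_index less_Suc_eq_le simp del: upt_Suc)
  ultimately show ?thesis by presburger
next
  case False
  then have "eproj n m k (Y t) $$ (i, j) = 0" for t using ij by (auto simp: eproj_outside)
  then show ?thesis by (simp add: Q_const)
qed

end

section \<open>Trace, norm and neighbourhoods of matrices\<close>

lemma mat_trace_mult:
  assumes "A \<in> carrier_mat n n" "B \<in> carrier_mat n n"
  shows "mat_trace (A * B) = (\<Sum>i<n. \<Sum>j<n. A $$ (i, j) * B $$ (j, i))"
proof -
  have "mat_trace (A * B) = (\<Sum>i<n. (A * B) $$ (i, i))"
    using assms by (simp add: mat_trace_def)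
  then show ?thesis using index_mult_sum[OF assms] by (simp del: index_mult_mat(1))
qed

lemma mat_trace_commute:
  assumes "A \<in> carrier_mat n n" "B \<in> carrier_mat n n"
  shows "mat_trace (A * B) = mat_trace (B * A)"
  unfolding mat_trace_mult[OF assms] mat_trace_mult[OF assms(2,1)]
  by (subst sum.swap) (simp add: mult.commute)

lemma mat_trace_diff:
  "A \<in> carrier_mat n n \<Longrightarrow> B \<in> carrier_mat n n \<Longrightarrow> mat_trace (A - B) = mat_trace A - mat_trace B"
  by (simp add: mat_trace_def sum_subtractf)

lemma mat_trace_smult: "A \<in> carrier_mat n n \<Longrightarrow> mat_trace (c \<cdot>\<^sub>m A) = c * mat_trace A"
  by (simp add: mat_trace_def sum_distrib_left)

lemma mat_norm1_diff:
  assumes "u \<in> carrier_mat n n" "x \<in> carrier_mat n n"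
  shows "mat_norm1 (u - x) = (\<Sum>i<n. \<Sum>j<n. cmod (u $$ (i, j) - x $$ (i, j)))"
  using assms by (simp add: mat_norm1_def)

lemma entry_le_mat_norm1:
  assumes "u \<in> carrier_mat n n" "x \<in> carrier_mat n n" "i < n" "j < n"
  shows "cmod (u $$ (i, j) - x $$ (i, j)) \<le> mat_norm1 (u - x)"
proof -
  have "cmod (u $$ (i, j) - x $$ (i, j)) \<le> (\<Sum>j<n. cmod (u $$ (i, j) - x $$ (i, j)))"
    using assms by (intro member_le_sum[of j "{..<n}" "\<lambda>j. cmod (u $$ (i, j) - x $$ (i, j))"]) auto
  also have "\<dots> \<le> mat_norm1 (u - x)"
    unfolding mat_norm1_diff[OF assms(1,2)] using assms
    by (intro member_le_sum[of i "{..<n}" "\<lambda>i. \<Sum>j<n. cmod (u $$ (i, j) - x $$ (i, j))"])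
      (auto intro: sum_nonneg)
  finally show ?thesis .
qed

lemma mat_norm1_eq_0:
  assumes "u \<in> carrier_mat n n" "x \<in> carrier_mat n n" "mat_norm1 (u - x) = 0"
  shows "u = x"
  using assms entry_le_mat_norm1[OF assms(1,2)] by (intro eq_matI) auto

lemma mat_norm1_nonneg: "0 \<le> mat_norm1 A"
  unfolding mat_norm1_def by (intro sum_nonneg) auto

lemma eventually_nhds_mat_carrier: "\<forall>\<^sub>F u in nhds_mat n x. u \<in> carrier_mat n n"
  unfolding nhds_mat_def eventually_inf_principal by simp

lemma tendsto_nhds_mat_norm: "((\<lambda>u. mat_norm1 (u - x)) \<longlongrightarrow> 0) (nhds_mat n x)"
  unfolding nhds_mat_def
  by (rule filterlim_mono[OF filterlim_filtercomap]) auto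

lemma eventually_nhds_mat_self:
  assumes "eventually P (nhds_mat n x)" "x \<in> carrier_mat n n"
  shows "P x"
proof -
  obtain R where R: "eventually R (nhds 0)"
    "\<And>u. R (mat_norm1 (u - x)) \<Longrightarrow> u \<in> carrier_mat n n \<Longrightarrow> P u"
    using assms(1) unfolding nhds_mat_def eventually_inf_principal eventually_filtercomap by blast
  have "mat_norm1 (x - x) = 0" using mat_norm1_diff[OF assms(2,2)] by simp
  then show ?thesis using R(2)[of x] eventually_nhds_x_imp_x[OF R(1)] assms(2) by simp
qed

lemma tendsto_null_comparison:
  fixes f :: "'a \<Rightarrow> complex"
  assumes "\<forall>\<^sub>F x in F. norm (f x) \<le> g x" "(g \<longlongrightarrow> 0) F"
  shows "(f \<longlongrightarrow> 0) F"
  using assms(1) by (intro tendsto_0_le[OF assms(2), of f 1]) (auto elim: eventually_mono)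

lemma tendsto_nhds_mat_entry:
  assumes "x \<in> carrier_mat n n" "i < n" "j < n"
  shows "((\<lambda>u. u $$ (i, j)) \<longlongrightarrow> x $$ (i, j)) (nhds_mat n x)"
proof (rule LIM_zero_cancel, rule tendsto_null_comparison[OF _ tendsto_nhds_mat_norm[of x n]])
  show "\<forall>\<^sub>F u in nhds_mat n x. cmod (u $$ (i, j) - x $$ (i, j)) \<le> mat_norm1 (u - x)"
    using eventually_nhds_mat_carrier by eventually_elim (use assms entry_le_mat_norm1 in auto)
qed

lemma filterlim_nhds_mat:
  assumes "\<And>q. X q \<in> carrier_mat n n" "x \<in> carrier_mat n n"
    and "\<And>i j. i < n \<Longrightarrow> j < n \<Longrightarrow> ((\<lambda>q. X q $$ (i, j)) \<longlongrightarrow> x $$ (i, j)) F"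
  shows "filterlim X (nhds_mat n x) F"
proof -
  have "((\<lambda>q. \<Sum>i<n. \<Sum>j<n. cmod (X q $$ (i, j) - x $$ (i, j))) \<longlongrightarrow>
      (\<Sum>i<n. \<Sum>j<n. cmod (x $$ (i, j) - x $$ (i, j)))) F"
    using assms(3) by (intro tendsto_intros) auto
  then have "((\<lambda>q. mat_norm1 (X q - x)) \<longlongrightarrow> 0) F"
    using assms by (simp add: mat_norm1_diff[of _ n])
  then show ?thesis
    unfolding nhds_mat_def using assms(1)
    by (auto simp: filterlim_inf filterlim_filtercomap_iff filterlim_principal o_def)
qed

lemma function_ring_tendsto: "function_ring (\<lambda>f. (f \<longlongrightarrow> f x) F)"
  by unfold_locales (auto intro: tendsto_intros)

section \<open>Continuity of eigenvalues and local sections of the covering\<close>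

lemma norm_prod_list: "norm (prod_list xs) = (\<Prod>x\<leftarrow>xs. norm x)"
  for xs :: "complex list"
  by (induction xs) (auto simp: norm_mult)

lemma power_le_prod_list:
  assumes "0 \<le> (e :: real)" "\<And>a. a \<in> set as \<Longrightarrow> e \<le> f a"
  shows "e ^ length as \<le> (\<Prod>a\<leftarrow>as. f a)"
  using assms(2)
proof (induction as)
  case (Cons a as)
  then have "e * e ^ length as \<le> f a * (\<Prod>a\<leftarrow>as. f a)"
    using assms(1) by (intro mult_mono) (auto intro: order_trans[OF assms(1)])
  then show ?case by simp
qed simp

text \<open>At \<open>z\<close> the characteristic polynomial of a nearby matrix is close to 0, and
  it is the product of the \<open>m\<close> numbers \<open>z - a\<close> over the eigenvalues
  \<open>a\<close>. Were all of modulus at least \<open>e\<close>, the product would have modulus at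
  least \<open>e ^ m\<close>.\<close>

lemma eigenvalue_near:
  assumes x: "x \<in> carrier_mat n n" and m: "m \<le> n" "1 \<le> m"
    and ev: "eigenvalue (cutoff m x) z" and e: "0 < e"
  shows "\<forall>\<^sub>F u in nhds_mat n x. \<exists>z'. eigenvalue (cutoff m u) z' \<and> cmod (z' - z) < e"
proof -
  define p where "p u = poly (char_poly (cutoff m u)) z" for u
  \<comment> \<open>The Leibniz formula exhibits the value at \<open>z\<close> as a polynomial in
    the entries of \<open>u\<close>, which gives its continuity.\<close>
  have p: "p u = (\<Sum>q\<in>{q. q permutes {0..<m}}. signof q *
      (\<Prod>i = 0..<m. (if i = q i then z else 0) - u $$ (i, q i)))" for u
  proof -
    let ?C = "- char_matrix (cutoff m u) z"
    have C: "?C \<in> carrier_mat m m" by simp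
    have "?C $$ (i, q i) = (if i = q i then z else 0) - u $$ (i, q i)"
      if "q permutes {0..<m}" "i < m" for i q
    proof -
      have "q i < m" using permutes_in_image[OF that(1), of i] that(2) by auto
      then show ?thesis
        using that(2) by (auto simp: char_matrix_def cutoff_index carrier_matD[OF cutoff_carrier])
    qed
    then show ?thesis
      unfolding p_def char_poly_matrix[OF cutoff_carrier] det_def'[OF C]
      by (intro sum.cong refl arg_cong2[of _ _ _ _ "(*)"] prod.cong) auto
  qed
  have "(p \<longlongrightarrow> p x) (nhds_mat n x)"
    unfolding p
  proof (intro tendsto_intros tendsto_nhds_mat_entry x)
    fix q i assume "q \<in> {q. q permutes {0..<m}}" "i \<in> {0..<m}"
    then have "i < m" "q i < m" using permutes_in_image[of q "{0..<m}" i] by simp_all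
    then show "i < n" "q i < n" using m by auto
  qed
  moreover have "p x = 0" using ev eigenvalue_root_char_poly[OF cutoff_carrier] by (simp add: p_def)
  ultimately have "\<forall>\<^sub>F u in nhds_mat n x. dist (p u) 0 < e ^ m"
    using e by (intro tendstoD) auto
  then show ?thesis
  proof eventually_elim
    case (elim u)
    obtain as where as: "char_poly (cutoff m u) = (\<Prod>a\<leftarrow>as. [:- a, 1:])" "length as = m"
      using char_poly_factorized[OF cutoff_carrier] by blast
    have pu: "p u = (\<Prod>a\<leftarrow>as. z - a)"
      unfolding p_def as(1) by (simp add: poly_prod_list o_def)
    have "\<exists>a\<in>set as. cmod (z - a) < e"
    proof (rule ccontr)
      assume "\<not> ?thesis"
      then have "e ^ length as \<le> (\<Prod>a\<leftarrow>as. cmod (z - a))"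
        using e by (intro power_le_prod_list) auto
      also have "\<dots> = cmod (p u)" unfolding pu norm_prod_list by (simp add: o_def)
      finally show False using elim as(2) by simp
    qed
    then obtain a where a: "a \<in> set as" "cmod (z - a) < e" by auto
    have "poly (char_poly (cutoff m u)) a = 0"
      unfolding as(1) using a(1) by (simp add: poly_prod_list prod_list_zero_iff o_def)
    then have "eigenvalue (cutoff m u) a" by (simp add: eigenvalue_root_char_poly[OF cutoff_carrier])
    then show ?case using a(2) by (auto simp: norm_minus_commute)
  qed
qed

definition nu_near :: "nat \<Rightarrow> real \<Rightarrow> (nat \<Rightarrow> complex mat) \<Rightarrow> (nat \<Rightarrow> complex mat) \<Rightarrow> bool" where
  "nu_near n e \<nu> \<nu>' \<longleftrightarrow>
     (\<forall>m\<in>{1..n}. \<forall>k\<in>{1..m}. cmod (nu_entry \<nu>' k m - nu_entry \<nu> k m) < e)"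

text \<open>The factor 2 makes the discs of radius \<open>e\<close> around different values
  disjoint. Coinciding values are exempt because labels of non-adjacent levels may carry the same
  number.\<close>

definition nu_separated :: "nat \<Rightarrow> real \<Rightarrow> (nat \<Rightarrow> complex mat) \<Rightarrow> bool" where
  "nu_separated n e \<nu> \<longleftrightarrow>
     (\<forall>m\<in>{1..n}. \<forall>k\<in>{1..m}. \<forall>m'\<in>{1..n}. \<forall>k'\<in>{1..m'}.
        nu_entry \<nu> k m \<noteq> nu_entry \<nu> k' m' \<longrightarrow> 2 * e \<le> cmod (nu_entry \<nu> k m - nu_entry \<nu> k' m'))"

lemma nu_separated_exists: "\<exists>e>0. nu_separated n e \<nu>"
proof -
  let ?I = "SIGMA m:{1..n}. {1..m}"
  define Z where "Z = (\<lambda>(m, k). nu_entry \<nu> k m) ` ?I"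
  define D where "D = (\<lambda>(a, b). cmod (a - b) / 2) ` ((Z \<times> Z) \<inter> {(a, b). a \<noteq> b})"
  \<comment> \<open>The element 1 keeps the set nonempty when no two values differ.\<close>
  have fin: "finite (insert 1 D)" by (auto simp: D_def Z_def)
  have "Min (insert 1 D) > 0" using fin by (subst Min_gr_iff) (auto simp: D_def)
  moreover have "nu_separated n (Min (insert 1 D)) \<nu>"
    unfolding nu_separated_def
  proof (intro ballI impI)
    fix m k m' k' assume mk: "m \<in> {1..n}" "k \<in> {1..m}" "m' \<in> {1..n}" "k' \<in> {1..m'}"
      and ne: "nu_entry \<nu> k m \<noteq> nu_entry \<nu> k' m'"
    have "nu_entry \<nu> k m \<in> Z" "nu_entry \<nu> k' m' \<in> Z"
      unfolding Z_def using mk image_eqI[of _ "\<lambda>(m, k). nu_entry \<nu> k m" "(m, k)" ?I]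
        image_eqI[of _ "\<lambda>(m, k). nu_entry \<nu> k m" "(m', k')" ?I] by auto
    then have "cmod (nu_entry \<nu> k m - nu_entry \<nu> k' m') / 2 \<in> D"
      unfolding D_def using ne by (intro image_eqI[of _ _ "(nu_entry \<nu> k m, nu_entry \<nu> k' m')"]) auto
    then show "2 * Min (insert 1 D) \<le> cmod (nu_entry \<nu> k m - nu_entry \<nu> k' m')"
      using Min_le[OF fin, of "cmod (nu_entry \<nu> k m - nu_entry \<nu> k' m') / 2"] by auto
  qed
  ultimately show ?thesis by blast
qed

lemma nu_separatedD:
  assumes "nu_separated n e \<nu>" "m \<in> {1..n}" "k \<in> {1..m}" "m' \<in> {1..n}" "k' \<in> {1..m'}"
    and "cmod (z - nu_entry \<nu> k m) < e" "cmod (z - nu_entry \<nu> k' m') < e"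
  shows "nu_entry \<nu> k m = nu_entry \<nu> k' m'"
proof (rule ccontr)
  assume "nu_entry \<nu> k m \<noteq> nu_entry \<nu> k' m'"
  then have "2 * e \<le> cmod (nu_entry \<nu> k m - nu_entry \<nu> k' m')"
    using assms unfolding nu_separated_def by blast
  also have "\<dots> = cmod ((z - nu_entry \<nu> k' m') - (z - nu_entry \<nu> k m))" by simp
  also have "\<dots> < 2 * e" using assms(6,7) norm_triangle_ineq4[of "z - nu_entry \<nu> k' m'" "z - nu_entry \<nu> k m"]
    by linarith
  finally show False by simp
qed

lemma e_Omega_eqI:
  assumes "\<nu> \<in> e_Omega n" "\<nu>' \<in> e_Omega n"
    and "\<And>m k. m \<in> {1..n} \<Longrightarrow> k \<in> {1..m} \<Longrightarrow> nu_entry \<nu> k m = nu_entry \<nu>' k m"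
  shows "\<nu> = \<nu>'"
proof
  fix m
  show "\<nu> m = \<nu>' m"
  proof (cases "m \<in> {1..n}")
    case True
    have "diag_of m (\<lambda>i. nu_entry \<nu> (Suc i) m) = diag_of m (\<lambda>i. nu_entry \<nu>' (Suc i) m)"
      using assms(3)[OF True] by (intro eq_matI) (auto simp: diag_of_def)
    then show ?thesis using e_Omega_diag_of[OF _ True] assms(1,2) by metis
  next
    case False
    have "\<nu> \<in> extensional {1..n}" "\<nu>' \<in> extensional {1..n}"
      using assms(1,2) by (auto simp: e_Omega_def PiE_def)
    then show ?thesis using extensional_arb[OF _ False] by metis
  qed
qed

text \<open>A lift of \<open>u\<close> is a labelling of its eigenvalues. An eigenvalue close to two
  centres of one level would identify them, so closeness to \<open>\<nu>\<close> fixes every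
  label.\<close>

lemma near_unique:
  assumes sep: "nu_separated n e \<nu>" and nu: "\<nu> \<in> e_Omega n"
    and p: "(\<nu>', u) \<in> M_Omega_e n" "(\<nu>'', u) \<in> M_Omega_e n"
    and near: "nu_near n e \<nu> \<nu>'" "nu_near n e \<nu> \<nu>''"
  shows "\<nu>' = \<nu>''"
proof (rule e_Omega_eqI[of _ n])
  show "\<nu>' \<in> e_Omega n" "\<nu>'' \<in> e_Omega n" using p M_Omega_eD(1) by fastforce+
  fix m k assume m: "m \<in> {1..n}" and k: "k \<in> {1..m}"
  have "eigenvalue (cutoff m u) (nu_entry \<nu>' k m)"
    using M_Omega_e_eigenvalue[OF p(1) m] k by auto
  then obtain l where l: "l \<in> {1..m}" "nu_entry \<nu>' k m = nu_entry \<nu>'' l m"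
    using M_Omega_e_eigenvalue[OF p(2) m] by auto
  have "cmod (nu_entry \<nu>' k m - nu_entry \<nu> k m) < e"
    "cmod (nu_entry \<nu>'' l m - nu_entry \<nu> l m) < e"
    using near m k l(1) unfolding nu_near_def by blast+
  then have "nu_entry \<nu> k m = nu_entry \<nu> l m"
    unfolding l(2) by (intro nu_separatedD[OF sep m k m l(1)])
  then have "k = l" using inj_onD[OF e_Omega_inj[OF nu m]] k l by auto
  then show "nu_entry \<nu>' k m = nu_entry \<nu>'' k m" using l by simp
qed

text \<open>In each disc around a label of \<open>y\<close> an eigenvalue of the nearby matrix is
  picked. Separation of the discs transfers distinctness within a level and disjointness of adjacent
  levels from \<open>y\<close> to the new labels.\<close>

lemma lift_near:
  assumes y: "y \<in> M_Omega_e n" and e: "0 < e"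
  shows "\<forall>\<^sub>F u in nhds_mat n (proj y). \<exists>\<nu>'. (\<nu>', u) \<in> M_Omega_e n \<and> nu_near n e (fst y) \<nu>'"
proof -
  note yD = M_Omega_eD[OF y]
  obtain d where d: "d > 0" "nu_separated n d (fst y)" using nu_separated_exists by blast
  \<comment> \<open>\<open>d\<close> separates the labels of \<open>y\<close>, \<open>e\<close> is
    the accuracy asked for.\<close>
  let ?e = "min d e"
  have "\<forall>\<^sub>F u in nhds_mat n (proj y). \<forall>m\<in>{1..n}. \<forall>k\<in>{1..m}. \<exists>z.
      eigenvalue (cutoff m u) z \<and> cmod (z - nu_entry (fst y) k m) < ?e"
    using yD(3) d(1) e M_Omega_e_eigenvalue[OF y]
    by (intro eventually_ball_finite ballI eigenvalue_near) auto
  with eventually_nhds_mat_carrier show ?thesis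
  proof eventually_elim
    case (elim u)
    then obtain z where z: "\<And>m k. m \<in> {1..n} \<Longrightarrow> k \<in> {1..m} \<Longrightarrow> eigenvalue (cutoff m u) (z m k)"
      "\<And>m k. m \<in> {1..n} \<Longrightarrow> k \<in> {1..m} \<Longrightarrow> cmod (z m k - nu_entry (fst y) k m) < ?e"
      by metis
    define \<nu> where "\<nu> = (\<lambda>m\<in>{1..n}. diag_of m (\<lambda>i. z m (Suc i)))"
    have entry: "nu_entry \<nu> k m = z m k" if "m \<in> {1..n}" "k \<in> {1..m}" for m k
      using that by (auto simp: nu_entry_def \<nu>_def diag_of_def)
    have inj: "inj_on (z m) {1..m}" if m: "m \<in> {1..n}" for m
    proof
      fix k l assume kl: "k \<in> {1..m}" "l \<in> {1..m}" "z m k = z m l"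
      have "nu_entry (fst y) k m = nu_entry (fst y) l m"
        using z(2)[OF m kl(1)] z(2)[OF m kl(2)] kl
        by (intro nu_separatedD[OF d(2) m kl(1) m kl(2), of "z m k"]) auto
      then show "k = l" using inj_onD[OF e_Omega_inj[OF yD(1) m]] kl by auto
    qed
    have "inj_on (\<lambda>k. nu_entry \<nu> k m) {1..m}" if "m \<in> {1..n}" for m
      using inj[OF that] entry[OF that] by (subst inj_on_cong[of _ _ "z m"]) auto
    moreover have "nu_entry \<nu> i m \<noteq> nu_entry \<nu> j (m + 1)"
      if m: "m \<in> {1..<n}" and i: "i \<in> {1..m}" and j: "j \<in> {1..m + 1}" for m i j
    proof
      assume eq: "nu_entry \<nu> i m = nu_entry \<nu> j (m + 1)"
      have mn: "m \<in> {1..n}" "m + 1 \<in> {1..n}" using m by auto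
      have "nu_entry (fst y) i m = nu_entry (fst y) j (m + 1)"
        using z(2)[OF mn(1) i] z(2)[OF mn(2) j] eq entry[OF mn(1) i] entry[OF mn(2) j]
        by (intro nu_separatedD[OF d(2) mn(1) i mn(2) j, of "z m i"]) auto
      then show False using yD(1) m i j unfolding e_Omega_def by blast
    qed
    moreover have "\<nu> \<in> (\<Pi>\<^sub>E m\<in>{1..n}. {D \<in> carrier_mat m m. diagonal_mat D})"
      by (auto simp: \<nu>_def diagonal_mat_def diag_of_def)
    ultimately have "\<nu> \<in> e_Omega n" unfolding e_Omega_def by blast
    moreover have "similar_mat (\<nu> m) (cutoff m u)" if m: "m \<in> {1..n}" for m
      using similar_diag_of[OF cutoff_carrier inj[OF m] z(1)[OF m]] m by (simp add: \<nu>_def)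
    ultimately have "(\<nu>, u) \<in> M_Omega_e n" using elim(1) by (intro M_Omega_eI)
    moreover have "nu_near n e (fst y) \<nu>"
      unfolding nu_near_def using z(2) entry by auto
    ultimately show ?case by blast
  qed
qed

lemma nu_coord: "m \<in> {1..n} \<Longrightarrow> k \<in> {1..m} \<Longrightarrow> (\<lambda>y. nu_entry (fst y) k m) \<in> point_coords n"
  unfolding point_coords_def by blast

lemma entry_coord: "i < n \<Longrightarrow> j < n \<Longrightarrow> (\<lambda>y. proj y $$ (i, j)) \<in> point_coords n"
  unfolding point_coords_def by blast

text \<open>Near \<open>proj y\<close> the section takes the unique lift whose labels are close to
  those of \<open>y\<close>. Continuity is required at every nearby \<open>u\<close>; there, lifts
  close to the chosen one exist, and by uniqueness they are the values of the section.\<close>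

lemma local_section_exists:
  assumes y: "y \<in> M_Omega_e n"
  obtains s where "local_section n y s"
proof -
  note yD = M_Omega_eD[OF y]
  obtain d where d: "d > 0" "nu_separated n d (fst y)" using nu_separated_exists by blast
  define s where "s u = (SOME p. p \<in> M_Omega_e n \<and> proj p = u \<and> nu_near n d (fst y) (fst p))" for u
  have s: "s u = (\<nu>', u)" if "(\<nu>', u) \<in> M_Omega_e n" "nu_near n d (fst y) \<nu>'" for u \<nu>'
  proof -
    have "s u \<in> M_Omega_e n \<and> proj (s u) = u \<and> nu_near n d (fst y) (fst (s u))"
      unfolding s_def by (rule someI[of _ "(\<nu>', u)"]) (use that in auto)
    then show ?thesis
      using near_unique[OF d(2) yD(1) that(1), of "fst (s u)"] that(2) by (metis prod.collapse)
  qed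
  have "local_section n y s"
    unfolding local_section_def
  proof
    show "s (proj y) = y"
      using s[of "fst y" "proj y"] y d by (simp add: nu_near_def)
    show "\<forall>\<^sub>F u in nhds_mat n (proj y). s u \<in> M_Omega_e n \<and> proj (s u) = u \<and>
        (\<forall>g\<in>point_coords n. ((\<lambda>w. g (s w)) \<longlongrightarrow> g (s u)) (nhds_mat n u))"
      using lift_near[OF y d(1)]
    proof eventually_elim
      case (elim u)
      then obtain \<nu>' where nu': "(\<nu>', u) \<in> M_Omega_e n" "nu_near n d (fst y) \<nu>'" by blast
      have su: "s u = (\<nu>', u)" by (rule s[OF nu'])
      have u: "u \<in> carrier_mat n n" using M_Omega_eD(3)[OF nu'(1)] by simp
      have close: "\<forall>\<^sub>F w in nhds_mat n u. proj (s w) = w \<and> nu_near n e \<nu>' (fst (s w))"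
        if e: "e > 0" for e
      proof -
        \<comment> \<open>Labels within \<open>r\<close> of \<open>\<nu>'\<close> stay within
          \<open>d\<close> of those of \<open>y\<close>, where lifts are unique; inserting
          \<open>e\<close> also secures the accuracy asked for.\<close>
        define r where "r = Min (insert e ((\<lambda>(m, k). d - cmod (nu_entry \<nu>' k m - nu_entry (fst y) k m)) `
            (SIGMA m:{1..n}. {1..m})))"
        have r: "r > 0" "r \<le> e"
          unfolding r_def using e nu'(2) by (auto simp: nu_near_def)
        have rd: "cmod (nu_entry \<nu>' k m - nu_entry (fst y) k m) + r \<le> d"
          if "m \<in> {1..n}" "k \<in> {1..m}" for m k
        proof -
          have "r \<le> d - cmod (nu_entry \<nu>' k m - nu_entry (fst y) k m)"
            unfolding r_def using that by (intro Min_le) (auto intro!: image_eqI[of _ _ "(m, k)"])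
          then show ?thesis by simp
        qed
        have "\<forall>\<^sub>F w in nhds_mat n u. \<exists>\<nu>''. (\<nu>'', w) \<in> M_Omega_e n \<and> nu_near n r \<nu>' \<nu>''"
          using lift_near[OF nu'(1) r(1)] by simp
        then show ?thesis
        proof eventually_elim
          case (elim w)
          then obtain \<nu>'' where nu'': "(\<nu>'', w) \<in> M_Omega_e n" "nu_near n r \<nu>' \<nu>''" by blast
          have "nu_near n d (fst y) \<nu>''"
            unfolding nu_near_def
          proof (intro ballI)
            fix m k assume mk: "m \<in> {1..n}" "k \<in> {1..m}"
            have "cmod (nu_entry \<nu>'' k m - nu_entry \<nu>' k m) < r"
              using nu''(2) mk by (auto simp: nu_near_def)
            then show "cmod (nu_entry \<nu>'' k m - nu_entry (fst y) k m) < d"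
              using rd[OF mk] norm_triangle_ineq[of "nu_entry \<nu>'' k m - nu_entry \<nu>' k m"
                  "nu_entry \<nu>' k m - nu_entry (fst y) k m"] by simp
          qed
          then have "s w = (\<nu>'', w)" by (rule s[OF nu''(1)])
          then show ?case using nu''(2) r(2) by (fastforce simp: nu_near_def)
        qed
      qed
      have "((\<lambda>w. g (s w)) \<longlongrightarrow> g (s u)) (nhds_mat n u)" if g: "g \<in> point_coords n" for g
      proof -
        consider k m where "m \<in> {1..n}" "k \<in> {1..m}" "g = (\<lambda>y. nu_entry (fst y) k m)"
          | i j where "i < n" "j < n" "g = (\<lambda>y. proj y $$ (i, j))"
          using g unfolding point_coords_def by blast
        then show ?thesis
        proof cases
          case 1
          show ?thesis
          proof (rule tendstoI)
            fix e :: real assume "e > 0"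
            from close[OF this] show "\<forall>\<^sub>F w in nhds_mat n u. dist (g (s w)) (g (s u)) < e"
              by eventually_elim (use 1 in \<open>auto simp: nu_near_def su dist_norm\<close>)
          qed
        next
          case 2
          have "\<forall>\<^sub>F w in nhds_mat n u. w $$ (i, j) = g (s w)"
            using close[of 1, simplified] by eventually_elim (use 2 in auto)
          then show ?thesis
            using Lim_transform_eventually[OF tendsto_nhds_mat_entry[OF u 2(1,2)]] 2(3)
            by (simp add: su)
        qed
      qed
      then show ?case using su nu' by simp
    qed
  qed
  then show ?thesis by (rule that)
qed

lemma local_sectionD:
  assumes "local_section n y s" "y \<in> M_Omega_e n"
  shows "s (proj y) = y"
    "\<forall>\<^sub>F u in nhds_mat n (proj y). s u \<in> M_Omega_e n \<and> proj (s u) = u"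
    "g \<in> point_coords n \<Longrightarrow> ((\<lambda>w. g (s w)) \<longlongrightarrow> g y) (nhds_mat n (proj y))"
proof -
  show s: "s (proj y) = y" using assms(1) by (simp add: local_section_def)
  have ev: "\<forall>\<^sub>F u in nhds_mat n (proj y). s u \<in> M_Omega_e n \<and> proj (s u) = u \<and>
        (\<forall>g\<in>point_coords n. ((\<lambda>w. g (s w)) \<longlongrightarrow> g (s u)) (nhds_mat n u))"
    using assms(1) by (simp add: local_section_def)
  then show "\<forall>\<^sub>F u in nhds_mat n (proj y). s u \<in> M_Omega_e n \<and> proj (s u) = u"
    by eventually_elim simp
  show "g \<in> point_coords n \<Longrightarrow> ((\<lambda>w. g (s w)) \<longlongrightarrow> g y) (nhds_mat n (proj y))"
    using eventually_nhds_mat_self[OF ev M_Omega_eD(3)[OF assms(2)]] s by simp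
qed

lemma local_section_near:
  assumes "local_section n y s" "y \<in> M_Omega_e n" "0 < e"
  shows "\<forall>\<^sub>F u in nhds_mat n (proj y). nu_near n e (fst y) (fst (s u))"
  unfolding nu_near_def
proof (intro eventually_ball_finite ballI)
  fix m k assume mk: "m \<in> {1..n}" "k \<in> {1..m}"
  show "\<forall>\<^sub>F u in nhds_mat n (proj y). cmod (nu_entry (fst (s u)) k m - nu_entry (fst y) k m) < e"
    using tendstoD[OF local_sectionD(3)[OF assms(1,2) nu_coord[OF mk]] assms(3)]
    by (simp add: dist_norm)
qed auto

text \<open>Continuity of the coordinates keeps a section within the separation distance, where the
  lift is unique. This serves to compare two sections and to recognize a curve in the covering as
  the section applied to its projection.\<close>

lemma local_section_eventually_eq:
  assumes s: "local_section n y s" and y: "y \<in> M_Omega_e n"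
  obtains e where "0 < e"
    "\<forall>\<^sub>F u in nhds_mat n (proj y). \<forall>p \<in> M_Omega_e n. proj p = u \<longrightarrow> nu_near n e (fst y) (fst p)
       \<longrightarrow> s u = p"
proof -
  obtain d where d: "d > 0" "nu_separated n d (fst y)" using nu_separated_exists by blast
  have "\<forall>\<^sub>F u in nhds_mat n (proj y). \<forall>p \<in> M_Omega_e n. proj p = u \<longrightarrow> nu_near n d (fst y) (fst p)
       \<longrightarrow> s u = p"
    using local_sectionD(2)[OF s y] local_section_near[OF s y d(1)]
  proof eventually_elim
    case (elim u)
    show ?case
    proof (intro ballI impI)
      fix p assume p: "p \<in> M_Omega_e n" "proj p = u" "nu_near n d (fst y) (fst p)"
      have "(fst (s u), u) \<in> M_Omega_e n" "(fst p, u) \<in> M_Omega_e n"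
        using elim(1) p by (metis prod.collapse)+
      then have "fst (s u) = fst p"
        using near_unique[OF d(2) M_Omega_eD(1)[OF y]] elim(2) p(3) by blast
      then show "s u = p" using elim(1) p(2) by (simp add: prod_eq_iff)
    qed
  qed
  then show ?thesis using that d(1) by blast
qed

lemma local_section_unique:
  assumes s: "local_section n y s" and s': "local_section n y s'" and y: "y \<in> M_Omega_e n"
  shows "\<forall>\<^sub>F u in nhds_mat n (proj y). s u = s' u"
proof -
  obtain e where e: "0 < e"
    "\<forall>\<^sub>F u in nhds_mat n (proj y). \<forall>p \<in> M_Omega_e n. proj p = u \<longrightarrow> nu_near n e (fst y) (fst p)
       \<longrightarrow> s u = p"
    using local_section_eventually_eq[OF s y] by blast
  show ?thesis
    using e(2) local_sectionD(2)[OF s' y] local_section_near[OF s' y e(1)]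
    by eventually_elim blast
qed

section \<open>Gradients and their uniqueness\<close>

lemma has_gradient_cong:
  assumes f: "has_gradient n f G x" and eq: "\<forall>\<^sub>F u in nhds_mat n x. f u = f' u"
    and x: "x \<in> carrier_mat n n"
  shows "has_gradient n f' G x"
proof -
  have "f x = f' x" by (rule eventually_nhds_mat_self[OF eq x])
  then have "\<forall>\<^sub>F u in nhds_mat n x.
      (f u - f x - mat_trace (G * (u - x))) / of_real (mat_norm1 (u - x)) =
      (f' u - f' x - mat_trace (G * (u - x))) / of_real (mat_norm1 (u - x))"
    using eq by (auto elim: eventually_mono)
  then show ?thesis
    using f unfolding has_gradient_def by (auto intro: Lim_transform_eventually)
qed

text \<open>Chain rule along a curve of matrices: the difference quotient is \<open>E\<close>,
  formed from the entrywise difference quotients, plus the remainder \<open>R\<close> times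
  \<open>N p / (p - q)\<close>, whose modulus converges.\<close>

lemma has_gradient_curve:
  assumes f: "has_gradient n f G (X q)" and X: "\<And>p. X p \<in> carrier_mat n n"
    and D: "D \<in> carrier_mat n n"
    and der: "\<And>i j. i < n \<Longrightarrow> j < n \<Longrightarrow> ((\<lambda>p. X p $$ (i, j)) has_field_derivative D $$ (i, j)) (at q)"
  shows "((\<lambda>p. f (X p)) has_field_derivative mat_trace (G * D)) (at q)"
proof -
  have G: "G \<in> carrier_mat n n" using f by (simp add: has_gradient_def)
  define N where "N p = mat_norm1 (X p - X q)" for p
  define R where "R u = (f u - f (X q) - mat_trace (G * (u - X q))) / of_real (mat_norm1 (u - X q))" for u
  define E where "E p = (\<Sum>i<n. \<Sum>j<n. G $$ (i, j) * ((X p $$ (j, i) - X q $$ (j, i)) / (p - q)))" for p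
  have "((\<lambda>p. X p $$ (i, j)) \<longlongrightarrow> X q $$ (i, j)) (at q)" if "i < n" "j < n" for i j
    using DERIV_isCont[OF der[OF that]] by (simp add: isCont_def)
  then have "filterlim X (nhds_mat n (X q)) (at q)"
    using X by (intro filterlim_nhds_mat) auto
  then have R: "((\<lambda>p. R (X p)) \<longlongrightarrow> 0) (at q)"
    using f filterlim_compose[of R "nhds 0" "nhds_mat n (X q)" X "at q"]
    unfolding has_gradient_def R_def by blast
  have q: "((\<lambda>p. (X p $$ (i, j) - X q $$ (i, j)) / (p - q)) \<longlongrightarrow> D $$ (i, j)) (at q)"
    if "i < n" "j < n" for i j
    using der[OF that] by (simp add: has_field_derivative_iff)
  have E: "(E \<longlongrightarrow> mat_trace (G * D)) (at q)"
    unfolding mat_trace_mult[OF G D] E_def by (intro tendsto_intros q) auto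
  have "((\<lambda>p. \<Sum>i<n. \<Sum>j<n. cmod ((X p $$ (i, j) - X q $$ (i, j)) / (p - q))) \<longlongrightarrow>
      (\<Sum>i<n. \<Sum>j<n. cmod (D $$ (i, j)))) (at q)"
    by (intro tendsto_intros q) auto
  then have "((\<lambda>p. cmod (R (X p)) * (\<Sum>i<n. \<Sum>j<n. cmod ((X p $$ (i, j) - X q $$ (i, j)) / (p - q))))
      \<longlongrightarrow> cmod 0 * (\<Sum>i<n. \<Sum>j<n. cmod (D $$ (i, j)))) (at q)"
    by (intro tendsto_mult tendsto_norm R)
  moreover have "cmod (R (X p) * (of_real (N p) / (p - q))) =
      cmod (R (X p)) * (\<Sum>i<n. \<Sum>j<n. cmod ((X p $$ (i, j) - X q $$ (i, j)) / (p - q)))" for p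
  proof -
    have "cmod (of_real (N p) / (p - q)) = N p / cmod (p - q)"
      using mat_norm1_nonneg[of "X p - X q"] by (simp add: norm_divide N_def)
    also have "\<dots> = (\<Sum>i<n. \<Sum>j<n. cmod ((X p $$ (i, j) - X q $$ (i, j)) / (p - q)))"
      unfolding N_def mat_norm1_diff[OF X X] by (simp add: sum_divide_distrib norm_divide)
    finally show ?thesis by (simp only: norm_mult)
  qed
  ultimately have "((\<lambda>p. cmod (R (X p) * (of_real (N p) / (p - q)))) \<longlongrightarrow> 0) (at q)" by simp
  then have "((\<lambda>p. R (X p) * (of_real (N p) / (p - q))) \<longlongrightarrow> 0) (at q)"
    by (rule tendsto_norm_zero_cancel)
  then have "((\<lambda>p. E p + R (X p) * (of_real (N p) / (p - q))) \<longlongrightarrow> mat_trace (G * D) + 0) (at q)"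
    by (intro tendsto_add E)
  moreover have "E p + R (X p) * (of_real (N p) / (p - q)) = (f (X p) - f (X q)) / (p - q)" for p
  proof -
    have XX: "X p - X q \<in> carrier_mat n n" using X by (intro minus_carrier_mat)
    have "mat_trace (G * (X p - X q)) = (\<Sum>i<n. \<Sum>j<n. G $$ (i, j) * (X p $$ (j, i) - X q $$ (j, i)))"
      unfolding mat_trace_mult[OF G XX]
      using carrier_matD[OF X[of p]] carrier_matD[OF X[of q]] by (intro sum.cong refl) auto
    then have E': "E p = mat_trace (G * (X p - X q)) / (p - q)"
      by (simp add: E_def sum_divide_distrib)
    have "f (X p) - f (X q) = mat_trace (G * (X p - X q)) + R (X p) * of_real (N p)"
    proof (cases "N p = 0")
      \<comment> \<open>Here \<open>R\<close> divides by 0, but the curve is at \<open>X q\<close>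
        again, so both sides vanish.\<close>
      case True
      then have "X p = X q" using mat_norm1_eq_0[OF X X] by (simp add: N_def)
      moreover have "mat_trace (G * (X q - X q)) = 0"
        using mat_trace_mult[OF G, of "X q - X q"] X[of q] by (simp add: carrier_matD[OF X])
      ultimately show ?thesis using True by simp
    next
      case False
      then show ?thesis by (simp add: R_def N_def)
    qed
    then show ?thesis unfolding E' by (simp add: add_divide_distrib)
  qed
  ultimately have "((\<lambda>p. (f (X p) - f (X q)) / (p - q)) \<longlongrightarrow> mat_trace (G * D)) (at q)" by simp
  then show ?thesis by (simp add: has_field_derivative_iff)
qed

definition unit_mat :: "nat \<Rightarrow> nat \<Rightarrow> nat \<Rightarrow> complex mat" where
  "unit_mat n i j = mat n n (\<lambda>(a, b). if a = i \<and> b = j then 1 else 0)"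

lemma unit_mat_carrier [simp]: "unit_mat n i j \<in> carrier_mat n n"
  by (simp add: unit_mat_def)

lemma trace_mult_unit_mat:
  assumes A: "A \<in> carrier_mat n n" and ij: "i < n" "j < n"
  shows "mat_trace (A * unit_mat n j i) = A $$ (i, j)"
proof -
  have "mat_trace (A * unit_mat n j i) = (\<Sum>a<n. \<Sum>b<n. A $$ (a, b) * unit_mat n j i $$ (b, a))"
    using A by (intro mat_trace_mult) auto
  also have "\<dots> = (\<Sum>a<n. \<Sum>b<n. if b = j then if a = i then A $$ (i, j) else 0 else 0)"
    by (intro sum.cong refl) (auto simp: unit_mat_def)
  also have "\<dots> = (\<Sum>a<n. if a = i then A $$ (i, j) else 0)"
    using ij by (simp add: sum.delta)
  also have "\<dots> = A $$ (i, j)" using ij by (simp add: sum.delta)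
  finally show ?thesis .
qed

text \<open>Derivatives along the lines in the directions of the matrix units recover the entries of
  the gradient.\<close>

lemma has_gradient_unique:
  assumes G: "has_gradient n f G x" and G': "has_gradient n f G' x" and x: "x \<in> carrier_mat n n"
  shows "G = G'"
proof -
  have car: "G \<in> carrier_mat n n" "G' \<in> carrier_mat n n" using G G' by (auto simp: has_gradient_def)
  show ?thesis
  proof (rule eq_matI)
    fix i j assume "i < dim_row G'" "j < dim_col G'"
    then have ij: "i < n" "j < n" using car by auto
    let ?E = "unit_mat n j i"
    define X where "X q = x + q \<cdot>\<^sub>m ?E" for q
    have X: "X q \<in> carrier_mat n n" for q using x by (simp add: X_def)
    have X0: "X 0 = x" unfolding X_def using x by (intro eq_matI) (auto simp: unit_mat_def)
    have der: "((\<lambda>p. X p $$ (a, b)) has_field_derivative ?E $$ (a, b)) (at 0)" if "a < n" "b < n" for a b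
      unfolding X_def using that x carrier_matD[OF unit_mat_carrier[of n j i]]
      by (auto intro!: derivative_eq_intros)
    have "((\<lambda>p. f (X p)) has_field_derivative mat_trace (G * ?E)) (at 0)"
      "((\<lambda>p. f (X p)) has_field_derivative mat_trace (G' * ?E)) (at 0)"
      by (rule has_gradient_curve[of n f _ X 0]; use G G' X X0 der in simp)+
    then have "mat_trace (G * ?E) = mat_trace (G' * ?E)" by (rule DERIV_unique)
    then show "G $$ (i, j) = G' $$ (i, j)"
      using trace_mult_unit_mat[OF car(1) ij] trace_mult_unit_mat[OF car(2) ij] by simp
  qed (use car in auto)
qed

text \<open>Two local sections through \<open>y\<close> agree near \<open>proj y\<close>, so the
  gradient does not depend on the section; this resolves the definite description.\<close>

lemma lifted_gradient_eqI:
  assumes y: "y \<in> M_Omega_e n" and G: "has_lifted_gradient n \<phi> G y"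
  shows "lifted_gradient n \<phi> y = G"
  unfolding lifted_gradient_def
proof (rule the_equality)
  show "has_lifted_gradient n \<phi> G y" by (rule G)
  fix G' assume G': "has_lifted_gradient n \<phi> G' y"
  obtain s s' where s: "local_section n y s" "has_gradient n (\<phi> \<circ> s) G (proj y)"
    and s': "local_section n y s'" "has_gradient n (\<phi> \<circ> s') G' (proj y)"
    using G G' by (auto simp: has_lifted_gradient_def)
  have "\<forall>\<^sub>F u in nhds_mat n (proj y). (\<phi> \<circ> s') u = (\<phi> \<circ> s) u"
    using local_section_unique[OF s(1) s'(1) y] by eventually_elim simp
  then have "has_gradient n (\<phi> \<circ> s) G' (proj y)"
    using has_gradient_cong[OF s'(2)] M_Omega_eD(3)[OF y] by blast
  then show "G' = G" using has_gradient_unique s(2) M_Omega_eD(3)[OF y] by blast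
qed

text \<open>The indices of the matrix unit are swapped because gradients pair with tangent vectors
  through the trace of a product.\<close>

lemma entry_lifted_gradient:
  assumes y: "y \<in> M_Omega_e n" and ij: "i < n" "j < n"
  shows "has_lifted_gradient n (\<lambda>y. proj y $$ (i, j)) (unit_mat n j i) y"
proof -
  obtain s where s: "local_section n y s" using local_section_exists[OF y] .
  let ?x = "proj y"
  have x: "?x \<in> carrier_mat n n" by (rule M_Omega_eD(3)[OF y])
  have "\<forall>\<^sub>F u in nhds_mat n ?x.
      (u $$ (i, j) - ?x $$ (i, j) - mat_trace (unit_mat n j i * (u - ?x))) / of_real (mat_norm1 (u - ?x)) = 0"
    using eventually_nhds_mat_carrier
  proof eventually_elim
    case (elim u)
    have d: "u - ?x \<in> carrier_mat n n" using x by (intro minus_carrier_mat)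
    have "mat_trace (unit_mat n j i * (u - ?x)) = (u - ?x) $$ (i, j)"
      using trace_mult_unit_mat[OF d ij] mat_trace_commute[OF d, of "unit_mat n j i"] by simp
    then show ?case using ij x by simp
  qed
  then have "has_gradient n (\<lambda>u. u $$ (i, j)) (unit_mat n j i) ?x"
    unfolding has_gradient_def by (simp add: tendsto_eventually)
  moreover have "\<forall>\<^sub>F u in nhds_mat n ?x. u $$ (i, j) = ((\<lambda>y. proj y $$ (i, j)) \<circ> s) u"
    using local_sectionD(2)[OF s y] by eventually_elim simp
  ultimately have "has_gradient n ((\<lambda>y. proj y $$ (i, j)) \<circ> s) (unit_mat n j i) ?x"
    using x by (rule has_gradient_cong)
  then show ?thesis using s unfolding has_lifted_gradient_def by blast
qed

section \<open>The gradient of an eigenvalue\<close>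

context
  fixes n m k y P x \<mu> and Q :: "complex mat"
  assumes y: "y \<in> M_Omega_e n" and m: "m \<in> {1..n}" and k: "k \<in> {1..m}"
    and Q: "Q \<in> carrier_mat n n"
  defines "P \<equiv> eproj n m k y" and "x \<equiv> proj y" and "\<mu> \<equiv> nu_entry (fst y) k m"
begin

text \<open>The zero columns of \<open>Q\<close> discard exactly the rows of \<open>x * P\<close>
  about which \<open>eproj_left\<close> says nothing.\<close>

lemma mult_left_eproj:
  assumes 0: "\<And>i l. i < n \<Longrightarrow> l < n \<Longrightarrow> m \<le> l \<Longrightarrow> Q $$ (i, l) = 0"
  shows "Q * (x * P) = \<mu> \<cdot>\<^sub>m (Q * P)"
proof (rule eq_matI)
  have car: "x \<in> carrier_mat n n" "P \<in> carrier_mat n n"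
    using M_Omega_eD(3)[OF y] by (auto simp: x_def P_def)
  fix i j assume "i < dim_row (\<mu> \<cdot>\<^sub>m (Q * P))" "j < dim_col (\<mu> \<cdot>\<^sub>m (Q * P))"
  then have ij: "i < n" "j < n" using Q car by auto
  have "(Q * (x * P)) $$ (i, j) = (\<Sum>l<n. Q $$ (i, l) * (x * P) $$ (l, j))"
    using ij Q car by (intro index_mult_sum) auto
  also have "\<dots> = (\<Sum>l<n. \<mu> * (Q $$ (i, l) * P $$ (l, j)))"
  proof (intro sum.cong refl)
    fix l assume "l \<in> {..<n}"
    then show "Q $$ (i, l) * (x * P) $$ (l, j) = \<mu> * (Q $$ (i, l) * P $$ (l, j))"
      using eproj_left[OF y m k _ ij(2), of l] 0[of i l] ij
      by (cases "l < m") (auto simp: x_def P_def \<mu>_def simp del: index_mult_mat)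
  qed
  also have "\<dots> = \<mu> * (Q * P) $$ (i, j)"
    using ij by (subst index_mult_sum[OF Q car(2)]) (auto simp: sum_distrib_left)
  finally show "(Q * (x * P)) $$ (i, j) = (\<mu> \<cdot>\<^sub>m (Q * P)) $$ (i, j)"
    using ij Q car by simp
qed (use Q in \<open>auto simp: P_def\<close>)

lemma mult_right_eproj:
  assumes 0: "\<And>l j. l < n \<Longrightarrow> j < n \<Longrightarrow> m \<le> l \<Longrightarrow> Q $$ (l, j) = 0"
  shows "(P * x) * Q = \<mu> \<cdot>\<^sub>m (P * Q)"
proof (rule eq_matI)
  have car: "x \<in> carrier_mat n n" "P \<in> carrier_mat n n"
    using M_Omega_eD(3)[OF y] by (auto simp: x_def P_def)
  fix i j assume "i < dim_row (\<mu> \<cdot>\<^sub>m (P * Q))" "j < dim_col (\<mu> \<cdot>\<^sub>m (P * Q))"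
  then have ij: "i < n" "j < n" using Q car by auto
  have "((P * x) * Q) $$ (i, j) = (\<Sum>l<n. (P * x) $$ (i, l) * Q $$ (l, j))"
    using ij Q car by (intro index_mult_sum) auto
  also have "\<dots> = (\<Sum>l<n. \<mu> * (P $$ (i, l) * Q $$ (l, j)))"
  proof (intro sum.cong refl)
    fix l assume "l \<in> {..<n}"
    then show "(P * x) $$ (i, l) * Q $$ (l, j) = \<mu> * (P $$ (i, l) * Q $$ (l, j))"
      using eproj_right[OF y m k ij(1), of l] 0[of l j] ij
      by (cases "l < m") (auto simp: x_def P_def \<mu>_def simp del: index_mult_mat)
  qed
  also have "\<dots> = \<mu> * (P * Q) $$ (i, j)"
    using ij by (subst index_mult_sum[OF car(2) Q]) (auto simp: sum_distrib_left)
  finally show "((P * x) * Q) $$ (i, j) = (\<mu> \<cdot>\<^sub>m (P * Q)) $$ (i, j)"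
    using ij Q car by simp
qed (use Q in \<open>auto simp: P_def\<close>)

end

text \<open>Perturbation of a simple eigenvalue: if \<open>P\<close>, \<open>P'\<close> are the spectral projections of \<open>x\<close>, \<open>u\<close> for
  \<open>\<mu>\<close>, \<open>\<mu>'\<close>, then \<open>P (u - x) P' = (\<mu>' - \<mu>) P P'\<close>, and \<open>tr (P P')\<close> tends to 1 as \<open>u\<close> tends to \<open>x\<close>.\<close>

lemma nu_lifted_gradient:
  assumes y: "y \<in> M_Omega_e n" and m: "m \<in> {1..n}" and k: "k \<in> {1..m}"
  shows "has_lifted_gradient n (\<lambda>y. nu_entry (fst y) k m) (eproj n m k y) y"
proof -
  obtain s where s: "local_section n y s" using local_section_exists[OF y] .
  note sD = local_sectionD[OF s y]
  let ?x = "proj y" let ?F = "nhds_mat n ?x" let ?P = "eproj n m k y"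
  define P' where "P' u = eproj n m k (s u)" for u
  define f where "f u = nu_entry (fst (s u)) k m" for u
  define \<tau> where "\<tau> u = mat_trace (?P * P' u)" for u
  have x: "?x \<in> carrier_mat n n" by (rule M_Omega_eD(3)[OF y])
  have car: "?P \<in> carrier_mat n n" "P' u \<in> carrier_mat n n" for u by (simp_all add: P'_def)
  interpret function_ring "\<lambda>f. (f \<longlongrightarrow> f ?x) ?F" by (rule function_ring_tendsto)
  have nu_lim: "((\<lambda>u. nu_entry (fst (s u)) l m) \<longlongrightarrow> nu_entry (fst (s ?x)) l m) ?F"
    if "l \<in> {1..m}" for l
    using sD(3)[OF nu_coord[OF m that]] by (simp add: sD(1))
  have P'_lim: "((\<lambda>u. P' u $$ (i, j)) \<longlongrightarrow> P' ?x $$ (i, j)) ?F" if "i < n" "j < n" for i j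
    unfolding P'_def
  proof (rule Q_eproj[OF _ k])
    fix l assume l: "l \<in> {1..m}" "l \<noteq> k"
    have "nu_entry (fst (s ?x)) k m - nu_entry (fst (s ?x)) l m \<noteq> 0"
      using inj_onD[OF e_Omega_inj[OF M_Omega_eD(1)[OF y] m]] l k sD(1) by auto
    then show "((\<lambda>u. 1 / (nu_entry (fst (s u)) k m - nu_entry (fst (s u)) l m)) \<longlongrightarrow>
        1 / (nu_entry (fst (s ?x)) k m - nu_entry (fst (s ?x)) l m)) ?F"
      using nu_lim l k by (intro tendsto_intros) auto
  next
    fix i j assume "i < n" "j < n"
    from sD(3)[OF entry_coord[OF this]]
    show "((\<lambda>u. proj (s u) $$ (i, j)) \<longlongrightarrow> proj (s ?x) $$ (i, j)) ?F" by (simp add: sD(1))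
  qed (use m that nu_lim in auto)
  have P'x: "P' ?x = ?P" by (simp add: P'_def sD(1))
  have "(\<tau> \<longlongrightarrow> \<tau> ?x) ?F"
    unfolding \<tau>_def mat_trace_mult[OF car] by (intro Q_sum Q_mult Q_const P'_lim) auto
  moreover have "\<tau> ?x = 1"
    unfolding \<tau>_def P'x using eproj_idem[OF y m k] eproj_trace[OF y m k] by simp
  ultimately have tau: "(\<tau> \<longlongrightarrow> 1) ?F" by simp
  \<comment> \<open>Taking traces will show that \<open>f u - f ?x\<close> is the trace of
    \<open>P' u * ?P * (u - ?x)\<close> divided by \<open>\<tau> u\<close>. So \<open>E u\<close> is
    what pairs with \<open>u - ?x\<close> in the remainder, and it tends to
    \<open>?P * ?P - ?P = 0\<close>.\<close>
  define E where "E u i j = (P' u * ?P) $$ (i, j) / \<tau> u - ?P $$ (i, j)" for u i j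
  have E_lim: "((\<lambda>u. E u i j) \<longlongrightarrow> 0) ?F" if "i < n" "j < n" for i j
  proof -
    have "((\<lambda>u. (P' u * ?P) $$ (i, j)) \<longlongrightarrow> (P' ?x * ?P) $$ (i, j)) ?F"
      using that by (intro Q_mult_mat[of _ n] car Q_const P'_lim) auto
    also have "P' ?x * ?P = ?P" unfolding P'x by (rule eproj_idem[OF y m k])
    finally have "((\<lambda>u. E u i j) \<longlongrightarrow> ?P $$ (i, j) / 1 - ?P $$ (i, j)) ?F"
      unfolding E_def by (intro tendsto_intros tau) auto
    then show ?thesis by simp
  qed
  have "((\<lambda>u. (f u - f ?x - mat_trace (?P * (u - ?x))) / of_real (mat_norm1 (u - ?x))) \<longlongrightarrow> 0) ?F"
  proof (rule tendsto_null_comparison)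
    have "((\<lambda>u. \<Sum>i<n. \<Sum>j<n. cmod (E u i j)) \<longlongrightarrow> (\<Sum>i<n. \<Sum>j<n. cmod 0)) ?F"
      by (intro tendsto_intros E_lim) auto
    then show "((\<lambda>u. \<Sum>i<n. \<Sum>j<n. cmod (E u i j)) \<longlongrightarrow> 0) ?F" by simp
    have "\<forall>\<^sub>F u in ?F. \<tau> u \<noteq> 0" using tendsto_imp_eventually_ne[OF tau] by simp
    with sD(2) show "\<forall>\<^sub>F u in ?F. cmod ((f u - f ?x - mat_trace (?P * (u - ?x))) /
        of_real (mat_norm1 (u - ?x))) \<le> (\<Sum>i<n. \<Sum>j<n. cmod (E u i j))"
    proof eventually_elim
      case (elim u)
      then have su: "s u \<in> M_Omega_e n" "proj (s u) = u" by auto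
      have u: "u \<in> carrier_mat n n" using M_Omega_eD(3)[OF su(1)] su(2) by simp
      define V where "V = u - ?x"
      have V: "V \<in> carrier_mat n n" using x unfolding V_def by (intro minus_carrier_mat)
      have "?P * (u * P' u) = f u \<cdot>\<^sub>m (?P * P' u)"
        using mult_left_eproj[OF su(1) m k car(1)] su(2)
        by (auto simp: P'_def f_def eproj_outside)
      moreover have "(?P * ?x) * P' u = f ?x \<cdot>\<^sub>m (?P * P' u)"
        using mult_right_eproj[OF y m k car(2)[of u]] by (auto simp: P'_def f_def eproj_outside sD(1))
      moreover have "?P * (V * P' u) = ?P * (u * P' u) - (?P * ?x) * P' u"
        unfolding V_def using u x car
        by (simp add: minus_mult_distrib_mat[of _ n n _ _ n] mult_minus_distrib_mat[of _ n n _ n]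
            assoc_mult_mat[of _ n n _ n _ n])
      ultimately have "mat_trace (?P * (V * P' u)) = (f u - f ?x) * \<tau> u"
        using car mat_trace_diff[of "f u \<cdot>\<^sub>m (?P * P' u)" n "f ?x \<cdot>\<^sub>m (?P * P' u)"]
        by (simp add: mat_trace_smult[of _ n] \<tau>_def left_diff_distrib)
      moreover have "mat_trace (?P * (V * P' u)) = mat_trace ((P' u * ?P) * V)"
        using car V mat_trace_commute[of "?P * V" n "P' u"]
        by (simp add: assoc_mult_mat[of _ n n _ n _ n])
      moreover have "\<dots> = (\<Sum>i<n. \<Sum>j<n. (P' u * ?P) $$ (i, j) * V $$ (j, i))"
        using car V by (intro mat_trace_mult) auto
      ultimately have "f u - f ?x = (\<Sum>i<n. \<Sum>j<n. (P' u * ?P) $$ (i, j) * V $$ (j, i)) / \<tau> u"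
        using elim by (simp add: field_simps del: index_mult_mat)
      then have eq: "f u - f ?x - mat_trace (?P * V) = (\<Sum>i<n. \<Sum>j<n. E u i j * V $$ (j, i))"
        unfolding mat_trace_mult[OF car(1) V] E_def
        by (simp add: sum_divide_distrib left_diff_distrib sum_subtractf del: index_mult_mat)
      have "cmod (f u - f ?x - mat_trace (?P * V)) \<le> (\<Sum>i<n. \<Sum>j<n. cmod (E u i j) * mat_norm1 V)"
        unfolding eq
      proof (intro order_trans[OF norm_sum] sum_mono)
        fix i j assume "i \<in> {..<n}" "j \<in> {..<n}"
        then have "cmod (V $$ (j, i)) \<le> mat_norm1 V"
          using entry_le_mat_norm1[OF u x, of j i] u x by (simp add: V_def)
        then show "cmod (E u i j * V $$ (j, i)) \<le> cmod (E u i j) * mat_norm1 V"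
          by (simp add: norm_mult mult_left_mono)
      qed
      also have "\<dots> = (\<Sum>i<n. \<Sum>j<n. cmod (E u i j)) * mat_norm1 V"
        by (simp add: sum_distrib_right)
      finally have "cmod (f u - f ?x - mat_trace (?P * V)) / mat_norm1 V \<le> (\<Sum>i<n. \<Sum>j<n. cmod (E u i j))"
        using mat_norm1_nonneg[of V]
        by (cases "mat_norm1 V = 0") (auto simp: pos_divide_le_eq intro!: sum_nonneg)
      then show ?case using mat_norm1_nonneg[of V] by (simp add: norm_divide V_def)
    qed
  qed
  then have "has_gradient n f ?P ?x" unfolding has_gradient_def by simp
  moreover have "(\<lambda>y. nu_entry (fst y) k m) \<circ> s = f" by (auto simp: f_def)
  ultimately show ?thesis using s unfolding has_lifted_gradient_def by metis
qed

section \<open>Integral curves\<close>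

text \<open>On the segment from 0 to \<open>q\<close> the real and imaginary parts are real
  functions with derivative 0.\<close>

lemma zero_derivative_imp_constant:
  fixes f :: "complex \<Rightarrow> complex"
  assumes "\<And>q. (f has_field_derivative 0) (at q)"
  shows "f q = f 0"
proof -
  have der: "((\<lambda>t::real. f (of_real t * q)) has_derivative (\<lambda>_. 0)) (at t)" for t
  proof -
    have "((\<lambda>t::real. of_real t * q) has_derivative (\<lambda>h. of_real h * q)) (at t)"
      by (auto intro!: derivative_eq_intros)
    moreover have "(f has_derivative (\<lambda>_. 0)) (at (of_real t * q))"
      using assms[of "of_real t * q"] by (simp add: has_field_derivative_def lambda_zero)
    ultimately show ?thesis by (rule has_derivative_compose)
  qed
  have "DERIV (\<lambda>t. Re (f (of_real t * q))) t :> 0" "DERIV (\<lambda>t. Im (f (of_real t * q))) t :> 0" for t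
    using bounded_linear.has_derivative[OF bounded_linear_Re der]
      bounded_linear.has_derivative[OF bounded_linear_Im der]
    by (simp_all add: has_field_derivative_def lambda_zero)
  then have "Re (f (of_real 1 * q)) = Re (f (of_real 0 * q))" "Im (f (of_real 1 * q)) = Im (f (of_real 0 * q))"
    using DERIV_isconst_all[of "\<lambda>t. Re (f (of_real t * q))" 1 0]
      DERIV_isconst_all[of "\<lambda>t. Im (f (of_real t * q))" 1 0] by simp_all
  then show ?thesis by (simp add: complex_eq_iff)
qed

lemma gmat_conj_index:
  assumes P: "P \<in> carrier_mat n n" and X: "X \<in> carrier_mat n n" and ij: "i < n" "j < n"
  shows "(gmat n P \<alpha> * X * gmat n P \<beta>) $$ (i, j) = X $$ (i, j) + (\<beta> - 1) * (X * P) $$ (i, j) +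
      (\<alpha> - 1) * ((P * X) $$ (i, j) + (\<beta> - 1) * (P * X * P) $$ (i, j))"
proof -
  have "gmat n P \<alpha> * X * gmat n P \<beta> = (X + (\<alpha> - 1) \<cdot>\<^sub>m (P * X)) * gmat n P \<beta>"
    using gmat_mult_left[OF P X] by simp
  also have "\<dots> = (X + (\<alpha> - 1) \<cdot>\<^sub>m (P * X)) + (\<beta> - 1) \<cdot>\<^sub>m ((X + (\<alpha> - 1) \<cdot>\<^sub>m (P * X)) * P)"
    using P X by (intro gmat_mult_right) auto
  also have "(X + (\<alpha> - 1) \<cdot>\<^sub>m (P * X)) * P = X * P + (\<alpha> - 1) \<cdot>\<^sub>m (P * X * P)"
    using P X by (simp add: add_mult_distrib_mat[of _ n n _ _ n] mult_smult_assoc_mat[of _ n n _ n])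
  finally show ?thesis
    using ij P X by (simp add: algebra_simps del: index_mult_mat(1))
qed

lemma has_field_derivative_mult_mat:
  fixes X :: "complex \<Rightarrow> complex mat"
  assumes X: "\<And>p. X p \<in> carrier_mat n n" and D: "D \<in> carrier_mat n n"
    and A: "A \<in> carrier_mat n n" and ij: "i < n" "j < n"
    and der: "\<And>i j. i < n \<Longrightarrow> j < n \<Longrightarrow> ((\<lambda>p. X p $$ (i, j)) has_field_derivative D $$ (i, j)) (at q)"
  shows "((\<lambda>p. (X p * A) $$ (i, j)) has_field_derivative (D * A) $$ (i, j)) (at q)"
    and "((\<lambda>p. (A * X p) $$ (i, j)) has_field_derivative (A * D) $$ (i, j)) (at q)"
proof -
  show "((\<lambda>p. (X p * A) $$ (i, j)) has_field_derivative (D * A) $$ (i, j)) (at q)"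
    unfolding index_mult_sum[OF X A ij] index_mult_sum[OF D A ij]
    using ij by (intro DERIV_sum DERIV_cmult_right der) auto
  show "((\<lambda>p. (A * X p) $$ (i, j)) has_field_derivative (A * D) $$ (i, j)) (at q)"
    unfolding index_mult_sum[OF A X ij] index_mult_sum[OF A D ij]
    using ij by (intro DERIV_sum DERIV_cmult der) auto
qed

text \<open>Cyclicity of the trace. With \<open>P\<close> the gradient of the Hamiltonian and
  \<open>G\<close> that of the test function, it identifies the Hamiltonian vector field as
  \<open>x * P - P * x\<close>.\<close>

lemma trace_bracket:
  assumes "x \<in> carrier_mat n n" "P \<in> carrier_mat n n" "G \<in> carrier_mat n n"
  shows "mat_trace (x * mat_bracket P G) = mat_trace (G * (x * P - P * x))"
proof -
  have "x * mat_bracket P G = x * P * G - x * (G * P)"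
    unfolding mat_bracket_def using assms
    by (simp add: mult_minus_distrib_mat[of _ n n _ n] assoc_mult_mat[of _ n n _ n _ n])
  moreover have "G * (x * P - P * x) = G * (x * P) - G * (P * x)"
    using assms by (intro mult_minus_distrib_mat[of _ n n _ n]) auto
  moreover have "mat_trace (x * P * G) = mat_trace (G * (x * P))"
    using assms by (intro mat_trace_commute) auto
  moreover have "mat_trace (x * (G * P)) = mat_trace (G * P * x)"
    using assms by (intro mat_trace_commute) auto
  moreover have "G * P * x = G * (P * x)"
    using assms by (intro assoc_mult_mat) auto
  ultimately show ?thesis using assms by (simp add: mat_trace_diff[of _ n])
qed

lemma poisson_nu:
  assumes y: "y \<in> M_Omega_e n" and m: "m \<in> {1..n}" and k: "k \<in> {1..m}"
    and G: "has_lifted_gradient n \<psi> G y"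
  shows "poisson n (\<lambda>y. nu_entry (fst y) k m) \<psi> y =
    mat_trace (G * (proj y * eproj n m k y - eproj n m k y * proj y))"
proof -
  have "G \<in> carrier_mat n n" using G by (auto simp: has_lifted_gradient_def has_gradient_def)
  then show ?thesis
    unfolding poisson_def lifted_gradient_eqI[OF y G]
      lifted_gradient_eqI[OF y nu_lifted_gradient[OF y m k]]
    by (rule trace_bracket[OF M_Omega_eD(3)[OF y] eproj_carrier])
qed

lemma poisson_nu_entry:
  assumes y: "y \<in> M_Omega_e n" and m: "m \<in> {1..n}" and k: "k \<in> {1..m}" and ij: "i < n" "j < n"
  shows "poisson n (\<lambda>y. nu_entry (fst y) k m) (\<lambda>y. proj y $$ (i, j)) y =
    (proj y * eproj n m k y - eproj n m k y * proj y) $$ (i, j)"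
proof -
  let ?D = "proj y * eproj n m k y - eproj n m k y * proj y"
  have D: "?D \<in> carrier_mat n n"
    using M_Omega_eD(3)[OF y] by (intro minus_carrier_mat mult_carrier_square) auto
  show ?thesis
    unfolding poisson_nu[OF y m k entry_lifted_gradient[OF y ij]]
    using mat_trace_commute[OF unit_mat_carrier D] trace_mult_unit_mat[OF D ij] by simp
qed

text \<open>Involutivity of the Gelfand-Tsetlin eigenvalues. The projection of the smaller level is
  supported where the larger one satisfies its eigenvector equations, so both terms of the
  commutator pair with it to the same multiple of the trace of the product of the two
  projections.\<close>

lemma poisson_nu_nu:
  assumes y: "y \<in> M_Omega_e n" and m: "m \<in> {1..n}" and k: "k \<in> {1..m}"
    and m': "m' \<in> {1..n}" and k': "k' \<in> {1..m'}"
  shows "poisson n (\<lambda>y. nu_entry (fst y) k m) (\<lambda>y. nu_entry (fst y) k' m') y = 0"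
proof -
  let ?P = "eproj n m k y" and ?R = "eproj n m' k' y" and ?x = "proj y"
  have car: "?P \<in> carrier_mat n n" "?R \<in> carrier_mat n n" "?x \<in> carrier_mat n n"
    using M_Omega_eD(3)[OF y] by auto
  have "mat_trace (?R * (?x * ?P)) = mat_trace (?R * (?P * ?x))"
  proof (cases "m' \<le> m")
    case True
    have "?R * (?x * ?P) = nu_entry (fst y) k m \<cdot>\<^sub>m (?R * ?P)"
      using True by (intro mult_left_eproj[OF y m k car(2)]) (auto simp: eproj_outside)
    moreover have "(?P * ?x) * ?R = nu_entry (fst y) k m \<cdot>\<^sub>m (?P * ?R)"
      using True by (intro mult_right_eproj[OF y m k car(2)]) (auto simp: eproj_outside)
    moreover have "mat_trace (?R * (?P * ?x)) = mat_trace ((?P * ?x) * ?R)"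
      using car by (intro mat_trace_commute) auto
    ultimately show ?thesis
      using car mat_trace_commute[OF car(1,2)] by (simp add: mat_trace_smult[of _ n])
  next
    case False
    have "?P * (?x * ?R) = nu_entry (fst y) k' m' \<cdot>\<^sub>m (?P * ?R)"
      using False by (intro mult_left_eproj[OF y m' k' car(1)]) (auto simp: eproj_outside)
    moreover have "(?R * ?x) * ?P = nu_entry (fst y) k' m' \<cdot>\<^sub>m (?R * ?P)"
      using False by (intro mult_right_eproj[OF y m' k' car(1)]) (auto simp: eproj_outside)
    moreover have "mat_trace (?R * (?P * ?x)) = mat_trace (?P * (?x * ?R))"
      using car mat_trace_commute[of ?R n "?P * ?x"] by (simp add: assoc_mult_mat[of _ n n _ n _ n])
    moreover have "?R * (?x * ?P) = (?R * ?x) * ?P"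
      using car by (intro assoc_mult_mat[symmetric]) auto
    ultimately show ?thesis
      using car mat_trace_commute[OF car(1,2)]
      by (simp add: mat_trace_smult[of _ n] del: assoc_mult_mat)
  qed
  moreover have "?R * (?x * ?P - ?P * ?x) = ?R * (?x * ?P) - ?R * (?P * ?x)"
    using car by (intro mult_minus_distrib_mat[of _ n n _ n]) auto
  ultimately show ?thesis
    unfolding poisson_nu[OF y m k nu_lifted_gradient[OF y m' k']] using car
    by (simp add: mat_trace_diff[of _ n])
qed

lemma holomorphic_nu: "m \<in> {1..n} \<Longrightarrow> k \<in> {1..m} \<Longrightarrow> holomorphic_fun n (\<lambda>y. nu_entry (fst y) k m)"
  using nu_lifted_gradient unfolding holomorphic_fun_def by blast

lemma holomorphic_entry: "i < n \<Longrightarrow> j < n \<Longrightarrow> holomorphic_fun n (\<lambda>y. proj y $$ (i, j))"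
  using entry_lifted_gradient unfolding holomorphic_fun_def by blast

context
  fixes n m k and \<phi> :: "point \<Rightarrow> complex"
  assumes m: "m \<in> {1..n}" and k: "k \<in> {1..m}"
  defines "\<phi> \<equiv> (\<lambda>y. nu_entry (fst y) k m)"
begin

text \<open>The projection is constant along the curve, so the entries of \<open>X\<close> are
  explicit rational functions of \<open>exp q\<close> and can be differentiated directly. A general
  test function is holomorphic only through a local section; the constant labels keep the curve on
  the sheet of that section.\<close>

lemma act_integral_curve:
  assumes y: "y \<in> M_Omega_e n"
  shows "integral_curve n \<phi> (\<lambda>q. act n m k (exp q) y)"
proof -
  define c where "c q = act n m k (exp q) y" for q
  let ?P = "eproj n m k y" and ?x = "proj y"
  define X where "X q = proj (c q)" for q
  define D where "D q = X q * ?P - ?P * X q" for q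
  have cM: "c q \<in> M_Omega_e n" for q
    unfolding c_def by (rule act_in[OF y m k]) simp
  have X: "X q \<in> carrier_mat n n" for q unfolding X_def by (rule M_Omega_eD(3)[OF cM])
  have x: "?x \<in> carrier_mat n n" by (rule M_Omega_eD(3)[OF y])
  have P: "?P \<in> carrier_mat n n" "?P * ?P = ?P" using eproj_idem[OF y m k] by auto
  have D: "D q \<in> carrier_mat n n" for q
    unfolding D_def using X P by (intro minus_carrier_mat mult_carrier_square) auto
  have Xq: "X q = gmat n ?P (1 / exp q) * ?x * gmat n ?P (exp q)" for q
    by (simp add: X_def c_def act_def)
  have Pc: "eproj n m k (c q) = ?P" for q
    unfolding c_def by (rule act_eproj_le[OF y m k]) auto
  have der: "((\<lambda>p. X p $$ (i, j)) has_field_derivative D q $$ (i, j)) (at q)" if ij: "i < n" "j < n" for q i j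
  proof -
    let ?a = "(?x * ?P) $$ (i, j)" and ?b = "(?P * ?x) $$ (i, j)" and ?d = "(?P * ?x * ?P) $$ (i, j)"
    have "X q * ?P = (gmat n ?P (1 / exp q) * ?x) * (gmat n ?P (exp q) * ?P)"
      unfolding Xq using P x by (intro assoc_mult_mat[of _ n n _ n _ n]) auto
    also have "\<dots> = exp q \<cdot>\<^sub>m (gmat n ?P (1 / exp q) * (?x * ?P))"
      unfolding gmat_proj[OF P] using P x
      by (simp add: mult_smult_distrib[of _ n n _ n] assoc_mult_mat[of _ n n _ n _ n])
    also have "gmat n ?P (1 / exp q) * (?x * ?P) = ?x * ?P + (1 / exp q - 1) \<cdot>\<^sub>m (?P * ?x * ?P)"
      using P x by (subst gmat_mult_left) (auto simp: assoc_mult_mat[of _ n n _ n _ n])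
    finally have XP: "(X q * ?P) $$ (i, j) = exp q * (?a + (1 / exp q - 1) * ?d)"
      using ij x by (simp del: index_mult_mat(1))
    have "?P * X q = (?P * gmat n ?P (1 / exp q)) * (?x * gmat n ?P (exp q))"
      unfolding Xq using P x by (simp add: assoc_mult_mat[of _ n n _ n _ n])
    also have "\<dots> = (1 / exp q) \<cdot>\<^sub>m (?P * ?x * gmat n ?P (exp q))"
      unfolding gmat_proj[OF P] using P x
      by (simp add: mult_smult_assoc_mat[of _ n n _ n] assoc_mult_mat[of _ n n _ n _ n])
    also have "?P * ?x * gmat n ?P (exp q) = ?P * ?x + (exp q - 1) \<cdot>\<^sub>m (?P * ?x * ?P)"
      using P x by (intro gmat_mult_right) auto
    finally have PX: "(?P * X q) $$ (i, j) = 1 / exp q * (?b + (exp q - 1) * ?d)"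
      using ij x by (simp del: index_mult_mat(1))
    have D': "D q $$ (i, j) = exp q * (?a + (1 / exp q - 1) * ?d) - 1 / exp q * (?b + (exp q - 1) * ?d)"
      unfolding D_def XP[symmetric] PX[symmetric] using ij X[of q] P by (simp del: index_mult_mat(1))
    have "((\<lambda>p. ?x $$ (i, j) + (exp p - 1) * ?a + (1 / exp p - 1) * (?b + (exp p - 1) * ?d))
        has_field_derivative D q $$ (i, j)) (at q)"
      unfolding D' by (auto intro!: derivative_eq_intros simp: field_simps power2_eq_square)
    then show ?thesis
      unfolding Xq gmat_conj_index[OF P(1) x ij] .
  qed
  have "((\<lambda>p. \<psi> (c p)) has_field_derivative poisson n \<phi> \<psi> (c q)) (at q)"
    if psi: "holomorphic_fun n \<psi>" for \<psi> q
  proof -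
    obtain G s where s: "local_section n (c q) s" and G: "has_gradient n (\<psi> \<circ> s) G (X q)"
      using psi cM unfolding holomorphic_fun_def has_lifted_gradient_def X_def by blast
    have lG: "has_lifted_gradient n \<psi> G (c q)"
      using s G unfolding has_lifted_gradient_def X_def by blast
    have 1: "((\<lambda>p. (\<psi> \<circ> s) (X p)) has_field_derivative mat_trace (G * D q)) (at q)"
      by (rule has_gradient_curve[of n "\<psi> \<circ> s" G X q "D q"]) (use G X D der in auto)
    obtain e where e: "0 < e" "\<forall>\<^sub>F u in nhds_mat n (X q). \<forall>p \<in> M_Omega_e n. proj p = u \<longrightarrow>
        nu_near n e (fst (c q)) (fst p) \<longrightarrow> s u = p"
      using local_section_eventually_eq[OF s cM] unfolding X_def by blast
    \<comment> \<open>Convergence on the unpunctured filter: \<open>DERIV_cong_ev\<close> compares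
      the two functions on a full neighbourhood of \<open>q\<close>.\<close>
    have "((\<lambda>p. X p $$ (i, j)) \<longlongrightarrow> X q $$ (i, j)) (nhds q)" if "i < n" "j < n" for i j
      using DERIV_isCont[OF der[OF that, of q]] unfolding isCont_def
      by (rule tendsto_at_iff_tendsto_nhds[THEN iffD1])
    then have "filterlim X (nhds_mat n (X q)) (nhds q)"
      using X by (intro filterlim_nhds_mat) auto
    then have "\<forall>\<^sub>F p in nhds q. \<forall>z \<in> M_Omega_e n. proj z = X p \<longrightarrow>
        nu_near n e (fst (c q)) (fst z) \<longrightarrow> s (X p) = z"
      using e(2) by (rule filterlim_iff[THEN iffD1, rule_format])
    then have "\<forall>\<^sub>F p in nhds q. (\<psi> \<circ> s) (X p) = \<psi> (c p)"
    proof eventually_elim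
      case (elim p)
      have "fst (c p) = fst (c q)" by (simp add: c_def)
      then have "nu_near n e (fst (c q)) (fst (c p))" using e(1) by (simp add: nu_near_def)
      then show ?case using elim cM[of p] by (simp add: X_def)
    qed
    then have "((\<lambda>p. \<psi> (c p)) has_field_derivative mat_trace (G * D q)) (at q)"
      using 1 DERIV_cong_ev[OF refl _ refl, of "\<lambda>p. (\<psi> \<circ> s) (X p)" "\<lambda>p. \<psi> (c p)" q] by blast
    then show ?thesis
      unfolding \<phi>_def poisson_nu[OF cM m k lG] Pc by (simp add: D_def X_def)
  qed
  then show ?thesis
    using cM unfolding integral_curve_def c_def by blast
qed

text \<open>Conserved quantities linearize the equation: first the labels are constant because the
  eigenvalues Poisson commute, then the leading block, hence the projection. What remains is an
  equation with constant coefficients that conjugation solves.\<close>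

lemma integral_curve_unique:
  assumes c: "integral_curve n \<phi> c"
  shows "c q = act n m k (exp q) (c 0)"
proof -
  have cM: "c q \<in> M_Omega_e n" for q using c by (simp add: integral_curve_def)
  have c': "((\<lambda>p. \<psi> (c p)) has_field_derivative poisson n \<phi> \<psi> (c q)) (at q)"
    if "holomorphic_fun n \<psi>" for \<psi> q
    using c that by (simp add: integral_curve_def)
  have nu: "fst (c q) = fst (c 0)" for q
  proof (rule e_Omega_eqI)
    fix m' k' assume mk: "m' \<in> {1..n}" "k' \<in> {1..m'}"
    show "nu_entry (fst (c q)) k' m' = nu_entry (fst (c 0)) k' m'"
      using c'[OF holomorphic_nu[OF mk]] poisson_nu_nu[OF cM m k mk]
      by (intro zero_derivative_imp_constant[of "\<lambda>q. nu_entry (fst (c q)) k' m'"]) (simp add: \<phi>_def)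
  qed (use cM M_Omega_eD(1) in auto)
  define X where "X q = proj (c q)" for q
  have X: "X q \<in> carrier_mat n n" for q unfolding X_def by (rule M_Omega_eD(3)[OF cM])
  define P where "P = eproj n m k (c 0)"
  have P: "P \<in> carrier_mat n n" "P * P = P"
    unfolding P_def using eproj_idem[OF cM m k] by auto
  have der': "((\<lambda>p. X p $$ (i, j)) has_field_derivative
      (X q * eproj n m k (c q) - eproj n m k (c q) * X q) $$ (i, j)) (at q)"
    if "i < n" "j < n" for q i j
    using c'[OF holomorphic_entry[OF that], of q] poisson_nu_entry[OF cM m k that]
    by (simp add: \<phi>_def X_def del: index_minus_mat)
  \<comment> \<open>In the leading block both products with the projection are the same multiple of
    it, so their difference, the derivative, is 0.\<close>
  have low: "X q $$ (i, j) = X 0 $$ (i, j)" if ij: "i < m" "j < m" for q i j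
  proof (rule zero_derivative_imp_constant[of "\<lambda>q. X q $$ (i, j)"])
    fix q
    have n: "i < n" "j < n" using ij m by auto
    have "(X q * eproj n m k (c q) - eproj n m k (c q) * X q) $$ (i, j) = 0"
      unfolding X_def using n M_Omega_eD(3)[OF cM, of q] eproj_left[OF cM m k ij(1) n(2), of q]
        eproj_right[OF cM m k n(1) ij(2), of q] by (simp del: index_mult_mat(1))
    then show "((\<lambda>q. X q $$ (i, j)) has_field_derivative 0) (at q)" using der'[OF n, of q] by simp
  qed
  have Pc: "eproj n m k (c q) = P" for q
  proof -
    have "cutoff m (X q) = cutoff m (X 0)"
      using low[of _ _ q] by (intro eq_matI) (auto simp: cutoff_def)
    then show ?thesis using nu[of q] by (simp add: P_def eproj_def X_def)
  qed
  define D where "D q = X q * P - P * X q" for q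
  have D: "D q \<in> carrier_mat n n" for q
    unfolding D_def using X P by (intro minus_carrier_mat mult_carrier_square) auto
  have der: "((\<lambda>p. X p $$ (i, j)) has_field_derivative D q $$ (i, j)) (at q)" if "i < n" "j < n" for q i j
    using der'[OF that, of q] unfolding Pc D_def .
  \<comment> \<open>\<open>Z\<close> undoes the conjugation by which \<open>X q\<close> should arise
    from \<open>X 0\<close>, so its derivative has to vanish; this comes down to
    \<open>P * P = P\<close>.\<close>
  define Z where "Z q = gmat n P (exp q) * X q * gmat n P (1 / exp q)" for q
  have PXP: "P * (P * X q) = P * X q" "X q * P * P = X q * P" "P * X q * P * P = P * X q * P" for q
    using assoc_mult_mat[OF P(1,1) X[of q]] assoc_mult_mat[OF X[of q] P(1,1)]
      assoc_mult_mat[OF mult_carrier_square[OF P(1) X[of q]] P(1,1)] unfolding P(2) by metis+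
  have Z: "Z q $$ (i, j) = Z 0 $$ (i, j)" if ij: "i < n" "j < n" for q i j
  proof (rule zero_derivative_imp_constant[of "\<lambda>q. Z q $$ (i, j)"])
    fix q
    let ?a = "(X q * P) $$ (i, j)" and ?b = "(P * X q) $$ (i, j)" and ?d = "(P * X q * P) $$ (i, j)"
    note hm = has_field_derivative_mult_mat[OF X D[of q] P(1) ij der[of _ _ q]]
    have PX: "P * X q \<in> carrier_mat n n" for q using P X by simp
    have PD: "P * D q \<in> carrier_mat n n" for q using P D by simp
    have d1: "D q $$ (i, j) = ?a - ?b"
      unfolding D_def using ij X[of q] P(1) by (simp del: index_mult_mat(1))
    have "D q * P = X q * P * P - P * X q * P"
      unfolding D_def using P X by (intro minus_mult_distrib_mat[of _ n n _ _ n]) auto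
    then have d2: "(D q * P) $$ (i, j) = ?a - ?d"
      unfolding PXP(2) using ij X[of q] P(1) by (simp del: index_mult_mat(1))
    have "P * D q = P * (X q * P) - P * (P * X q)"
      unfolding D_def using P X by (intro mult_minus_distrib_mat[of _ n n _ n]) auto
    then have PD': "P * D q = P * X q * P - P * X q"
      unfolding PXP(1) using assoc_mult_mat[OF P(1) X[of q] P(1)] by simp
    then have d3: "(P * D q) $$ (i, j) = ?d - ?b"
      using ij X[of q] P(1) by (simp del: index_mult_mat(1))
    have "P * D q * P = P * X q * P * P - P * X q * P"
      unfolding PD' using P X by (intro minus_mult_distrib_mat[of _ n n _ _ n]) auto
    then have d4: "(P * D q * P) $$ (i, j) = 0"
      unfolding PXP(3) using ij X[of q] P(1) by (simp del: index_mult_mat(1))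
    have h4: "((\<lambda>p. (P * X p * P) $$ (i, j)) has_field_derivative (P * D q * P) $$ (i, j)) (at q)"
      by (rule has_field_derivative_mult_mat(1)[OF PX PD P(1) ij
            has_field_derivative_mult_mat(2)[OF X D P(1) _ _ der]])
    have "((\<lambda>p. X p $$ (i, j) + (1 / exp p - 1) * (X p * P) $$ (i, j) +
        (exp p - 1) * ((P * X p) $$ (i, j) + (1 / exp p - 1) * (P * X p * P) $$ (i, j)))
        has_field_derivative 0) (at q)"
      by (rule derivative_eq_intros refl der[OF ij, of q, unfolded d1] hm(1)[unfolded d2] hm(2)[unfolded d3]
          h4[unfolded d4] | simp add: field_simps)+
    then show "((\<lambda>q. Z q $$ (i, j)) has_field_derivative 0) (at q)"
      unfolding Z_def gmat_conj_index[OF P(1) X ij] .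
  qed
  have G: "gmat n P a \<in> carrier_mat n n" for a using P by simp
  have Zc: "Z q \<in> carrier_mat n n" for q unfolding Z_def using G X by simp
  have Z0: "Z 0 = X 0" using X[of 0] by (simp add: Z_def gmat_one[OF P(1)])
  have "Z q = X 0"
    using Z[of _ _ q] carrier_matD[OF Zc[of q]] carrier_matD[OF X[of 0]] unfolding Z0
    by (intro eq_matI) auto
  then have "gmat n P (1 / exp q) * X 0 * gmat n P (exp q) =
      gmat n P (1 / exp q) * (gmat n P (exp q) * X q * gmat n P (1 / exp q)) * gmat n P (exp q)"
    by (simp add: Z_def)
  also have "\<dots> = (gmat n P (1 / exp q) * gmat n P (exp q)) * (X q * (gmat n P (1 / exp q) * gmat n P (exp q)))"
    using G X[of q] by (simp add: assoc_mult_mat[of _ n n _ n _ n])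
  also have "\<dots> = X q"
    using X[of q] by (simp add: gmat_mult[OF P] gmat_one[OF P(1)])
  finally have "proj (c q) = proj (act n m k (exp q) (c 0))"
    by (simp add: act_def P_def X_def)
  then show ?thesis using nu[of q] by (simp add: prod_eq_iff)
qed

lemma exp_flow_nu:
  assumes "y \<in> M_Omega_e n"
  shows "exp_flow n \<phi> q y = act n m k (exp q) y"
  unfolding exp_flow_def
proof (rule the_equality)
  have "act n m k (exp 0) y = y"
    using M_Omega_eD(3)[OF assms] gmat_one[OF eproj_carrier[of n m k y]]
    by (simp add: act_def prod_eq_iff)
  then show "\<exists>c. integral_curve n \<phi> c \<and> c 0 = y \<and> act n m k (exp q) y = c q"
    using act_integral_curve[OF assms] by blast
qed (use integral_curve_unique in auto)

end

section \<open>The torus action\<close>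

definition act_at :: "nat \<Rightarrow> (nat \<Rightarrow> complex) \<Rightarrow> nat \<Rightarrow> point \<Rightarrow> point" where
  "act_at n \<zeta> j = act n (level j) (index j) (\<zeta> j)"

definition acoord_at :: "nat \<Rightarrow> nat \<Rightarrow> point \<Rightarrow> complex" where
  "acoord_at n j = acoord n (level j) (index j)"

context
  fixes n :: nat and I :: "nat set"
  defines "I \<equiv> {1..dim_d (n - 1)}"
begin

private lemma range: "j \<in> I \<Longrightarrow> level j \<in> {1..<n}" "j \<in> I \<Longrightarrow> level j \<in> {1..n}"
  "j \<in> I \<Longrightarrow> index j \<in> {1..level j}"
  unfolding I_def by (fact level_index_range)+

lemma level_index_inj:
  assumes "i \<in> I" "j \<in> I" "level i = level j" "index i = index j"
  shows "i = j"
  using level_index(3)[of i] level_index(3)[of j] assms by (auto simp: I_def)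

lemma act_at_in: "y \<in> M_Omega_e n \<Longrightarrow> j \<in> I \<Longrightarrow> \<zeta> j \<noteq> 0 \<Longrightarrow> act_at n \<zeta> j y \<in> M_Omega_e n"
  unfolding act_at_def using range by (intro act_in)

lemma foldr_act_in:
  assumes "y \<in> M_Omega_e n" "set js \<subseteq> I" "\<And>j. j \<in> I \<Longrightarrow> \<zeta> j \<noteq> 0"
  shows "foldr (act_at n \<zeta>) js y \<in> M_Omega_e n"
  using assms(2)
proof (induction js)
  case (Cons j js)
  then show ?case using act_at_in[of _ j \<zeta>] assms(3)[of j] by simp
qed (use assms(1) in simp)

lemma foldl_act_in:
  assumes "y \<in> M_Omega_e n" "set js \<subseteq> I" "\<And>j. j \<in> I \<Longrightarrow> \<zeta> j \<noteq> 0"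
  shows "foldl (\<lambda>y j. act_at n \<zeta> j y) y js \<in> M_Omega_e n"
  using assms(1,2)
proof (induction js arbitrary: y)
  case (Cons j js)
  then show ?case using act_at_in[of y j \<zeta>] assms(3)[of j] by simp
qed simp

lemma act_at_inverse:
  assumes "y \<in> M_Omega_e n" "j \<in> I" "\<zeta> j \<noteq> 0"
  shows "act_at n (\<lambda>j. 1 / \<zeta> j) j (act_at n \<zeta> j y) = y"
    "act_at n \<zeta> j (act_at n (\<lambda>j. 1 / \<zeta> j) j y) = y"
  using act_act_inverse[OF assms(1) range(2,3)[OF assms(2)], of "\<zeta> j"]
    act_act_inverse[OF assms(1) range(2,3)[OF assms(2)], of "1 / \<zeta> j"] assms(3)
  by (simp_all add: act_at_def)

text \<open>\<open>foldr\<close> applies the head of the list last, and \<open>foldl\<close> undoes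
  the head first, so the factors cancel in pairs from the outside.\<close>

lemma foldl_foldr_act:
  assumes "y \<in> M_Omega_e n" "set js \<subseteq> I" "\<And>j. j \<in> I \<Longrightarrow> \<zeta> j \<noteq> 0"
  shows "foldl (\<lambda>y j. act_at n (\<lambda>j. 1 / \<zeta> j) j y) (foldr (act_at n \<zeta>) js y) js = y"
  using assms(2)
proof (induction js)
  case (Cons j js)
  then show ?case using act_at_inverse(1)[OF foldr_act_in[OF assms(1)]] assms(3) by simp
qed simp

lemma foldr_foldl_act:
  assumes "z \<in> M_Omega_e n" "set js \<subseteq> I" "\<And>j. j \<in> I \<Longrightarrow> \<zeta> j \<noteq> 0"
  shows "foldr (act_at n \<zeta>) js (foldl (\<lambda>y j. act_at n (\<lambda>j. 1 / \<zeta> j) j y) z js) = z"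
  using assms(1,2)
proof (induction js arbitrary: z)
  case (Cons j js)
  then show ?case
    using act_at_inverse(2)[OF Cons.prems(1), of j \<zeta>] assms(3)
      act_at_in[OF Cons.prems(1), of j "\<lambda>j. 1 / \<zeta> j"] by simp
qed simp

lemma acoord_at_act:
  assumes "y \<in> M_Omega_e n" "i \<in> I" "j \<in> I" "\<zeta> j \<noteq> 0"
  shows "acoord_at n i (act_at n \<zeta> j y) = (if i = j then \<zeta> j else 1) * acoord_at n i y"
  unfolding acoord_at_def act_at_def
  using acoord_act[where \<zeta> = "\<zeta> j", OF assms(1) range(2,3)[OF assms(3)] assms(4) range(1,3)[OF assms(2)]]
    level_index_inj[OF assms(3,2)] by auto

lemma acoord_at_foldr:
  assumes "y \<in> M_Omega_e n" "set js \<subseteq> I" "distinct js" "i \<in> I" "\<And>j. j \<in> I \<Longrightarrow> \<zeta> j \<noteq> 0"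
  shows "acoord_at n i (foldr (act_at n \<zeta>) js y) =
    (if i \<in> set js then \<zeta> i else 1) * acoord_at n i y"
  using assms(2,3)
proof (induction js)
  case (Cons j js)
  then show ?case
    using acoord_at_act[OF foldr_act_in[OF assms(1)] assms(4)] assms(5) by auto
qed simp

lemma acoord_at_foldl:
  assumes "y \<in> M_Omega_e n" "set js \<subseteq> I" "distinct js" "i \<in> I" "\<And>j. j \<in> I \<Longrightarrow> \<zeta> j \<noteq> 0"
  shows "acoord_at n i (foldl (\<lambda>y j. act_at n \<zeta> j y) y js) =
    (if i \<in> set js then \<zeta> i else 1) * acoord_at n i y"
  using assms(1-3)
proof (induction js arbitrary: y)
  case (Cons j js)
  have "acoord_at n i (foldl (\<lambda>y j. act_at n \<zeta> j y) y (j # js)) =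
      (if i \<in> set js then \<zeta> i else 1) * acoord_at n i (act_at n \<zeta> j y)"
    using Cons assms(5) by (simp add: act_at_in)
  then show ?case
    using acoord_at_act[OF Cons.prems(1) assms(4), of j \<zeta>] Cons.prems assms(5) by auto
qed simp

lemma acoord_at_nonzero: "y \<in> M_Omega_e n \<Longrightarrow> j \<in> I \<Longrightarrow> acoord_at n j y \<noteq> 0"
  unfolding acoord_at_def using range[of j] by (intro acoord_nonzero) auto

lemma M_Omega_e_b_iff:
  "y \<in> M_Omega_e_b n \<longleftrightarrow> y \<in> M_Omega_e n \<and> (\<forall>j\<in>I. acoord_at n j y = 1)"
proof -
  have "(\<forall>m\<in>{1..<n}. \<forall>k\<in>{1..m}. acoord n m k y = 1) \<longleftrightarrow> (\<forall>j\<in>I. acoord_at n j y = 1)"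
  proof (intro iffI ballI)
    fix m k assume all: "\<forall>j\<in>I. acoord_at n j y = 1" and mk: "m \<in> {1..<n}" "k \<in> {1..m}"
    then have "dim_d (m - 1) + k \<in> I" unfolding I_def by (intro dim_d_ge_position) auto
    then have "acoord_at n (dim_d (m - 1) + k) y = 1" using all by blast
    then show "acoord n m k y = 1" unfolding acoord_at_def using mk level_index_eq[of k m] by auto
  qed (use range in \<open>auto simp: acoord_at_def\<close>)
  then show ?thesis
    using hessenberg_iff_acoord[of y n] M_Omega_eD(2)[of y n] unfolding M_Omega_e_b_def by blast
qed

lemma exp_flow_r_fun:
  assumes "j \<in> I" "y \<in> M_Omega_e n"
  shows "exp_flow n (r_fun j) q y = act n (level j) (index j) (exp q) y"
proof -
  have "r_fun j = (\<lambda>y. nu_entry (fst y) (index j) (level j))"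
    using assms(1) by (intro ext r_fun_eq) (simp add: I_def)
  then show ?thesis using exp_flow_nu[OF range(2,3)[OF assms(1)] assms(2)] by simp
qed

lemma foldr_exp_flow:
  assumes "y \<in> M_Omega_e n" "set js \<subseteq> I" "\<And>j. j \<in> I \<Longrightarrow> \<zeta> j = exp (q j)"
  shows "foldr (\<lambda>j. exp_flow n (r_fun j) (q j)) js y = foldr (act_at n \<zeta>) js y"
  using assms(2)
proof (induction js)
  case (Cons j js)
  have "foldr (act_at n \<zeta>) js y \<in> M_Omega_e n"
    using Cons.prems assms(3) by (intro foldr_act_in[OF assms(1)]) auto
  then have "exp_flow n (r_fun j) (q j) (foldr (act_at n \<zeta>) js y) =
      act_at n \<zeta> j (foldr (act_at n \<zeta>) js y)"
    using exp_flow_r_fun[of j] assms(3)[of j] Cons.prems by (simp add: act_at_def[of n \<zeta> j])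
  then show ?case using Cons by simp
qed simp

lemma set_positions: "set [1..<Suc (dim_d (n - 1))] = I"
  by (auto simp: I_def)

text \<open>Each flow depends on \<open>q j\<close> only through \<open>exp (q j)\<close>, so all
  choices of logarithms produce the same composition.\<close>

lemma torus_act_eq:
  assumes y: "y \<in> M_Omega_e n" and zeta: "\<And>j. j \<in> I \<Longrightarrow> \<zeta> j \<noteq> 0"
  shows "torus_act n \<zeta> y = foldr (act_at n \<zeta>) [1..<Suc (dim_d (n - 1))] y"
  unfolding torus_act_def
proof (rule the_equality)
  show "\<forall>q. (\<forall>j\<in>{1..dim_d (n - 1)}. \<zeta> j = exp (q j)) \<longrightarrow>
      foldr (act_at n \<zeta>) [1..<Suc (dim_d (n - 1))] y =
      foldr (\<lambda>j. exp_flow n (r_fun j) (q j)) [1..<Suc (dim_d (n - 1))] y"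
    using foldr_exp_flow[OF y, of "[1..<Suc (dim_d (n - 1))]" \<zeta>] set_positions
    by (auto simp: I_def simp del: upt_Suc)
next
  fix z
  assume z: "\<forall>q. (\<forall>j\<in>{1..dim_d (n - 1)}. \<zeta> j = exp (q j)) \<longrightarrow>
      z = foldr (\<lambda>j. exp_flow n (r_fun j) (q j)) [1..<Suc (dim_d (n - 1))] y"
  \<comment> \<open>Explicit logarithms of the coordinates: without an admissible \<open>q\<close>
    the assumption \<open>z\<close> would be vacuous and every point would satisfy it.\<close>
  define q where "q j = of_real (ln (cmod (\<zeta> j))) + \<i> * of_real (Arg (\<zeta> j))" for j
  have q: "\<zeta> j = exp (q j)" if "j \<in> I" for j
  proof -
    have "exp (q j) = of_real (cmod (\<zeta> j)) * cis (Arg (\<zeta> j))"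
      using zeta[OF that] by (simp add: q_def exp_add cis_conv_exp exp_of_real)
    then show ?thesis using rcis_cmod_Arg[of "\<zeta> j"] by (simp add: rcis_def)
  qed
  then have "z = foldr (\<lambda>j. exp_flow n (r_fun j) (q j)) [1..<Suc (dim_d (n - 1))] y"
    using z by (auto simp: I_def)
  also have "\<dots> = foldr (act_at n \<zeta>) [1..<Suc (dim_d (n - 1))] y"
    using q set_positions by (intro foldr_exp_flow[OF y]) auto
  finally show "z = foldr (act_at n \<zeta>) [1..<Suc (dim_d (n - 1))] y" .
qed

end

text \<open>A family of points of the covering that depends regularly on a parameter. Allowing any
  parameter space lets the same step handle the forward map, where the multipliers are torus
  coordinates, and its inverse, where they are the functions \<open>1 / a z j\<close> on the
  covering.\<close>

definition coord_regular :: "('a \<Rightarrow> complex) set \<Rightarrow> 'a set \<Rightarrow> nat \<Rightarrow> ('a \<Rightarrow> point) \<Rightarrow> bool" where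
  "coord_regular C X n Y \<longleftrightarrow> (\<forall>t\<in>X. Y t \<in> M_Omega_e n) \<and>
     (\<forall>g\<in>point_coords n. regular_on C X (\<lambda>t. g (Y t)))"

context
  fixes C :: "('a \<Rightarrow> complex) set" and X n Y m k
  assumes Y: "coord_regular C X n Y" and m: "m \<in> {1..n}" and k: "k \<in> {1..m}"
begin

interpretation function_ring "regular_on C X"
  by (rule function_ring_regular_on)

private lemma YM: "t \<in> X \<Longrightarrow> Y t \<in> M_Omega_e n"
  using Y by (simp add: coord_regular_def)

private lemma Y_coord: "g \<in> point_coords n \<Longrightarrow> regular_on C X (\<lambda>t. g (Y t))"
  using Y by (simp add: coord_regular_def)

private lemma Y_nu: "l \<in> {1..n} \<Longrightarrow> p \<in> {1..l} \<Longrightarrow> regular_on C X (\<lambda>t. nu_entry (fst (Y t)) p l)"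
  by (rule Y_coord[OF nu_coord])

private lemma Y_entry: "i < n \<Longrightarrow> j < n \<Longrightarrow> regular_on C X (\<lambda>t. proj (Y t) $$ (i, j))"
  by (rule Y_coord[OF entry_coord])

lemma regular_eproj:
  assumes "i < n" "j < n"
  shows "regular_on C X (\<lambda>t. eproj n m k (Y t) $$ (i, j))"
proof (rule Q_eproj[OF _ k])
  fix l assume l: "l \<in> {1..m}" "l \<noteq> k"
  have "nu_entry (fst (Y t)) k m - nu_entry (fst (Y t)) l m \<noteq> 0" if "t \<in> X" for t
    using inj_onD[OF e_Omega_inj[OF M_Omega_eD(1)[OF YM[OF that]] m]] l k by auto
  then show "regular_on C X (\<lambda>t. 1 / (nu_entry (fst (Y t)) k m - nu_entry (fst (Y t)) l m))"
    using l m k by (intro regular_on_divide Q_const Q_diff Y_nu) auto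
qed (use m assms Y_nu Y_entry in auto)

text \<open>Off \<open>X\<close> the values of \<open>Y\<close> are arbitrary, hence this copy of the matrix.\<close>

private definition "Z t = mat n n (\<lambda>(i, j). proj (Y t) $$ (i, j))"

private lemma Z: "Z t \<in> carrier_mat n n" "t \<in> X \<Longrightarrow> Z t = proj (Y t)"
  using carrier_matD[OF M_Omega_eD(3)[OF YM]] by (auto simp: Z_def intro!: eq_matI)

private lemma Z_entry: "i < n \<Longrightarrow> j < n \<Longrightarrow> regular_on C X (\<lambda>t. Z t $$ (i, j))"
  using Y_entry by (simp add: Z_def)

lemma regular_acoord:
  assumes "m < n"
  shows "regular_on C X (\<lambda>t. acoord n m k (Y t))"
proof -
  have "regular_on C X (\<lambda>t. (Z t * eproj n m k (Y t)) $$ (m, m - 1))"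
    using assms m by (intro Q_mult_mat[of _ n] Z Z_entry regular_eproj) auto
  moreover have "regular_on C X (\<lambda>t. eproj n m k (Y t) $$ (m - 1, m - 1))"
    using assms by (intro regular_eproj) auto
  ultimately have "regular_on C X (\<lambda>t. (Z t * eproj n m k (Y t)) $$ (m, m - 1) /
      eproj n m k (Y t) $$ (m - 1, m - 1))"
    by (rule regular_on_divide) (use eproj_corner_nonzero[OF YM m k] in auto)
  then show ?thesis
    by (rule regular_on_cong) (simp add: acoord_def Z(2))
qed

lemma coord_regular_act:
  assumes z: "regular_on C X z" "\<And>t. t \<in> X \<Longrightarrow> z t \<noteq> 0"
  shows "coord_regular C X n (\<lambda>t. act n m k (z t) (Y t))"
  unfolding coord_regular_def
proof (intro conjI ballI)
  fix t assume t: "t \<in> X"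
  show "act n m k (z t) (Y t) \<in> M_Omega_e n"
    using act_in[OF YM[OF t] m k z(2)[OF t]] .
next
  have g: "regular_on C X (\<lambda>t. gmat n (eproj n m k (Y t)) (w t) $$ (i, j))"
    if w: "regular_on C X w" and ij: "i < n" "j < n" for w i j
  proof -
    have "regular_on C X (\<lambda>t. (if i = j then 1 else 0) + (w t - 1) * eproj n m k (Y t) $$ (i, j))"
      by (intro Q_add Q_mult Q_diff Q_const w regular_eproj ij)
    then show ?thesis using ij by (simp add: gmat_def)
  qed
  fix f assume "f \<in> point_coords n"
  then consider l k' where "l \<in> {1..n}" "k' \<in> {1..l}" "f = (\<lambda>y. nu_entry (fst y) k' l)"
    | i j where "i < n" "j < n" "f = (\<lambda>y. proj y $$ (i, j))"
    unfolding point_coords_def by blast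
  then show "regular_on C X (\<lambda>t. f (act n m k (z t) (Y t)))"
  proof cases
    case 1
    then show ?thesis using Y_nu by simp
  next
    case 2
    let ?G = "\<lambda>w t. gmat n (eproj n m k (Y t)) (w t)"
    have "regular_on C X (\<lambda>t. 1 / z t)" using z by (intro regular_on_divide Q_const)
    then have "regular_on C X (\<lambda>t. (?G (\<lambda>t. 1 / z t) t * Z t * ?G z t) $$ (i, j))"
      using z(1) 2 by (intro Q_mult_mat[of _ n] g Z Z_entry gmat_carrier eproj_carrier mult_carrier_square)
    then show ?thesis
      by (rule regular_on_cong) (simp add: act_def 2(3) Z(2))
  qed
qed

end

lemma coord_regular_foldr:
  assumes "coord_regular C X n Y" "set js \<subseteq> {1..dim_d (n - 1)}"
    and "\<And>j. j \<in> set js \<Longrightarrow> regular_on C X (\<lambda>t. z t j)"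
    and "\<And>j t. j \<in> set js \<Longrightarrow> t \<in> X \<Longrightarrow> z t j \<noteq> 0"
  shows "coord_regular C X n (\<lambda>t. foldr (act_at n (z t)) js (Y t))"
  using assms(2-)
proof (induction js)
  case (Cons j js)
  then have "coord_regular C X n (\<lambda>t. foldr (act_at n (z t)) js (Y t))" by auto
  moreover have "act_at n (z t) j y = act n (level j) (index j) (z t j) y" for t y
    by (simp add: act_at_def)
  ultimately show ?case
    using coord_regular_act[of C X n _ "level j" "index j" "\<lambda>t. z t j"] Cons.prems
      level_index_range[of j n] by simp
qed (use assms(1) in simp)

lemma coord_regular_foldl:
  assumes "coord_regular C X n Y" "set js \<subseteq> {1..dim_d (n - 1)}"
    and "\<And>j. j \<in> set js \<Longrightarrow> regular_on C X (\<lambda>t. z t j)"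
    and "\<And>j t. j \<in> set js \<Longrightarrow> t \<in> X \<Longrightarrow> z t j \<noteq> 0"
  shows "coord_regular C X n (\<lambda>t. foldl (\<lambda>y j. act_at n (z t) j y) (Y t) js)"
  using assms
proof (induction js arbitrary: Y)
  case (Cons j js)
  have "coord_regular C X n (\<lambda>t. act_at n (z t) j (Y t))"
    unfolding act_at_def using Cons.prems level_index_range[of j n]
    by (intro coord_regular_act) auto
  from Cons.IH[OF this] show ?case using Cons.prems by simp
qed simp

theorem theorem5p12:
  fixes n :: nat
  assumes "n \<ge> 1"
  shows "algebraic_isomorphism
           (prod_coords (torus_coords n) (point_coords n)) (torus n \<times> M_Omega_e_b n)
           (point_coords n) (M_Omega_e n)
           (\<lambda>(b, y). torus_act n b y)"
proof -
  define js where "js = [1..<Suc (dim_d (n - 1))]"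
  let ?I = "{1..dim_d (n - 1)}"
  let ?C = "prod_coords (torus_coords n) (point_coords n)" and ?X = "torus n \<times> M_Omega_e_b n"
  let ?D = "point_coords n" and ?Y = "M_Omega_e n" and ?f = "\<lambda>(b, y). torus_act n b y"
  \<comment> \<open>The restriction makes the tuple \<open>undefined\<close> outside the index set,
    as elements of \<open>torus n\<close> are; this is what allows \<open>a\<close> to return the
    original torus element exactly.\<close>
  define a where "a z = (\<lambda>j\<in>?I. acoord_at n j z)" for z
  define g where "g z = (a z, foldl (\<lambda>y j. act_at n (\<lambda>j. 1 / a z j) j y) z js)" for z
  have js: "set js \<subseteq> ?I" "set js = ?I" "distinct js" by (auto simp: js_def)
  have b_nz: "b j \<noteq> 0" if "b \<in> torus n" "j \<in> ?I" for b j
    using that by (auto simp: torus_def)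
  have b_Y: "y \<in> ?Y" if "y \<in> M_Omega_e_b n" for y using that by (simp add: M_Omega_e_b_def)
  have a_nz: "a z j \<noteq> 0" if "z \<in> ?Y" "j \<in> ?I" for z j
    using acoord_at_nonzero that by (simp add: a_def)
  have f: "?f (b, y) = foldr (act_at n b) js y" if "b \<in> torus n" "y \<in> ?Y" for b y
    using torus_act_eq[OF that(2)] b_nz[OF that(1)] by (simp add: js_def)
  have morph_f: "morphism ?C ?X ?D ?Y ?f"
  proof (rule morphismI)
    have "regular_on ?C ?X (\<lambda>t. h (snd t))" if "h \<in> point_coords n" for h
      using regular_on_coord[of "h \<circ> snd" ?C ?X] that by (simp add: prod_coords_def o_def)
    then have "coord_regular ?C ?X n snd"
      using b_Y by (auto simp: coord_regular_def)
    moreover have "regular_on ?C ?X (\<lambda>t. fst t j)" if "j \<in> ?I" for j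
    proof -
      have "(\<lambda>\<zeta>. \<zeta> j) \<in> torus_coords n" using that by (auto simp: torus_coords_def)
      then have "(\<lambda>\<zeta>. \<zeta> j) \<circ> fst \<in> ?C" unfolding prod_coords_def by blast
      then show ?thesis using regular_on_coord[of "(\<lambda>\<zeta>. \<zeta> j) \<circ> fst" ?C ?X] by (simp add: o_def)
    qed
    ultimately have "coord_regular ?C ?X n (\<lambda>t. foldr (act_at n (fst t)) js (snd t))"
      using js b_nz by (intro coord_regular_foldr) auto
    then have reg: "t \<in> ?X \<Longrightarrow> foldr (act_at n (fst t)) js (snd t) \<in> ?Y"
      "h \<in> ?D \<Longrightarrow> regular_on ?C ?X (\<lambda>t. h (foldr (act_at n (fst t)) js (snd t)))" for t h
      unfolding coord_regular_def by blast+
    have f': "foldr (act_at n (fst t)) js (snd t) = ?f t" if "t \<in> ?X" for t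
      using f[of "fst t" "snd t"] that b_Y by auto
    show "?f \<in> ?X \<rightarrow> ?Y" using reg(1) f' by auto
    show "regular_on ?C ?X (\<lambda>t. h (?f t))" if "h \<in> ?D" for h
      by (rule regular_on_cong[OF reg(2)[OF that]]) (simp add: f')
  qed
  have g_in: "g z \<in> ?X" if z: "z \<in> ?Y" for z
  proof -
    have "snd (g z) \<in> ?Y"
      unfolding g_def snd_conv using js a_nz[OF z] by (intro foldl_act_in[OF z]) auto
    moreover have "acoord_at n i (snd (g z)) = 1" if i: "i \<in> ?I" for i
    proof -
      have "acoord_at n i (snd (g z)) = (if i \<in> set js then 1 / a z i else 1) * acoord_at n i z"
        unfolding g_def snd_conv using js a_nz[OF z] i by (intro acoord_at_foldl[OF z]) auto
      then show ?thesis using i a_nz[OF z i] js(2) by (simp add: a_def)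
    qed
    ultimately have "snd (g z) \<in> M_Omega_e_b n" by (simp add: M_Omega_e_b_iff)
    moreover have "fst (g z) \<in> torus n"
      using a_nz[OF z] by (auto simp: g_def torus_def a_def)
    ultimately show ?thesis by (simp add: mem_Times_iff)
  qed
  have morph_g: "morphism ?D ?Y ?C ?X g"
  proof (rule morphismI)
    have id: "coord_regular ?D ?Y n (\<lambda>z. z)"
      by (auto simp: coord_regular_def intro: regular_on_coord)
    have a_reg: "regular_on ?D ?Y (\<lambda>z. a z j)" if "j \<in> ?I" for j
      using regular_acoord[OF id level_index_range(2,3)[OF that]] level_index_range(1)[OF that] that
      by (simp add: a_def acoord_at_def)
    have "regular_on ?D ?Y (\<lambda>z. 1 / a z j)" if "j \<in> ?I" for j
      using a_reg[OF that] a_nz that by (intro regular_on_divide regular_on_const) auto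
    then have reg: "coord_regular ?D ?Y n (\<lambda>z. snd (g z))"
      unfolding g_def snd_conv using js a_nz by (intro coord_regular_foldl[OF id]) auto
    show "g \<in> ?Y \<rightarrow> ?X" using g_in by blast
    fix h assume "h \<in> ?C"
    then consider j where "j \<in> ?I" "h = (\<lambda>t. fst t j)" | h' where "h' \<in> ?D" "h = (\<lambda>t. h' (snd t))"
      by (auto simp: prod_coords_def torus_coords_def o_def)
    then show "regular_on ?D ?Y (\<lambda>z. h (g z))"
    proof cases
      case 1
      then show ?thesis using a_reg by (simp add: g_def)
    next
      case 2
      then show ?thesis using reg by (simp add: coord_regular_def)
    qed
  qed
  have "g (?f (b, y)) = (b, y)" if b: "b \<in> torus n" and y: "y \<in> M_Omega_e_b n" for b y
  proof -
    have "acoord_at n j (?f (b, y)) = b j" if "j \<in> ?I" for j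
      using acoord_at_foldr[OF b_Y[OF y] js(1,3) that b_nz[OF b]] M_Omega_e_b_iff y that js(2)
      unfolding f[OF b b_Y[OF y]] by auto
    then have "a (?f (b, y)) = restrict b ?I" by (auto simp: a_def)
    then have ab: "a (?f (b, y)) = b" using b unfolding torus_def by (simp add: PiE_restrict)
    have "foldl (\<lambda>y j. act_at n (\<lambda>j. 1 / b j) j y) (?f (b, y)) js = y"
      unfolding f[OF b b_Y[OF y]] using b_nz[OF b] by (intro foldl_foldr_act[OF b_Y[OF y] js(1)])
    then show ?thesis unfolding g_def ab by simp
  qed
  moreover have "?f (g z) = z" if z: "z \<in> ?Y" for z
  proof -
    have gz: "fst (g z) \<in> torus n" "snd (g z) \<in> ?Y" using g_in[OF z] b_Y by auto
    have "?f (g z) = foldr (act_at n (fst (g z))) js (snd (g z))"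
      using f[OF gz] by simp
    also have "\<dots> = z"
      unfolding g_def fst_conv snd_conv using a_nz[OF z] by (intro foldr_foldl_act[OF z js(1)])
    finally show ?thesis .
  qed
  ultimately show ?thesis
    unfolding algebraic_isomorphism_def using morph_f morph_g by (intro conjI exI[of _ g]) auto
qed

end
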